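(* Let $X$ be a rigid decomposition groupoid. Then the mapping groupoid $\operatorname{map}(X,U)$, whose objects are the strict culf maps from $X$ to the pseudo-simplicial groupoid $U$ of subdivided discrete algebraic intervals and whose arrows are the invertible modifications, is contractible (i.e. equivalent to the terminal groupoid).
   Context: **Simplicial conventions.** $\Delta$ is the category of nonempty finite ordinals $[n]=\{0<\dots<n\}$ and monotone maps. A map $g:[m]\to[n]$ is *active* if $g(0)=0$ and $g(m)=n$; it is *inert* if $g(i+1)=g(i)+1$ for all $0\le i<m$. Pushouts in $\Delta$ of active maps along inert maps exist. A simplicial groupoid is a strict functor $\Delta^{\mathrm{op}}\to\mathbf{Grpd}$; sets are regarded as discrete groupoids, and $\Delta^n$ is the standard $n$-simplex. An $n$-simplex of $X$ is an object $\lambda$ of $X_n$, equivalently a simplicial map $\lambda:\Delta^n\to X$. Its long edge $\operatorname{long}(\lambda)\in X_1$ is its image under the unique active map $[1]\to[n]$. Write $d_\bot=d_0$ and $d_\top=d_n$ for the outer face maps. **Rigid decomposition groupoids.** A simplicial groupoid $X$ is a *rigid decomposition groupoid* if (i) $d_1:X_2\to X_1$ is a discrete fibration, (ii) $s_0:X_0\to X_1$ is fully faithful, (iii) $X$ sends every pushout square in $\Delta$ of an active map along an inert map to a strict pullback of groupoids. **Discrete algebraic intervals.** A discrete algebraic interval is a simplicial set $A$ satisfying the strict Segal condition $A_n\cong A_1\times_{A_0}\cdots\times_{A_0}A_1$ (i.e. isomorphic to the nerve of a category), together with a chosen initial object $\bot\in A_0$ and a chosen terminal object $\top\in A_0$.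 Each $\Delta^n$ is one, with $\bot=0$, $\top=n$. A simplicial map between discrete algebraic intervals is *stretched* if it preserves the chosen initial and the chosen terminal objects. A simplicial map of simplicial sets is *strict culf* if its naturality square on every active map is a pullback. Every simplicial map between discrete algebraic intervals factors, uniquely up to unique isomorphism, as a stretched map followed by a strict culf map, and stretched maps are orthogonal to strict culf maps. **The pseudo-simplicial groupoid $U$.** $U:\Delta^{\mathrm{op}}\to\widehat{\mathbf{Grpd}}$ (large groupoids) is the pseudofunctor where $U_n$ has as objects the stretched maps $a:\Delta^n\to A$ with $A$ a discrete algebraic interval, and as arrows $(a:\Delta^n\to A)\to(b:\Delta^n\to B)$ the isomorphisms $F:A\to B$ with $Fa=b$. For $p:[m]\to[n]$, the functor $p^*:U_n\to U_m$ sends $a:\Delta^n\to A$ to the stretched part $\Delta^m\to A'$ of a chosen stretched–culf factorisation $\Delta^m\to A'\to A$ of $a\circ p$, and acts on arrows by orthogonality; the coherence isomorphisms are the unique comparison isomorphisms of factorisations. If $p$ is active then $a\circ p$ is already stretched and the choice is $A'=A$ with the identity map to $A$, so $U$ is strict on active maps. **Strict culf maps to $U$.** A strict culf map $J:X\to U$ is a pseudonatural transformation from $X$ to $U$ (as pseudofunctors on $\Delta^{\mathrm{op}}$) whose structure isomorphisms are identities on active maps, and such that for every active $p:[m]\to[n]$ the square formed by $p^*:X_n\to X_m$, $p^*:U_n\to U_m$, $J_n$, $J_m$ is a strict pullback. A modification $\Gamma:J\Rightarrow J'$ is a family of natural transformations $\Gamma_n:J_n\Rightarrow J'_n$ compatible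 with the structure isomorphisms for all maps of $\Delta$. *)

theory Defs
  imports Main "HOL-Library.FuncSet" "HOL-Library.Equipollence"
begin

section \<open>Groupoids and functors\<close>

text \<open>Composition is written in applicative order: \<open>Comp C g f\<close> is \<open>g\<close> after \<open>f\<close>.
  All functions on carriers are kept extensional (in the sense of \<open>HOL-Library.FuncSet\<close>),
  so that HOL equality of functors, simplicial maps, etc. is the intended strict equality.\<close>

record ('o, 'a) category =
  Obj :: "'o set"
  Arr :: "'a set"
  Src :: "'a \<Rightarrow> 'o"
  Tgt :: "'a \<Rightarrow> 'o"
  Unit :: "'o \<Rightarrow> 'a"
  Comp :: "'a \<Rightarrow> 'a \<Rightarrow> 'a"

definition hom :: "('o, 'a) category \<Rightarrow> 'o \<Rightarrow> 'o \<Rightarrow> 'a set" where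
  "hom C x y = {f \<in> Arr C. Src C f = x \<and> Tgt C f = y}"

definition is_category :: "('o, 'a) category \<Rightarrow> bool" where
  "is_category C \<longleftrightarrow>
     (\<forall>f \<in> Arr C. Src C f \<in> Obj C \<and> Tgt C f \<in> Obj C) \<and>
     (\<forall>x \<in> Obj C. Unit C x \<in> hom C x x) \<and>
     (\<forall>x \<in> Obj C. \<forall>y \<in> Obj C. \<forall>z \<in> Obj C. \<forall>f \<in> hom C x y. \<forall>g \<in> hom C y z.
        Comp C g f \<in> hom C x z) \<and>
     (\<forall>x \<in> Obj C. \<forall>y \<in> Obj C. \<forall>f \<in> hom C x y.
        Comp C f (Unit C x) = f \<and> Comp C (Unit C y) f = f) \<and>
     (\<forall>w \<in> Obj C. \<forall>x \<in> Obj C. \<forall>y \<in> Obj C. \<forall>z \<in> Obj C.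
        \<forall>f \<in> hom C w x. \<forall>g \<in> hom C x y. \<forall>h \<in> hom C y z.
        Comp C h (Comp C g f) = Comp C (Comp C h g) f)"

definition invertible :: "('o, 'a) category \<Rightarrow> 'a \<Rightarrow> bool" where
  "invertible C f \<longleftrightarrow> f \<in> Arr C \<and>
     (\<exists>g \<in> hom C (Tgt C f) (Src C f).
        Comp C g f = Unit C (Src C f) \<and> Comp C f g = Unit C (Tgt C f))"

definition is_groupoid :: "('o, 'a) category \<Rightarrow> bool" where
  "is_groupoid C \<longleftrightarrow> is_category C \<and> (\<forall>f \<in> Arr C. invertible C f)"

record ('o, 'a, 'p, 'b) cfunctor =
  ob_map :: "'o \<Rightarrow> 'p"
  arr_map :: "'a \<Rightarrow> 'b"

definition is_functor ::
  "('o, 'a) category \<Rightarrow> ('p, 'b) category \<Rightarrow> ('o, 'a, 'p, 'b) cfunctor \<Rightarrow> bool" where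
  "is_functor C D F \<longleftrightarrow>
     ob_map F \<in> Obj C \<rightarrow>\<^sub>E Obj D \<and>
     arr_map F \<in> Arr C \<rightarrow>\<^sub>E Arr D \<and>
     (\<forall>f \<in> Arr C. Src D (arr_map F f) = ob_map F (Src C f) \<and>
                  Tgt D (arr_map F f) = ob_map F (Tgt C f)) \<and>
     (\<forall>x \<in> Obj C. arr_map F (Unit C x) = Unit D (ob_map F x)) \<and>
     (\<forall>f \<in> Arr C. \<forall>g \<in> Arr C. Tgt C f = Src C g \<longrightarrow>
        arr_map F (Comp C g f) = Comp D (arr_map F g) (arr_map F f))"

definition id_functor :: "('o, 'a) category \<Rightarrow> ('o, 'a, 'o, 'a) cfunctor" where
  "id_functor C = \<lparr>ob_map = (\<lambda>x\<in>Obj C. x), arr_map = (\<lambda>f\<in>Arr C. f)\<rparr>"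

definition comp_functor ::
  "('o, 'a) category \<Rightarrow> ('p, 'b, 'q, 'c) cfunctor \<Rightarrow> ('o, 'a, 'p, 'b) cfunctor
    \<Rightarrow> ('o, 'a, 'q, 'c) cfunctor" where
  "comp_functor C G F = \<lparr>ob_map = compose (Obj C) (ob_map G) (ob_map F),
                         arr_map = compose (Arr C) (arr_map G) (arr_map F)\<rparr>"

definition nat_isomorphic ::
  "('o, 'a) category \<Rightarrow> ('p, 'b) category \<Rightarrow> ('o, 'a, 'p, 'b) cfunctor
    \<Rightarrow> ('o, 'a, 'p, 'b) cfunctor \<Rightarrow> bool" where
  "nat_isomorphic C D F G \<longleftrightarrow>
     (\<exists>t. (\<forall>x \<in> Obj C. t x \<in> hom D (ob_map F x) (ob_map G x) \<and> invertible D (t x)) \<and>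
          (\<forall>f \<in> Arr C. Comp D (t (Tgt C f)) (arr_map F f)
                     = Comp D (arr_map G f) (t (Src C f))))"

definition equivalent :: "('o, 'a) category \<Rightarrow> ('p, 'b) category \<Rightarrow> bool" where
  "equivalent C D \<longleftrightarrow>
     (\<exists>F G. is_functor C D F \<and> is_functor D C G \<and>
        nat_isomorphic C C (comp_functor C G F) (id_functor C) \<and>
        nat_isomorphic D D (comp_functor D F G) (id_functor D))"

definition terminal_groupoid :: "(unit, unit) category" where
  "terminal_groupoid = \<lparr>Obj = UNIV, Arr = UNIV, Src = (\<lambda>_. ()), Tgt = (\<lambda>_. ()),
     Unit = (\<lambda>_. ()), Comp = (\<lambda>_ _. ())\<rparr>"

definition contractible_groupoid :: "('o, 'a) category \<Rightarrow> bool" where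
  "contractible_groupoid C \<longleftrightarrow> is_groupoid C \<and> equivalent C terminal_groupoid"

definition discrete_fibration ::
  "('o, 'a) category \<Rightarrow> ('p, 'b) category \<Rightarrow> ('o, 'a, 'p, 'b) cfunctor \<Rightarrow> bool" where
  "discrete_fibration E B F \<longleftrightarrow> is_functor E B F \<and>
     (\<forall>e \<in> Obj E. \<forall>f \<in> Arr B. Tgt B f = ob_map F e \<longrightarrow>
        (\<exists>!g. g \<in> Arr E \<and> Tgt E g = e \<and> arr_map F g = f))"

definition fully_faithful ::
  "('o, 'a) category \<Rightarrow> ('p, 'b) category \<Rightarrow> ('o, 'a, 'p, 'b) cfunctor \<Rightarrow> bool" where
  "fully_faithful C D F \<longleftrightarrow> is_functor C D F \<and>
     (\<forall>x \<in> Obj C. \<forall>y \<in> Obj C.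
        bij_betw (arr_map F) (hom C x y) (hom D (ob_map F x) (ob_map F y)))"

text \<open>The square of sets \<open>P \<rightarrow> B\<close> (\<open>p\<close>), \<open>P \<rightarrow> C\<close> (\<open>q\<close>), \<open>B \<rightarrow> D\<close> (\<open>h\<close>), \<open>C \<rightarrow> D\<close> (\<open>k\<close>)
  is a pullback; commutativity is implied.\<close>

definition set_pullback ::
  "'p set \<Rightarrow> 'b set \<Rightarrow> 'c set \<Rightarrow> ('p \<Rightarrow> 'b) \<Rightarrow> ('p \<Rightarrow> 'c) \<Rightarrow> ('b \<Rightarrow> 'd) \<Rightarrow> ('c \<Rightarrow> 'd) \<Rightarrow> bool" where
  "set_pullback P B C p q h k \<longleftrightarrow>
     bij_betw (\<lambda>x. (p x, q x)) P {(b, c). b \<in> B \<and> c \<in> C \<and> h b = k c}"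

text \<open>A functor to the strict fibre product groupoid is an isomorphism iff it is bijective
  on objects and on arrows.\<close>

definition strict_pullback ::
  "('o1, 'a1) category \<Rightarrow> ('o2, 'a2) category \<Rightarrow> ('o3, 'a3) category
    \<Rightarrow> ('o1, 'a1, 'o2, 'a2) cfunctor \<Rightarrow> ('o1, 'a1, 'o3, 'a3) cfunctor
    \<Rightarrow> ('o2, 'a2, 'o4, 'a4) cfunctor \<Rightarrow> ('o3, 'a3, 'o4, 'a4) cfunctor \<Rightarrow> bool" where
  "strict_pullback P B C F G H K \<longleftrightarrow>
     set_pullback (Obj P) (Obj B) (Obj C) (ob_map F) (ob_map G) (ob_map H) (ob_map K) \<and>
     set_pullback (Arr P) (Arr B) (Arr C) (arr_map F) (arr_map G) (arr_map H) (arr_map K)"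


section \<open>The simplex category\<close>

text \<open>\<open>Delta m n\<close> is the set of monotone maps \<open>[m] \<rightarrow> [n]\<close>; the composite of
  \<open>q \<in> Delta l m\<close> and \<open>p \<in> Delta m n\<close> is \<open>compose {..l} p q\<close>.\<close>

definition Delta :: "nat \<Rightarrow> nat \<Rightarrow> (nat \<Rightarrow> nat) set" where
  "Delta m n = {p \<in> {..m} \<rightarrow>\<^sub>E {..n}. mono_on {..m} p}"

definition delta_id :: "nat \<Rightarrow> nat \<Rightarrow> nat" where
  "delta_id n = (\<lambda>k\<in>{..n}. k)"

definition active :: "nat \<Rightarrow> nat \<Rightarrow> (nat \<Rightarrow> nat) \<Rightarrow> bool" where
  "active m n p \<longleftrightarrow> p \<in> Delta m n \<and> p 0 = 0 \<and> p m = n"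

definition inert :: "nat \<Rightarrow> nat \<Rightarrow> (nat \<Rightarrow> nat) \<Rightarrow> bool" where
  "inert m n p \<longleftrightarrow> p \<in> Delta m n \<and> (\<forall>i < m. p (i + 1) = p i + 1)"

text \<open>\<open>coface n i : [n] \<rightarrow> [n + 1]\<close> omits the value \<open>i\<close>.\<close>

definition coface :: "nat \<Rightarrow> nat \<Rightarrow> nat \<Rightarrow> nat" where
  "coface n i = (\<lambda>k\<in>{..n}. if k < i then k else Suc k)"

definition codegen0 :: "nat \<Rightarrow> nat" where
  "codegen0 = (\<lambda>k\<in>{..1}. 0)"

definition delta_pushout ::
  "nat \<Rightarrow> nat \<Rightarrow> nat \<Rightarrow> nat \<Rightarrow> (nat \<Rightarrow> nat) \<Rightarrow> (nat \<Rightarrow> nat) \<Rightarrow> (nat \<Rightarrow> nat) \<Rightarrow> (nat \<Rightarrow> nat) \<Rightarrow> bool" where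
  "delta_pushout k m n l g f f' g' \<longleftrightarrow>
     g \<in> Delta k m \<and> f \<in> Delta k n \<and> f' \<in> Delta m l \<and> g' \<in> Delta n l \<and>
     compose {..k} f' g = compose {..k} g' f \<and>
     (\<forall>e. \<forall>u \<in> Delta m e. \<forall>v \<in> Delta n e.
        compose {..k} u g = compose {..k} v f \<longrightarrow>
        (\<exists>!h. h \<in> Delta l e \<and> compose {..m} h f' = u \<and> compose {..n} h g' = v))"


section \<open>Simplicial groupoids\<close>

text \<open>For \<open>p \<in> Delta m n\<close>, \<open>pull X m n p\<close> is the functor \<open>X\<^sub>n \<rightarrow> X\<^sub>m\<close>.\<close>

record ('o, 'a) simplicial =
  level :: "nat \<Rightarrow> ('o, 'a) category"
  pull :: "nat \<Rightarrow> nat \<Rightarrow> (nat \<Rightarrow> nat) \<Rightarrow> ('o, 'a, 'o, 'a) cfunctor"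

definition simplicial_groupoid :: "('o, 'a) simplicial \<Rightarrow> bool" where
  "simplicial_groupoid X \<longleftrightarrow>
     (\<forall>n. is_groupoid (level X n)) \<and>
     (\<forall>m n. \<forall>p \<in> Delta m n. is_functor (level X n) (level X m) (pull X m n p)) \<and>
     (\<forall>n. pull X n n (delta_id n) = id_functor (level X n)) \<and>
     (\<forall>l m n. \<forall>q \<in> Delta l m. \<forall>p \<in> Delta m n.
        pull X l n (compose {..l} p q)
          = comp_functor (level X n) (pull X l m q) (pull X m n p))"

definition rigid_decomposition_groupoid :: "('o, 'a) simplicial \<Rightarrow> bool" where
  "rigid_decomposition_groupoid X \<longleftrightarrow>
     simplicial_groupoid X \<and>
     discrete_fibration (level X 2) (level X 1) (pull X 1 2 (coface 1 1)) \<and>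
     fully_faithful (level X 0) (level X 1) (pull X 1 0 codegen0) \<and>
     (\<forall>k m n l g f f' g'.
        active k m g \<longrightarrow> inert k n f \<longrightarrow> delta_pushout k m n l g f f' g' \<longrightarrow>
        strict_pullback (level X l) (level X m) (level X n)
          (pull X m l f') (pull X n l g') (pull X k m g) (pull X k n f))"


section \<open>Simplicial sets and discrete algebraic intervals\<close>

text \<open>For \<open>p \<in> Delta m n\<close>, \<open>act A m n p\<close> is the map \<open>A\<^sub>n \<rightarrow> A\<^sub>m\<close>.\<close>

record 's sset =
  simps :: "nat \<Rightarrow> 's set"
  act :: "nat \<Rightarrow> nat \<Rightarrow> (nat \<Rightarrow> nat) \<Rightarrow> 's \<Rightarrow> 's"

definition simplicial_set :: "('s, 'z) sset_scheme \<Rightarrow> bool" where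
  "simplicial_set A \<longleftrightarrow>
     (\<forall>m n. \<forall>p \<in> Delta m n. act A m n p \<in> simps A n \<rightarrow>\<^sub>E simps A m) \<and>
     (\<forall>m n p. p \<notin> Delta m n \<longrightarrow> act A m n p = (\<lambda>_. undefined)) \<and>
     (\<forall>n. \<forall>x \<in> simps A n. act A n n (delta_id n) x = x) \<and>
     (\<forall>l m n. \<forall>q \<in> Delta l m. \<forall>p \<in> Delta m n. \<forall>x \<in> simps A n.
        act A l n (compose {..l} p q) x = act A l m q (act A m n p x))"

abbreviation edge_source :: "('s, 'z) sset_scheme \<Rightarrow> 's \<Rightarrow> 's" where
  "edge_source A e \<equiv> act A 0 1 (coface 0 1) e"

abbreviation edge_target :: "('s, 'z) sset_scheme \<Rightarrow> 's \<Rightarrow> 's" where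
  "edge_target A e \<equiv> act A 0 1 (coface 0 0) e"

text \<open>The map sending an \<open>n\<close>-simplex to its spine \<open>(0 \<rightarrow> 1, \<dots>, n - 1 \<rightarrow> n)\<close> is a bijection
  onto the composable chains. For \<open>n = 0\<close> the iterated fibre product is \<open>A\<^sub>0\<close> by convention
  and there is no condition.\<close>

definition strict_segal :: "('s, 'z) sset_scheme \<Rightarrow> bool" where
  "strict_segal A \<longleftrightarrow>
     (\<forall>n \<ge> 1. bij_betw
        (\<lambda>x. \<lambda>i\<in>{..<n}. act A 1 n (\<lambda>k\<in>{..1}. i + k) x)
        (simps A n)
        {e \<in> {..<n} \<rightarrow>\<^sub>E simps A 1.
           \<forall>i. Suc i < n \<longrightarrow> edge_target A (e i) = edge_source A (e (Suc i))})"

record 's interval = "'s sset" +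
  Bot :: 's
  Top :: 's

definition discrete_algebraic_interval :: "'s interval \<Rightarrow> bool" where
  "discrete_algebraic_interval A \<longleftrightarrow>
     simplicial_set A \<and> strict_segal A \<and> Bot A \<in> simps A 0 \<and> Top A \<in> simps A 0 \<and>
     (\<forall>x \<in> simps A 0. \<exists>!e. e \<in> simps A 1 \<and> edge_source A e = Bot A \<and> edge_target A e = x) \<and>
     (\<forall>x \<in> simps A 0. \<exists>!e. e \<in> simps A 1 \<and> edge_source A e = x \<and> edge_target A e = Top A)"

text \<open>A simplicial map \<open>\<phi>\<close> has components \<open>\<phi> n : A\<^sub>n \<rightarrow> B\<^sub>n\<close>.\<close>

definition simplicial_map ::
  "('s, 'y) sset_scheme \<Rightarrow> ('t, 'z) sset_scheme \<Rightarrow> (nat \<Rightarrow> 's \<Rightarrow> 't) \<Rightarrow> bool" where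
  "simplicial_map A B \<phi> \<longleftrightarrow>
     (\<forall>n. \<phi> n \<in> simps A n \<rightarrow>\<^sub>E simps B n) \<and>
     (\<forall>m n. \<forall>p \<in> Delta m n. \<forall>x \<in> simps A n. \<phi> m (act A m n p x) = act B m n p (\<phi> n x))"

definition simp_id :: "('s, 'y) sset_scheme \<Rightarrow> nat \<Rightarrow> 's \<Rightarrow> 's" where
  "simp_id A = (\<lambda>n. \<lambda>x\<in>simps A n. x)"

definition simp_comp ::
  "('s, 'y) sset_scheme \<Rightarrow> (nat \<Rightarrow> 't \<Rightarrow> 'u) \<Rightarrow> (nat \<Rightarrow> 's \<Rightarrow> 't) \<Rightarrow> nat \<Rightarrow> 's \<Rightarrow> 'u" where
  "simp_comp A \<psi> \<phi> = (\<lambda>n. compose (simps A n) (\<psi> n) (\<phi> n))"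

definition simplicial_iso ::
  "('s, 'y) sset_scheme \<Rightarrow> ('t, 'z) sset_scheme \<Rightarrow> (nat \<Rightarrow> 's \<Rightarrow> 't) \<Rightarrow> bool" where
  "simplicial_iso A B \<phi> \<longleftrightarrow> simplicial_map A B \<phi> \<and>
     (\<exists>\<psi>. simplicial_map B A \<psi> \<and> simp_comp A \<psi> \<phi> = simp_id A \<and> simp_comp B \<phi> \<psi> = simp_id B)"

definition stretched :: "'s interval \<Rightarrow> 't interval \<Rightarrow> (nat \<Rightarrow> 's \<Rightarrow> 't) \<Rightarrow> bool" where
  "stretched A B \<phi> \<longleftrightarrow> simplicial_map A B \<phi> \<and> \<phi> 0 (Bot A) = Bot B \<and> \<phi> 0 (Top A) = Top B"

definition strict_culf ::
  "('s, 'y) sset_scheme \<Rightarrow> ('t, 'z) sset_scheme \<Rightarrow> (nat \<Rightarrow> 's \<Rightarrow> 't) \<Rightarrow> bool" where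
  "strict_culf A B \<phi> \<longleftrightarrow> simplicial_map A B \<phi> \<and>
     (\<forall>m n p. active m n p \<longrightarrow>
        set_pullback (simps A n) (simps A m) (simps B n)
          (act A m n p) (\<phi> n) (\<phi> m) (act B m n p))"

definition std_simplex :: "nat \<Rightarrow> (nat \<Rightarrow> nat) interval" where
  "std_simplex n =
     \<lparr>simps = (\<lambda>k. Delta k n),
      act = (\<lambda>m k p. if p \<in> Delta m k then (\<lambda>q\<in>Delta k n. compose {..m} q p) else (\<lambda>_. undefined)),
      Bot = (\<lambda>i\<in>{..0}. 0),
      Top = (\<lambda>i\<in>{..0}. n)\<rparr>"

definition std_map :: "nat \<Rightarrow> nat \<Rightarrow> (nat \<Rightarrow> nat) \<Rightarrow> nat \<Rightarrow> (nat \<Rightarrow> nat) \<Rightarrow> (nat \<Rightarrow> nat)" where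
  "std_map m n p = (\<lambda>k. \<lambda>q\<in>Delta k m. compose {..k} p q)"


section \<open>The pseudo-simplicial groupoid of subdivided discrete algebraic intervals\<close>

text \<open>A pseudofunctor on the opposite of the simplex category: for \<open>q \<in> Delta l m\<close>,
  \<open>p \<in> Delta m n\<close> and an object \<open>x\<close> of level \<open>n\<close>, \<open>coh U l m n q p x\<close> is the coherence
  isomorphism \<open>q\<^sup>* (p\<^sup>* x) \<rightarrow> (p q)\<^sup>* x\<close>. There is no field for unit constraints since
  only pseudofunctors that are strict on active maps, in particular strictly unital, occur.\<close>

record ('o, 'a) pseudo_simplicial = "('o, 'a) simplicial" +
  coh :: "nat \<Rightarrow> nat \<Rightarrow> nat \<Rightarrow> (nat \<Rightarrow> nat) \<Rightarrow> (nat \<Rightarrow> nat) \<Rightarrow> 'o \<Rightarrow> 'a"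

text \<open>The type \<open>'u\<close> plays the role of the universe: the simplices of the intervals \<open>A\<close>
  below are taken from \<open>'u\<close>.\<close>

type_synonym 'u smap = "nat \<Rightarrow> 'u \<Rightarrow> 'u"
type_synonym 'u subdiv = "'u interval \<times> (nat \<Rightarrow> (nat \<Rightarrow> nat) \<Rightarrow> 'u)"
type_synonym 'u subdiv_arr = "'u subdiv \<times> 'u subdiv \<times> 'u smap"

definition U_obj :: "nat \<Rightarrow> 'u subdiv set" where
  "U_obj n = {(A, a). discrete_algebraic_interval A \<and> stretched (std_simplex n) A a}"

definition U_arr :: "nat \<Rightarrow> 'u subdiv_arr set" where
  "U_arr n = {((A, a), (B, b), F). (A, a) \<in> U_obj n \<and> (B, b) \<in> U_obj n \<and>
                simplicial_iso A B F \<and> simp_comp (std_simplex n) F a = b}"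

definition U_level :: "nat \<Rightarrow> ('u subdiv, 'u subdiv_arr) category" where
  "U_level n =
     \<lparr>Obj = U_obj n,
      Arr = U_arr n,
      Src = (\<lambda>(x, y, F). x),
      Tgt = (\<lambda>(x, y, F). y),
      Unit = (\<lambda>x. (x, x, simp_id (fst x))),
      Comp = (\<lambda>(y, z, G) (x, y', F). (x, z, simp_comp (fst x) G F))\<rparr>"

text \<open>A choice of stretched-culf factorisations: for \<open>p \<in> Delta m n\<close> and \<open>(A, a)\<close> in \<open>U\<^sub>n\<close>,
  \<open>ch m n p (A, a) = ((A', a'), c)\<close> with \<open>a' : \<Delta>\<^sup>m \<rightarrow> A'\<close> stretched, \<open>c : A' \<rightarrow> A\<close> culf and
  \<open>c a' = a p\<close>.\<close>

type_synonym 'u choice = "nat \<Rightarrow> nat \<Rightarrow> (nat \<Rightarrow> nat) \<Rightarrow> 'u subdiv \<Rightarrow> 'u subdiv \<times> 'u smap"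

definition factorisation_choice :: "'u choice \<Rightarrow> bool" where
  "factorisation_choice ch \<longleftrightarrow>
     (\<forall>m n p A a A' a' c. p \<in> Delta m n \<longrightarrow> (A, a) \<in> U_obj n \<longrightarrow>
        ch m n p (A, a) = ((A', a'), c) \<longrightarrow>
          discrete_algebraic_interval A' \<and>
          stretched (std_simplex m) A' a' \<and>
          strict_culf A' A c \<and>
          simp_comp (std_simplex m) c a' = simp_comp (std_simplex m) a (std_map m n p) \<and>
          (active m n p \<longrightarrow> A' = A \<and> c = simp_id A))"

abbreviation ch_mid :: "'u choice \<Rightarrow> nat \<Rightarrow> nat \<Rightarrow> (nat \<Rightarrow> nat) \<Rightarrow> 'u subdiv \<Rightarrow> 'u subdiv" where
  "ch_mid ch m n p x \<equiv> fst (ch m n p x)"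

abbreviation ch_culf :: "'u choice \<Rightarrow> nat \<Rightarrow> nat \<Rightarrow> (nat \<Rightarrow> nat) \<Rightarrow> 'u subdiv \<Rightarrow> 'u smap" where
  "ch_culf ch m n p x \<equiv> snd (ch m n p x)"

text \<open>The unique filler, given by orthogonality of the stretched map \<open>a : \<Delta>\<^sup>m \<rightarrow> A\<close> to the
  culf map \<open>c : B \<rightarrow> C\<close>, for a commutative square with \<open>b : \<Delta>\<^sup>m \<rightarrow> B\<close> and \<open>u : A \<rightarrow> C\<close>.\<close>

definition filler :: "nat \<Rightarrow> 'u subdiv \<Rightarrow> 'u subdiv \<Rightarrow> 'u smap \<Rightarrow> 'u smap \<Rightarrow> 'u smap" where
  "filler m = (\<lambda>(A, a) (B, b) u c.
     THE G. simplicial_map A B G \<and> simp_comp (std_simplex m) G a = b \<and> simp_comp A c G = u)"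

definition U_pull :: "'u choice \<Rightarrow> nat \<Rightarrow> nat \<Rightarrow> (nat \<Rightarrow> nat)
    \<Rightarrow> ('u subdiv, 'u subdiv_arr, 'u subdiv, 'u subdiv_arr) cfunctor" where
  "U_pull ch m n p =
     \<lparr>ob_map = (\<lambda>x\<in>U_obj n. ch_mid ch m n p x),
      arr_map = (\<lambda>(x, y, F)\<in>U_arr n.
        (let x' = ch_mid ch m n p x; y' = ch_mid ch m n p y
         in (x', y',
             filler m x' y' (simp_comp (fst x') F (ch_culf ch m n p x)) (ch_culf ch m n p y))))\<rparr>"

definition U_coh :: "'u choice \<Rightarrow> nat \<Rightarrow> nat \<Rightarrow> nat \<Rightarrow> (nat \<Rightarrow> nat) \<Rightarrow> (nat \<Rightarrow> nat)
    \<Rightarrow> 'u subdiv \<Rightarrow> 'u subdiv_arr" where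
  "U_coh ch l m n q p x =
     (let x' = ch_mid ch m n p x; x'' = ch_mid ch l m q x';
          y = ch_mid ch l n (compose {..l} p q) x
      in (x'', y,
          filler l x'' y
            (simp_comp (fst x'') (ch_culf ch m n p x) (ch_culf ch l m q x'))
            (ch_culf ch l n (compose {..l} p q) x)))"

definition U_groupoid :: "'u choice \<Rightarrow> ('u subdiv, 'u subdiv_arr) pseudo_simplicial" where
  "U_groupoid ch = \<lparr>level = U_level, pull = U_pull ch, coh = U_coh ch\<rparr>"


section \<open>Strict culf maps and modifications\<close>

text \<open>For \<open>p \<in> Delta m n\<close> and an object \<open>x\<close> of \<open>X\<^sub>n\<close>, \<open>struct_iso J m n p x\<close> is the structure
  isomorphism \<open>p\<^sup>* (J\<^sub>n x) \<rightarrow> J\<^sub>m (p\<^sup>* x)\<close>.\<close>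

record ('o, 'a, 'p, 'b) pseudonat =
  cmpt :: "nat \<Rightarrow> ('o, 'a, 'p, 'b) cfunctor"
  struct_iso :: "nat \<Rightarrow> nat \<Rightarrow> (nat \<Rightarrow> nat) \<Rightarrow> 'o \<Rightarrow> 'b"

definition pseudonatural ::
  "('o, 'a) simplicial \<Rightarrow> ('p, 'b) pseudo_simplicial \<Rightarrow> ('o, 'a, 'p, 'b) pseudonat \<Rightarrow> bool" where
  "pseudonatural X U J \<longleftrightarrow>
     (\<forall>n. is_functor (level X n) (level U n) (cmpt J n)) \<and>
     (\<forall>m n p. p \<notin> Delta m n \<longrightarrow> struct_iso J m n p = (\<lambda>_. undefined)) \<and>
     (\<forall>m n. \<forall>p \<in> Delta m n.
        struct_iso J m n p \<in> extensional (Obj (level X n)) \<and>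
        (\<forall>x \<in> Obj (level X n).
           struct_iso J m n p x
             \<in> hom (level U m) (ob_map (pull U m n p) (ob_map (cmpt J n) x))
                               (ob_map (cmpt J m) (ob_map (pull X m n p) x)) \<and>
           invertible (level U m) (struct_iso J m n p x)) \<and>
        (\<forall>f \<in> Arr (level X n).
           Comp (level U m) (struct_iso J m n p (Tgt (level X n) f))
                            (arr_map (pull U m n p) (arr_map (cmpt J n) f))
         = Comp (level U m) (arr_map (cmpt J m) (arr_map (pull X m n p) f))
                            (struct_iso J m n p (Src (level X n) f)))) \<and>
     (\<forall>n. \<forall>x \<in> Obj (level X n).
        struct_iso J n n (delta_id n) x = Unit (level U n) (ob_map (cmpt J n) x)) \<and>
     (\<forall>l m n. \<forall>q \<in> Delta l m. \<forall>p \<in> Delta m n. \<forall>x \<in> Obj (level X n).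
        Comp (level U l) (struct_iso J l m q (ob_map (pull X m n p) x))
                         (arr_map (pull U l m q) (struct_iso J m n p x))
      = Comp (level U l) (struct_iso J l n (compose {..l} p q) x)
                         (coh U l m n q p (ob_map (cmpt J n) x)))"

definition strict_culf_map ::
  "('o, 'a) simplicial \<Rightarrow> ('p, 'b) pseudo_simplicial \<Rightarrow> ('o, 'a, 'p, 'b) pseudonat \<Rightarrow> bool" where
  "strict_culf_map X U J \<longleftrightarrow> pseudonatural X U J \<and>
     (\<forall>m n p. active m n p \<longrightarrow>
        (\<forall>x \<in> Obj (level X n).
           struct_iso J m n p x
             = Unit (level U m) (ob_map (pull U m n p) (ob_map (cmpt J n) x))) \<and>
        strict_pullback (level X n) (level X m) (level U n)
          (pull X m n p) (cmpt J n) (cmpt J m) (pull U m n p))"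

definition modification ::
  "('o, 'a) simplicial \<Rightarrow> ('p, 'b) pseudo_simplicial
    \<Rightarrow> ('o, 'a, 'p, 'b) pseudonat \<Rightarrow> ('o, 'a, 'p, 'b) pseudonat \<Rightarrow> (nat \<Rightarrow> 'o \<Rightarrow> 'b) \<Rightarrow> bool" where
  "modification X U J J' \<Gamma> \<longleftrightarrow>
     (\<forall>n. \<Gamma> n \<in> extensional (Obj (level X n)) \<and>
        (\<forall>x \<in> Obj (level X n).
           \<Gamma> n x \<in> hom (level U n) (ob_map (cmpt J n) x) (ob_map (cmpt J' n) x)) \<and>
        (\<forall>f \<in> Arr (level X n).
           Comp (level U n) (\<Gamma> n (Tgt (level X n) f)) (arr_map (cmpt J n) f)
         = Comp (level U n) (arr_map (cmpt J' n) f) (\<Gamma> n (Src (level X n) f)))) \<and>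
     (\<forall>m n. \<forall>p \<in> Delta m n. \<forall>x \<in> Obj (level X n).
        Comp (level U m) (struct_iso J' m n p x) (arr_map (pull U m n p) (\<Gamma> n x))
      = Comp (level U m) (\<Gamma> m (ob_map (pull X m n p) x)) (struct_iso J m n p x))"

definition mod_id ::
  "('o, 'a) simplicial \<Rightarrow> ('p, 'b) pseudo_simplicial \<Rightarrow> ('o, 'a, 'p, 'b) pseudonat
    \<Rightarrow> nat \<Rightarrow> 'o \<Rightarrow> 'b" where
  "mod_id X U J = (\<lambda>n. \<lambda>x\<in>Obj (level X n). Unit (level U n) (ob_map (cmpt J n) x))"

definition mod_comp ::
  "('o, 'a) simplicial \<Rightarrow> ('p, 'b) pseudo_simplicial
    \<Rightarrow> (nat \<Rightarrow> 'o \<Rightarrow> 'b) \<Rightarrow> (nat \<Rightarrow> 'o \<Rightarrow> 'b) \<Rightarrow> nat \<Rightarrow> 'o \<Rightarrow> 'b" where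
  "mod_comp X U \<Gamma>' \<Gamma> = (\<lambda>n. \<lambda>x\<in>Obj (level X n). Comp (level U n) (\<Gamma>' n x) (\<Gamma> n x))"

definition invertible_modification ::
  "('o, 'a) simplicial \<Rightarrow> ('p, 'b) pseudo_simplicial
    \<Rightarrow> ('o, 'a, 'p, 'b) pseudonat \<Rightarrow> ('o, 'a, 'p, 'b) pseudonat \<Rightarrow> (nat \<Rightarrow> 'o \<Rightarrow> 'b) \<Rightarrow> bool" where
  "invertible_modification X U J J' \<Gamma> \<longleftrightarrow> modification X U J J' \<Gamma> \<and>
     (\<exists>\<Gamma>'. modification X U J' J \<Gamma>' \<and>
        mod_comp X U \<Gamma>' \<Gamma> = mod_id X U J \<and> mod_comp X U \<Gamma> \<Gamma>' = mod_id X U J')"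

definition mapping_groupoid ::
  "('o, 'a) simplicial \<Rightarrow> ('p, 'b) pseudo_simplicial
    \<Rightarrow> (('o, 'a, 'p, 'b) pseudonat,
        ('o, 'a, 'p, 'b) pseudonat \<times> ('o, 'a, 'p, 'b) pseudonat \<times> (nat \<Rightarrow> 'o \<Rightarrow> 'b)) category" where
  "mapping_groupoid X U =
     \<lparr>Obj = {J. strict_culf_map X U J},
      Arr = {(J, J', \<Gamma>). strict_culf_map X U J \<and> strict_culf_map X U J' \<and>
                          invertible_modification X U J J' \<Gamma>},
      Src = (\<lambda>(J, J', \<Gamma>). J),
      Tgt = (\<lambda>(J, J', \<Gamma>). J'),
      Unit = (\<lambda>J. (J, J, mod_id X U J)),
      Comp = (\<lambda>(J', J'', \<Gamma>') (J, J1, \<Gamma>). (J, J'', mod_comp X U \<Gamma>' \<Gamma>))\<rparr>"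

end

theory Submission
  imports Defs
begin

text \<open>Call a simplex of an interval, extended by the two edges from the initial and to the terminal
  object, its hull. Since a simplex is recovered from its hull, and the hull has the same long edge
  as the whole interval, culf lifting of hulls gives the orthogonality of stretched and culf maps.

  Uniqueness: if \<open>J\<close> is strict culf and \<open>J x = (A, a)\<close>, the strict pullback condition for
  \<open>[1] \<rightarrow> [k + 2]\<close> identifies the hulls of \<open>k\<close>-simplices of \<open>A\<close> with the \<open>(k + 2)\<close>-simplices of \<open>X\<close>
  that have the same long edge as \<open>x\<close>. This description of \<open>A\<close> does not involve \<open>J\<close>, so any two strict
  culf maps are related by exactly one modification.

  Existence: the same description defines the interval of an edge \<open>f\<close>, with \<open>k\<close>-simplices the
  \<open>(k + 2)\<close>-simplices of \<open>X\<close> over \<open>f\<close>. For a map \<open>p\<close> into \<open>[n]\<close> and \<open>x\<close> in \<open>X\<^sub>n\<close>, a simplex over the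
  long edge of \<open>p\<^sup>* x\<close> is inserted into the middle edge of the \<open>3\<close>-simplex \<open>(0, p 0, p m, n)\<close> of \<open>x\<close>;
  this gives the culf map from the interval of \<open>p\<^sup>* x\<close> to that of \<open>x\<close>. Arrows act because
  \<open>X\<^sub>n \<rightarrow> X\<^sub>1\<close> is a discrete fibration for \<open>n \<ge> 1\<close>.\<close>

subsection \<open>Maps in the simplex category\<close>

text \<open>Pullback conditions see only active maps, hence only simplices that run from one end of
  an interval to the other. Adding the two extreme vertices brings every simplex into this form;
  this is the origin of the indices \<open>Suc (Suc k)\<close>.

  The values of \<open>U\<close> on other maps depend on an arbitrary choice of factorisations.
  Structure isomorphisms are therefore traded for the culf maps that they induce between intervals,
  and equations between isomorphisms are checked after composing with a culf map, which
  orthogonality allows. Coherence becomes strict functoriality.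

  All gluing in \<open>X\<close> comes from pushouts of an active map along the inclusion of a
  middle block. For \<open>[1] \<rightarrow> [k]\<close> it inserts simplices into edges; for
  \<open>[1] \<rightarrow> [0]\<close> it shows that a simplex with degenerate outer edges is a
  degeneracy, so that a subdivision by \<open>[n]\<close> of the interval of an edge comes from an
  \<open>n\<close>-simplex of \<open>X\<close>, although the \<open>n\<close>-simplices of that
  interval are \<open>(n + 2)\<close>-simplices of \<open>X\<close>. The full faithfulness of
  \<open>X\<^sub>0 \<rightarrow> X\<^sub>1\<close> supplies the lifting of arrows for
  \<open>n = 0\<close>.\<close>

lemma DeltaI:
  assumes "\<And>i. i \<le> m \<Longrightarrow> p i \<le> n" "\<And>i j. i \<le> j \<Longrightarrow> j \<le> m \<Longrightarrow> p i \<le> p j"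
    "\<And>i. m < i \<Longrightarrow> p i = undefined"
  shows "p \<in> Delta m n"
  using assms unfolding Delta_def by (auto simp: mono_on_def extensional_def PiE_def)

lemma Delta_le: "p \<in> Delta m n \<Longrightarrow> i \<le> m \<Longrightarrow> p i \<le> n"
  unfolding Delta_def by auto

lemma Delta_mono: "p \<in> Delta m n \<Longrightarrow> i \<le> j \<Longrightarrow> j \<le> m \<Longrightarrow> p i \<le> p j"
  unfolding Delta_def by (auto simp: mono_on_def)

lemma Delta_undef: "p \<in> Delta m n \<Longrightarrow> \<not> i \<le> m \<Longrightarrow> p i = undefined"
  unfolding Delta_def by (auto simp: PiE_def extensional_def)

lemma Delta_eqI:
  assumes "p \<in> Delta m n" "q \<in> Delta m n'" "\<And>i. i \<le> m \<Longrightarrow> p i = q i"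
  shows "p = q"
proof
  fix i show "p i = q i"
    using assms Delta_undef[of p m n i] Delta_undef[of q m n' i] by (cases "i \<le> m") auto
qed

lemma comp_apply: "i \<le> l \<Longrightarrow> compose {..l} p q i = p (q i)"
  by (simp add: compose_def)

lemma Delta_comp:
  assumes "q \<in> Delta l m" "p \<in> Delta m n"
  shows "compose {..l} p q \<in> Delta l n"
  by (rule DeltaI) (simp_all add: compose_def Delta_le[OF assms(1)] Delta_le[OF assms(2)]
      Delta_mono[OF assms(2)] Delta_mono[OF assms(1)])

lemma Delta_assoc:
  assumes "r \<in> Delta k l"
  shows "compose {..k} p (compose {..k} q r) = compose {..k} (compose {..l} p q) r"
  using Delta_le[OF assms] by (auto simp: compose_def fun_eq_iff)

lemma delta_id_in [simp, intro]: "delta_id n \<in> Delta n n"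
  by (intro DeltaI) (auto simp: delta_id_def)

lemma comp_id_left:
  assumes "p \<in> Delta m n"
  shows "compose {..m} (delta_id n) p = p"
  using assms Delta_comp[OF assms delta_id_in]
  by (intro Delta_eqI[of _ m n p n]) (auto simp: comp_apply delta_id_def Delta_le)

lemma comp_id_right:
  assumes "p \<in> Delta m n"
  shows "compose {..m} p (delta_id m) = p"
  using assms Delta_comp[OF delta_id_in assms]
  by (intro Delta_eqI[of _ m n p n]) (auto simp: comp_apply delta_id_def)

text \<open>Along \<open>up k\<close> a simplex with two added ends is restricted to the simplex
  that it extends.\<close>

definition up :: "nat \<Rightarrow> nat \<Rightarrow> nat" where
  "up k = (\<lambda>i\<in>{..k}. Suc i)"

definition long :: "nat \<Rightarrow> nat \<Rightarrow> nat" where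
  "long n = (\<lambda>i\<in>{..1}. if i = 0 then 0 else n)"

definition vtx :: "nat \<Rightarrow> nat \<Rightarrow> nat" where
  "vtx i = (\<lambda>j\<in>{..0}. i)"

definition edg :: "nat \<Rightarrow> nat \<Rightarrow> nat" where
  "edg i = (\<lambda>k\<in>{..1}. i + k)"

definition hat :: "nat \<Rightarrow> nat \<Rightarrow> (nat \<Rightarrow> nat) \<Rightarrow> nat \<Rightarrow> nat" where
  "hat k m g = (\<lambda>i\<in>{..Suc (Suc k)}. if i = 0 then 0 else if i \<le> Suc k then Suc (g (i - 1)) else Suc (Suc m))"

text \<open>\<open>hat g\<close> adjoins a new bottom and a new top element; \<open>kap\<close> merges them with the old ones.\<close>

definition kap :: "nat \<Rightarrow> nat \<Rightarrow> nat" where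
  "kap n = (\<lambda>i\<in>{..Suc (Suc n)}. min n (i - 1))"

lemma up_in [simp, intro]: "up k \<in> Delta k (Suc (Suc k))"
  by (intro DeltaI) (auto simp: up_def)

lemma long_in [simp, intro]: "long n \<in> Delta 1 n" "long n \<in> Delta (Suc 0) n"
  by (auto intro!: DeltaI simp: long_def)

lemma vtx_in [intro]: "i \<le> n \<Longrightarrow> vtx i \<in> Delta 0 n"
  by (intro DeltaI) (auto simp: vtx_def)

lemma edg_in [intro]: "Suc i \<le> n \<Longrightarrow> edg i \<in> Delta 1 n" "Suc i \<le> n \<Longrightarrow> edg i \<in> Delta (Suc 0) n"
  by (auto intro!: DeltaI simp: edg_def)

lemma hat_in [intro]:
  assumes "g \<in> Delta k m"
  shows "hat k m g \<in> Delta (Suc (Suc k)) (Suc (Suc m))"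
proof (intro DeltaI)
  fix i j assume ij: "i \<le> j" "j \<le> Suc (Suc k)"
  show "hat k m g i \<le> hat k m g j"
  proof (cases "i = 0 \<or> j = Suc (Suc k)")
    case True
    then show ?thesis using ij Delta_le[OF assms, of "i - 1"] by (auto simp: hat_def le_SucI)
  next
    case False
    then show ?thesis using ij Delta_mono[OF assms, of "i - 1" "j - 1"] by (auto simp: hat_def)
  qed
next
  fix i assume "i \<le> Suc (Suc k)"
  then show "hat k m g i \<le> Suc (Suc m)"
    using Delta_le[OF assms, of "i - 1"] by (auto simp: hat_def le_SucI)
qed (simp add: hat_def)

lemma kap_in [simp, intro]: "kap n \<in> Delta (Suc (Suc n)) n"
  by (intro DeltaI) (auto simp: kap_def)

lemma active_in: "active m n p \<Longrightarrow> p \<in> Delta m n"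
  by (simp add: active_def)

lemma long_active [simp, intro]: "active 1 n (long n)" "active (Suc 0) n (long n)"
  by (simp_all add: active_def) (simp_all add: long_def)

lemma hat_active [intro]: "g \<in> Delta k m \<Longrightarrow> active (Suc (Suc k)) (Suc (Suc m)) (hat k m g)"
  using hat_in[of g k m] by (simp add: active_def) (simp add: hat_def)

lemma kap_active [simp, intro]: "active (Suc (Suc n)) n (kap n)"
  by (simp add: active_def) (simp add: kap_def)

lemma delta_id_active [simp, intro]: "active n n (delta_id n)"
  by (simp add: active_def) (simp add: delta_id_def)

lemma active_comp [intro]: "active l m q \<Longrightarrow> active m n p \<Longrightarrow> active l n (compose {..l} p q)"
  unfolding active_def by (auto simp: comp_apply Delta_comp)

lemma hat_simps:
  "hat k m g 0 = 0" "j \<le> k \<Longrightarrow> hat k m g (Suc j) = Suc (g j)" "hat k m g (Suc (Suc k)) = Suc (Suc m)"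
  by (auto simp: hat_def)

lemma le_SucSuc_cases:
  assumes "i \<le> Suc (Suc k)"
  obtains "i = 0" | j where "i = Suc j" "j \<le> k" | "i = Suc (Suc k)"
  using assms by (metis le_SucE not0_implies_Suc Suc_le_mono)

lemma kap_simps: "kap n 0 = 0" "j \<le> n \<Longrightarrow> kap n (Suc j) = j" "kap n (Suc (Suc n)) = n"
  by (auto simp: kap_def)

lemma up_apply: "i \<le> k \<Longrightarrow> up k i = Suc i"
  by (simp add: up_def)

text \<open>Restriction to the inner part is natural in every map \<open>g\<close>. Compatibility of
  hulls, gluing and insertion with the simplicial action rests on this identity.\<close>

lemma hat_up:
  assumes "g \<in> Delta k m"
  shows "compose {..k} (hat k m g) (up k) = compose {..k} (up m) g"
  using Delta_comp[OF up_in hat_in[OF assms]] Delta_comp[OF assms up_in]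
  by (rule Delta_eqI) (simp add: comp_apply up_apply hat_simps Delta_le[OF assms])

lemma hat_hat:
  assumes q: "q \<in> Delta k l" and p: "p \<in> Delta l m"
  shows "compose {..Suc (Suc k)} (hat l m p) (hat k l q) = hat k m (compose {..k} p q)"
proof (rule Delta_eqI)
  fix i assume "i \<le> Suc (Suc k)"
  then show "compose {..Suc (Suc k)} (hat l m p) (hat k l q) i = hat k m (compose {..k} p q) i"
    by (cases rule: le_SucSuc_cases) (auto simp: comp_apply hat_simps Delta_le[OF q])
qed (use p q in \<open>blast intro: Delta_comp hat_in\<close>)+

lemma hat_id: "hat k k (delta_id k) = delta_id (Suc (Suc k))"
proof (rule Delta_eqI)
  fix i assume "i \<le> Suc (Suc k)"
  then show "hat k k (delta_id k) i = delta_id (Suc (Suc k)) i"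
    by (cases rule: le_SucSuc_cases) (auto simp: hat_simps delta_id_def)
qed (blast intro: Delta_comp hat_in)+

lemma kap_up: "compose {..n} (kap n) (up n) = delta_id n"
  by (rule Delta_eqI[OF Delta_comp[OF up_in kap_in] delta_id_in])
    (simp add: comp_apply kap_simps up_apply delta_id_def)

text \<open>The values at the two added elements agree because \<open>g\<close> preserves the ends;
  this is where activity enters.\<close>

lemma kap_hat:
  assumes "active k m g"
  shows "compose {..Suc (Suc k)} (kap m) (hat k m g) = compose {..Suc (Suc k)} g (kap k)"
proof (rule Delta_eqI)
  have g: "g \<in> Delta k m" "g 0 = 0" "g k = m" using assms by (auto simp: active_def)
  show "compose {..Suc (Suc k)} (kap m) (hat k m g) \<in> Delta (Suc (Suc k)) m"
    "compose {..Suc (Suc k)} g (kap k) \<in> Delta (Suc (Suc k)) m"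
    using g by (blast intro: Delta_comp hat_in kap_in)+
  fix i assume "i \<le> Suc (Suc k)"
  then show "compose {..Suc (Suc k)} (kap m) (hat k m g) i = compose {..Suc (Suc k)} g (kap k) i"
    by (cases rule: le_SucSuc_cases) (auto simp: comp_apply hat_simps kap_simps g Delta_le[OF g(1)])
qed

lemma active_long: 
  "active k m g \<Longrightarrow> compose {..1} g (long k) = long m"
  "active k m g \<Longrightarrow> compose {..Suc 0} g (long k) = long m"
  by (rule ext; simp add: compose_def long_def active_def)+

text \<open>\<open>kap\<close> doubles both ends, and \<open>hat\<close> of \<open>up\<close> omits
  one copy of each. This makes insertion along an active map the identity.\<close>

lemma kap_hat_up: "compose {..Suc (Suc k)} (kap (Suc (Suc k))) (hat k (Suc (Suc k)) (up k)) = delta_id (Suc (Suc k))"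
proof (rule Delta_eqI)
  fix i assume "i \<le> Suc (Suc k)"
  then show "compose {..Suc (Suc k)} (kap (Suc (Suc k))) (hat k (Suc (Suc k)) (up k)) i = delta_id (Suc (Suc k)) i"
    by (cases rule: le_SucSuc_cases) (auto simp: comp_apply hat_simps kap_simps up_apply delta_id_def)
qed (blast intro: Delta_comp hat_in kap_in up_in)+

lemma coface_vtx: "coface 0 (Suc 0) = vtx 0" "coface 0 1 = vtx 0" "coface 0 0 = vtx 1"
  by (auto simp: fun_eq_iff coface_def vtx_def)

lemma comp_vtx: "compose {..0} p (vtx i) = vtx (p i)" "compose {0} p (vtx i) = vtx (p i)"
  by (auto simp: fun_eq_iff compose_def vtx_def)

lemma edg_val: "edg i 0 = i" "edg i 1 = Suc i" "edg i (Suc 0) = Suc i" by (auto simp: edg_def)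
lemma long_val: "long i 0 = 0" "long i 1 = i" "long i (Suc 0) = i" by (auto simp: long_def)

lemma up_edg:
  "Suc i \<le> k \<Longrightarrow> compose {..1} (up k) (edg i) = edg (Suc i)"
  "Suc i \<le> k \<Longrightarrow> compose {..Suc 0} (up k) (edg i) = edg (Suc i)"
  by (auto simp: fun_eq_iff compose_def edg_def up_def)

subsection \<open>Simplicial sets\<close>

lemma act_in: "simplicial_set A \<Longrightarrow> p \<in> Delta m n \<Longrightarrow> x \<in> simps A n \<Longrightarrow> act A m n p x \<in> simps A m"
  unfolding simplicial_set_def by blast

lemma act_id: "simplicial_set A \<Longrightarrow> x \<in> simps A n \<Longrightarrow> act A n n (delta_id n) x = x"
  unfolding simplicial_set_def by blast

lemma act_act: "simplicial_set A \<Longrightarrow> q \<in> Delta l m \<Longrightarrow> p \<in> Delta m n \<Longrightarrow> x \<in> simps A n \<Longrightarrow>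
  act A l m q (act A m n p x) = act A l n (compose {..l} p q) x"
  unfolding simplicial_set_def by force

lemma map_in: "simplicial_map A B \<phi> \<Longrightarrow> x \<in> simps A n \<Longrightarrow> \<phi> n x \<in> simps B n"
  unfolding simplicial_map_def by blast

lemma map_act: "simplicial_map A B \<phi> \<Longrightarrow> p \<in> Delta m n \<Longrightarrow> x \<in> simps A n \<Longrightarrow>
    \<phi> m (act A m n p x) = act B m n p (\<phi> n x)"
  unfolding simplicial_map_def by blast

lemma map_eqI:
  assumes "simplicial_map A B \<phi>" "simplicial_map A B' \<psi>" "\<And>n x. x \<in> simps A n \<Longrightarrow> \<phi> n x = \<psi> n x"
  shows "\<phi> = \<psi>"
proof (intro ext)
  fix n x
  have "\<phi> n \<in> extensional (simps A n)" "\<psi> n \<in> extensional (simps A n)"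
    using assms(1,2) unfolding simplicial_map_def by (auto simp: PiE_def)
  then show "\<phi> n x = \<psi> n x" using assms(3) by (cases "x \<in> simps A n") (auto simp: extensional_def)
qed

lemma simp_comp_apply: "x \<in> simps A n \<Longrightarrow> simp_comp A \<psi> \<phi> n x = \<psi> n (\<phi> n x)"
  by (simp add: simp_comp_def compose_def)

lemma simp_id_apply: "x \<in> simps A n \<Longrightarrow> simp_id A n x = x"
  by (simp add: simp_id_def)

lemma map_comp: "simplicial_map A B \<phi> \<Longrightarrow> simplicial_map B C \<psi> \<Longrightarrow> simplicial_set A \<Longrightarrow>
    simplicial_map A C (simp_comp A \<psi> \<phi>)"
  unfolding simplicial_map_def[of A C]
  by (auto simp: simp_comp_apply map_in map_act act_in) (auto simp: simp_comp_def compose_def)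

lemma map_id: "simplicial_set A \<Longrightarrow> simplicial_map A A (simp_id A)"
  unfolding simplicial_map_def by (auto simp: simp_id_apply act_in) (auto simp: simp_id_def)

lemma comp_simp_id: "simplicial_map A B F \<Longrightarrow> simp_comp A F (simp_id A) = F"
  unfolding simp_comp_def simp_id_def compose_def simplicial_map_def
  by (auto simp: fun_eq_iff PiE_def extensional_def)

lemma simp_id_comp: "simplicial_map A B F \<Longrightarrow> simp_comp A (simp_id B) F = F"
  unfolding simp_comp_def simp_id_def compose_def simplicial_map_def
  by (auto simp: fun_eq_iff PiE_def extensional_def Pi_def)

lemma simp_comp_assoc: "simplicial_map A B F \<Longrightarrow>
   simp_comp A H (simp_comp A G F) = simp_comp A (simp_comp B H G) F"
  by (auto simp: fun_eq_iff simp_comp_def compose_def dest: map_in)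

lemma std_simps [simp]: "simps (std_simplex n) k = Delta k n"
  by (simp add: std_simplex_def)

lemma std_act: "p \<in> Delta m k \<Longrightarrow> q \<in> Delta k n \<Longrightarrow> act (std_simplex n) m k p q = compose {..m} q p"
  by (simp add: std_simplex_def)

lemma std_simplicial_set: "simplicial_set (std_simplex n)"
proof -
  have "act (std_simplex n) l k' (compose {..l} p q) x = act (std_simplex n) l m q (act (std_simplex n) m k' p x)"
    if "q \<in> Delta l m" "p \<in> Delta m k'" "x \<in> Delta k' n" for l m k' p q x
    using that Delta_comp[OF that(1,2)] Delta_comp[OF that(2,3)] by (simp add: std_act Delta_assoc)
  moreover have "act (std_simplex n) m k p \<in> Delta k n \<rightarrow>\<^sub>E Delta m n" if "p \<in> Delta m k" for m k p
    using that by (auto simp: std_simplex_def Delta_comp)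
  moreover have "act (std_simplex n) k k (delta_id k) x = x" if "x \<in> Delta k n" for k x
    using that by (simp add: std_act comp_id_right)
  ultimately show ?thesis
    unfolding simplicial_set_def std_simps by (auto simp: std_simplex_def)
qed

lemma std_Bot: "Bot (std_simplex n) = vtx 0" "Top (std_simplex n) = vtx n"
  by (auto simp: std_simplex_def vtx_def)

lemma std_map_in: "p \<in> Delta m n \<Longrightarrow> simplicial_map (std_simplex m) (std_simplex n) (std_map m n p)"
  unfolding simplicial_map_def
  by (auto simp: std_act std_map_def Delta_comp Delta_assoc)

lemma std_map_apply: "q \<in> Delta k m \<Longrightarrow> std_map m n p k q = compose {..k} p q"
  by (simp add: std_map_def)

lemma yoneda_act: "simplicial_map (std_simplex n) A a \<Longrightarrow> q \<in> Delta k n \<Longrightarrow> a k q = act A k n q (a n (delta_id n))"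
  using map_act[of "std_simplex n" A a q k n "delta_id n"] by (simp add: std_act comp_id_left)

lemma std_map_act: "simplicial_map (std_simplex n) A a \<Longrightarrow> q \<in> Delta k n \<Longrightarrow> p \<in> Delta j k \<Longrightarrow>
   act A j k p (a k q) = a j (compose {..j} q p)"
  using map_act[of "std_simplex n" A a p j k q] by (simp add: std_act)

lemma std_map_eqI:
  assumes "simplicial_map (std_simplex n) A a" "simplicial_map (std_simplex n) A b"
    "a n (delta_id n) = b n (delta_id n)"
  shows "a = b"
  by (rule map_eqI[OF assms(1,2)]) (metis assms yoneda_act std_simps)

lemma yoneda_map:
  assumes "simplicial_set A" "x \<in> simps A n"
  shows "simplicial_map (std_simplex n) A (\<lambda>k. \<lambda>q\<in>Delta k n. act A k n q x)"
  using assms unfolding simplicial_map_def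
  by (auto simp: std_act act_act Delta_comp intro!: act_in)

subsection \<open>Intervals\<close>

lemma dai_set: "discrete_algebraic_interval A \<Longrightarrow> simplicial_set A"
  by (simp add: discrete_algebraic_interval_def)

lemma segal_eqI:
  assumes "simplicial_set A" "strict_segal A" "x \<in> simps A n" "y \<in> simps A n" "n \<ge> 1"
   "\<And>i. i < n \<Longrightarrow> act A 1 n (edg i) x = act A 1 n (edg i) y"
  shows "x = y"
proof -
  have "inj_on (\<lambda>x. \<lambda>i\<in>{..<n}. act A 1 n (edg i) x) (simps A n)"
    using assms(2,5) unfolding strict_segal_def edg_def by (meson bij_betw_def)
  then show ?thesis by (rule inj_onD) (use assms in auto)
qed

lemma segal_ex:
  assumes "simplicial_set A" "strict_segal A" "n \<ge> 1"
   "\<And>i. i < n \<Longrightarrow> e i \<in> simps A 1"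
   "\<And>i. Suc i < n \<Longrightarrow> act A 0 1 (vtx 1) (e i) = act A 0 1 (vtx 0) (e (Suc i))"
  shows "\<exists>x\<in>simps A n. \<forall>i<n. act A 1 n (edg i) x = e i"
proof -
  have b: "(\<lambda>x. \<lambda>i\<in>{..<n}. act A 1 n (edg i) x) ` (simps A n) = 
    {e \<in> {..<n} \<rightarrow>\<^sub>E simps A 1.
           \<forall>i. Suc i < n \<longrightarrow> act A 0 1 (vtx 1) (e i) = act A 0 1 (vtx 0) (e (Suc i))}"
    using assms(2,3) unfolding strict_segal_def edg_def coface_vtx by (meson bij_betw_def)
  have "(\<lambda>i\<in>{..<n}. e i) \<in> {e \<in> {..<n} \<rightarrow>\<^sub>E simps A 1.
           \<forall>i. Suc i < n \<longrightarrow> act A 0 1 (vtx 1) (e i) = act A 0 1 (vtx 0) (e (Suc i))}"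
    using assms by auto
  then obtain x where "x \<in> simps A n" and x: "(\<lambda>i\<in>{..<n}. e i) = (\<lambda>i\<in>{..<n}. act A 1 n (edg i) x)"
    unfolding b[symmetric] by auto
  moreover have "act A 1 n (edg i) x = e i" if "i < n" for i
    using fun_cong[OF x, of i] that by simp
  ultimately show ?thesis by blast
qed

lemma bot_edge:
  assumes "discrete_algebraic_interval A" "x \<in> simps A 0"
  shows "\<exists>!e. e \<in> simps A 1 \<and> act A 0 1 (vtx 0) e = Bot A \<and> act A 0 1 (vtx 1) e = x"
  using assms unfolding discrete_algebraic_interval_def coface_vtx by blast

lemma top_edge:
  assumes "discrete_algebraic_interval A" "x \<in> simps A 0"
  shows "\<exists>!e. e \<in> simps A 1 \<and> act A 0 1 (vtx 0) e = x \<and> act A 0 1 (vtx 1) e = Top A"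
  using assms unfolding discrete_algebraic_interval_def coface_vtx by blast

section \<open>Hulls of simplices of an interval\<close>

definition is_hull :: "'s interval \<Rightarrow> nat \<Rightarrow> 's \<Rightarrow> 's \<Rightarrow> bool" where
  "is_hull A k x z \<longleftrightarrow> z \<in> simps A (Suc (Suc k)) \<and> act A k (Suc (Suc k)) (up k) z = x \<and>
     act A 0 (Suc (Suc k)) (vtx 0) z = Bot A \<and> act A 0 (Suc (Suc k)) (vtx (Suc (Suc k))) z = Top A"

text \<open>The spine of a hull is forced: an edge from the initial object to the first vertex of
  \<open>x\<close>, the spine of \<open>x\<close>, and an edge from the last vertex to the terminal
  object. The two outer edges are unique, and the Segal condition does the rest.\<close>

lemma hull_ex1:
  assumes A: "discrete_algebraic_interval A" and x: "x \<in> simps A k"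
  shows "\<exists>!z. is_hull A k x z"
proof -
  have S: "simplicial_set A" "strict_segal A" using A by (auto simp: discrete_algebraic_interval_def)
  note [simp] = act_act[OF S(1)] 
  let ?n = "Suc (Suc k)"
  obtain e0 where e0: "e0 \<in> simps A 1" "act A 0 1 (vtx 0) e0 = Bot A" "act A 0 1 (vtx 1) e0 = act A 0 k (vtx 0) x"
    using bot_edge[OF A act_in[OF S(1) vtx_in x, of 0]] by blast
  obtain e1 where e1: "e1 \<in> simps A 1" "act A 0 1 (vtx 0) e1 = act A 0 k (vtx k) x" "act A 0 1 (vtx 1) e1 = Top A"
    using top_edge[OF A act_in[OF S(1) vtx_in x, of k]] by blast
  define e where "e = (\<lambda>i. if i = 0 then e0 else if i \<le> k then act A 1 k (edg (i - 1)) x else e1)"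
  have ends: "act A 0 1 (vtx 0) (act A 1 k (edg i) x) = act A 0 k (vtx i) x"
      "act A 0 1 (vtx 1) (act A 1 k (edg i) x) = act A 0 k (vtx (Suc i)) x" if "Suc i \<le> k" for i
    using that x by (auto simp: vtx_in edg_in comp_vtx edg_val)
  have chain: "act A 0 1 (vtx 1) (e i) = act A 0 1 (vtx 0) (e (Suc i))" if "Suc i < ?n" for i
    using that ends[of "i - 1"] ends[of i] e0 e1 unfolding e_def
    by (cases "i = 0"; cases "i = k") auto
  have ein: "e i \<in> simps A 1" for i
    unfolding e_def using e0 e1 act_in[OF S(1) edg_in(1) x, of "i - 1"] by auto
  obtain z where z: "z \<in> simps A ?n" "\<And>i. i < ?n \<Longrightarrow> act A 1 ?n (edg i) z = e i"
    using segal_ex[OF S, of ?n e] ein chain by auto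
  have v: "act A 0 ?n (vtx i) z' = act A 0 1 (vtx 0) (act A 1 ?n (edg i) z')"
     "act A 0 ?n (vtx (Suc i)) z' = act A 0 1 (vtx 1) (act A 1 ?n (edg i) z')" 
    if "i < ?n" "z' \<in> simps A ?n" for i z'
    using that by (auto simp: vtx_in edg_in comp_vtx edg_val)
  have eup: "act A 1 k (edg i) (act A k ?n (up k) z') = act A 1 ?n (edg (Suc i)) z'"
    if "Suc i \<le> k" "z' \<in> simps A ?n" for i z'
    using that up_edg by (auto simp: edg_in)
  have vup: "act A 0 k (vtx i) (act A k ?n (up k) z') = act A 0 ?n (vtx (Suc i)) z'"
    if "i \<le> k" "z' \<in> simps A ?n" for i z'
    using that by (auto simp: vtx_in comp_vtx up_apply)
  have "act A k ?n (up k) z = x"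
  \<comment> \<open>A vertex has no spine, so for \<open>k = 0\<close> the inner part is read off as
    the end of \<open>e0\<close>.\<close>
  proof (cases "k = 0")
    case True
    have "act A k ?n (up k) z = act A 0 ?n (vtx 1) z"
      unfolding True by (rule arg_cong[where f="\<lambda>p. act A 0 _ p z"]) (auto simp: up_def vtx_def)
    also have "\<dots> = act A 0 1 (vtx 1) e0" using v(2)[of 0 z] z by (simp add: e_def)
    also have "\<dots> = x"
      using e0(3) act_id[OF S(1) x] True by (simp add: vtx_def delta_id_def restrict_def cong: if_cong)
    finally show ?thesis .
  next
    case False
    then show ?thesis
      using z x by (intro segal_eqI[OF S _ x]) (auto simp: eup act_in[OF S(1)] e_def simp del: One_nat_def act_act[OF S(1)])
  qed
  then have h: "is_hull A k x z"
    unfolding is_hull_def using z v(1)[of 0 z] v(2)[of "Suc k" z] e0 e1 by (auto simp: e_def)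
  have "z' = z" if h': "is_hull A k x z'" for z'
  proof (rule segal_eqI[OF S])
    have z': "z' \<in> simps A ?n" "act A k ?n (up k) z' = x"
     "act A 0 ?n (vtx 0) z' = Bot A" "act A 0 ?n (vtx ?n) z' = Top A" using h' by (auto simp: is_hull_def)
    show "z' \<in> simps A ?n" "z \<in> simps A ?n" by fact+
    fix i assume i: "i < ?n"
    have ei: "act A 1 ?n (edg i) z' \<in> simps A 1" using act_in[OF S(1) edg_in(1) z'(1)] i by auto
    have "act A 1 ?n (edg i) z' = e i"
    proof -
      consider "i = 0" | "i \<noteq> 0" "i \<le> k" | "i = Suc k" using i by linarith
      then show ?thesis
      proof cases
        case 1
        have "act A 0 1 (vtx 0) (act A 1 ?n (edg 0) z') = Bot A"
          using v(1)[of 0 z'] z' by simp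
        moreover have "act A 0 1 (vtx 1) (act A 1 ?n (edg 0) z') = act A 0 k (vtx 0) x"
          using v(2)[of 0 z'] vup[of 0 z'] z' by (simp add: v)
        ultimately show ?thesis using bot_edge[OF A act_in[OF S(1) vtx_in x, of 0]] e0 ei 1 
          unfolding e_def by auto
      next
        case 2
        then show ?thesis using eup[of "i-1" z'] z' by (simp add: e_def)
      next
        case 3
        have "act A 0 1 (vtx 1) (act A 1 ?n (edg i) z') = Top A"
          using v(2)[of i z'] z' 3 by simp
        moreover have "act A 0 1 (vtx 0) (act A 1 ?n (edg i) z') = act A 0 k (vtx k) x"
          using v(1)[of i z'] vup[of k z'] z' 3 by simp
        ultimately show ?thesis using top_edge[OF A act_in[OF S(1) vtx_in x, of k]] e1 ei 3
          unfolding e_def by auto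
      qed
    qed
    then show "act A 1 ?n (edg i) z' = act A 1 ?n (edg i) z" using z i by simp
  qed auto
  with h show ?thesis by blast
qed

definition hull :: "'s interval \<Rightarrow> nat \<Rightarrow> 's \<Rightarrow> 's" where
  "hull A k x = (THE z. is_hull A k x z)"

lemma hull: "discrete_algebraic_interval A \<Longrightarrow> x \<in> simps A k \<Longrightarrow> is_hull A k x (hull A k x)"
  unfolding hull_def by (rule theI') (rule hull_ex1)

lemma hull_eqI: "discrete_algebraic_interval A \<Longrightarrow> x \<in> simps A k \<Longrightarrow> is_hull A k x z \<Longrightarrow> hull A k x = z"
  unfolding hull_def by (rule the1_equality[OF hull_ex1])

lemma U_objD:
  assumes "(A, a) \<in> U_obj m"
  shows "discrete_algebraic_interval A" "simplicial_set A" "simplicial_map (std_simplex m) A a"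
    "a 0 (vtx 0) = Bot A" "a 0 (vtx m) = Top A"
  using assms unfolding U_obj_def stretched_def std_Bot by (auto simp: dai_set)

lemma U_objI:
  "discrete_algebraic_interval A \<Longrightarrow> simplicial_map (std_simplex m) A a \<Longrightarrow> a 0 (vtx 0) = Bot A \<Longrightarrow>
    a 0 (vtx m) = Top A \<Longrightarrow> (A, a) \<in> U_obj m"
  unfolding U_obj_def stretched_def std_Bot by auto

lemma std_in: "(A, a) \<in> U_obj m \<Longrightarrow> q \<in> Delta k m \<Longrightarrow> a k q \<in> simps A k"
  using map_in[OF U_objD(3)] by fastforce

lemma obj_act: "(A, a) \<in> U_obj m \<Longrightarrow> q \<in> Delta k m \<Longrightarrow> p \<in> Delta j k \<Longrightarrow> act A j k p (a k q) = a j (compose {..j} q p)"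
  by (rule std_map_act[OF U_objD(3)])

lemma bot_top_edge_unique:
  assumes A: "discrete_algebraic_interval A" and e: "e \<in> simps A 1" "e' \<in> simps A 1"
    "act A 0 1 (vtx 0) e = Bot A" "act A 0 1 (vtx 1) e = Top A"
    "act A 0 1 (vtx 0) e' = Bot A" "act A 0 1 (vtx 1) e' = Top A"
  shows "e = e'"
proof -
  have "Top A \<in> simps A 0" using A by (simp add: discrete_algebraic_interval_def)
  from bot_edge[OF A this] e show ?thesis by auto
qed

text \<open>There is only one edge from the initial to the terminal object, so all simplices with
  these ends share the long edge of the subdivision \<open>a\<close>, whatever their
  dimension.\<close>

lemma long_edge:
  assumes x: "(A, a) \<in> U_obj m" and z: "z \<in> simps A n"
    "act A 0 n (vtx 0) z = Bot A" "act A 0 n (vtx n) z = Top A"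
  shows "act A 1 n (long n) z = a 1 (long m)"
proof (rule bot_top_edge_unique[OF U_objD(1)[OF x]])
  note S = U_objD(2)[OF x]
  show "act A 1 n (long n) z \<in> simps A 1" using act_in[OF S _ z(1)] by blast
  show "a 1 (long m) \<in> simps A 1" using std_in[OF x] by blast
  have "act A 0 1 (vtx i) (act A 1 n (long n) z) = act A 0 n (vtx (long n i)) z" if "i \<le> 1" for i
    using act_act[OF S vtx_in[OF that] long_in(1) z(1)] by (simp add: comp_vtx)
  from this[of 0] this[of 1] show "act A 0 1 (vtx 0) (act A 1 n (long n) z) = Bot A"
    "act A 0 1 (vtx 1) (act A 1 n (long n) z) = Top A" by (simp_all add: long_val z)
  have "act A 0 1 (vtx i) (a 1 (long m)) = a 0 (vtx (long m i))" if "i \<le> 1" for i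
    using obj_act[OF x long_in(1) vtx_in[OF that]] by (simp add: comp_vtx)
  from this[of 0] this[of 1] show "act A 0 1 (vtx 0) (a 1 (long m)) = Bot A"
    "act A 0 1 (vtx 1) (a 1 (long m)) = Top A" by (simp_all add: long_val U_objD(4,5)[OF x])
qed

lemma std_long:
  assumes x: "(A, a) \<in> U_obj m" and y: "(A, b) \<in> U_obj n"
  shows "a 1 (long m) = b 1 (long n)"
proof -
  have "act A 1 n (long n) (b n (delta_id n)) = a 1 (long m)"
    by (rule long_edge[OF x std_in[OF y delta_id_in]])
      (auto simp: obj_act[OF y] vtx_in comp_id_left[OF vtx_in, simplified] U_objD(4,5)[OF y])
  then show ?thesis by (simp add: obj_act[OF y] comp_id_left)
qed

lemma hullD:
  assumes x: "(A, a) \<in> U_obj m" and s: "s \<in> simps A k"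
  shows "hull A k s \<in> simps A (Suc (Suc k))" "act A k (Suc (Suc k)) (up k) (hull A k s) = s"
    "act A 1 (Suc (Suc k)) (long (Suc (Suc k))) (hull A k s) = a 1 (long m)"
    "act A 0 (Suc (Suc k)) (vtx 0) (hull A k s) = Bot A"
    "act A 0 (Suc (Suc k)) (vtx (Suc (Suc k))) (hull A k s) = Top A"
  using hull[OF U_objD(1)[OF x] s] long_edge[OF x, of "hull A k s" "Suc (Suc k)"] unfolding is_hull_def by auto

text \<open>Recasts the condition on the two ends as a condition on the long edge, the form in which
  pullbacks along \<open>long\<close> supply it.\<close>

lemma hull_unique:
  assumes x: "(A, a) \<in> U_obj m" and s: "s \<in> simps A k"
    and z: "z \<in> simps A (Suc (Suc k))" "act A k (Suc (Suc k)) (up k) z = s"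
      "act A 1 (Suc (Suc k)) (long (Suc (Suc k))) z = a 1 (long m)"
  shows "hull A k s = z"
proof (rule hull_eqI[OF U_objD(1)[OF x] s])
  note S = U_objD(2)[OF x]
  let ?n = "Suc (Suc k)"
  have "act A 0 ?n (vtx (long ?n i)) z = act A 0 1 (vtx i) (act A 1 ?n (long ?n) z)" if "i \<le> 1" for i
    using act_act[OF S vtx_in[OF that] long_in(1) z(1)] by (simp add: comp_vtx)
  moreover have "act A 0 1 (vtx i) (a 1 (long m)) = a 0 (vtx (long m i))" if "i \<le> 1" for i
    using obj_act[OF x long_in(1) vtx_in[OF that]] by (simp add: comp_vtx)
  ultimately have *: "act A 0 ?n (vtx (long ?n i)) z = a 0 (vtx (long m i))" if "i \<le> 1" for i
    using that z(3) by auto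
  show "is_hull A k s z" unfolding is_hull_def using z(1,2) *[of 0] *[of 1] U_objD(4,5)[OF x]
    by (auto simp: long_val)
qed

text \<open>The right-hand side has the correct inner part by \<open>hat_up\<close> and the correct
  long edge because \<open>hat\<close> is active; these two data determine a hull.\<close>

lemma hull_act:
  assumes x: "(A, a) \<in> U_obj m" and s: "s \<in> simps A k" and q: "q \<in> Delta j k"
  shows "hull A j (act A j k q s) = act A (Suc (Suc j)) (Suc (Suc k)) (hat j k q) (hull A k s)"
proof (rule hull_unique[OF x])
  note S = U_objD(2)[OF x] note h = hullD[OF x s]
  show "act A j k q s \<in> simps A j" by (rule act_in[OF S q s])
  show "act A (Suc (Suc j)) (Suc (Suc k)) (hat j k q) (hull A k s) \<in> simps A (Suc (Suc j))"
    by (rule act_in[OF S hat_in[OF q] h(1)])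
  show "act A j (Suc (Suc j)) (up j) (act A (Suc (Suc j)) (Suc (Suc k)) (hat j k q) (hull A k s)) = act A j k q s"
    unfolding act_act[OF S up_in hat_in[OF q] h(1)] hat_up[OF q]
    unfolding act_act[OF S q up_in h(1), symmetric] h(2) ..
  show "act A 1 (Suc (Suc j)) (long (Suc (Suc j))) (act A (Suc (Suc j)) (Suc (Suc k)) (hat j k q) (hull A k s)) =
    a 1 (long m)"
    unfolding act_act[OF S long_in(1) hat_in[OF q] h(1)] active_long(1)[OF hat_active[OF q]] by (rule h(3))
qed

text \<open>The map in parentheses is \<open>q\<close> with the extreme vertices \<open>0\<close>
  and \<open>m\<close> added; omitting the added ends gives \<open>q\<close> back.\<close>

lemma kap_hat_up_gen:
  assumes q: "q \<in> Delta k m"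
  shows "compose {..k} (compose {..Suc (Suc k)} (kap m) (hat k m q)) (up k) = q"
  unfolding Delta_assoc[OF up_in, symmetric] hat_up[OF q]
  unfolding Delta_assoc[OF q] kap_up comp_id_left[OF q] ..

text \<open>For a simplex that comes from the standard simplex, the hull can be formed there, by
  adding the vertices \<open>0\<close> and \<open>m\<close>.\<close>

lemma hull_std:
  assumes x: "(A, a) \<in> U_obj m" and q: "q \<in> Delta k m"
  shows "hull A k (a k q) = a (Suc (Suc k)) (compose {..Suc (Suc k)} (kap m) (hat k m q))"
proof (rule hull_unique[OF x std_in[OF x q]])
  have d: "compose {..Suc (Suc k)} (kap m) (hat k m q) \<in> Delta (Suc (Suc k)) m"
    by (rule Delta_comp[OF hat_in[OF q] kap_in])
  show "a (Suc (Suc k)) (compose {..Suc (Suc k)} (kap m) (hat k m q)) \<in> simps A (Suc (Suc k))"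
    by (rule std_in[OF x d])
  show "act A k (Suc (Suc k)) (up k) (a (Suc (Suc k)) (compose {..Suc (Suc k)} (kap m) (hat k m q))) = a k q"
    unfolding obj_act[OF x d up_in] kap_hat_up_gen[OF q] ..
  show "act A 1 (Suc (Suc k)) (long (Suc (Suc k))) (a (Suc (Suc k)) (compose {..Suc (Suc k)} (kap m) (hat k m q))) =
    a 1 (long m)"
    unfolding obj_act[OF x d long_in(1)] active_long(1)[OF active_comp[OF hat_active[OF q] kap_active]] ..
qed

definition yon :: "('s, 'z) sset_scheme \<Rightarrow> nat \<Rightarrow> 's \<Rightarrow> nat \<Rightarrow> (nat \<Rightarrow> nat) \<Rightarrow> 's" where
  "yon A n z = (\<lambda>k. \<lambda>q\<in>Delta k n. act A k n q z)"

lemma yon_apply: "q \<in> Delta k n \<Longrightarrow> yon A n z k q = act A k n q z"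
  by (simp add: yon_def)

lemma yon_obj:
  assumes "discrete_algebraic_interval A" "z \<in> simps A n"
    "act A 0 n (vtx 0) z = Bot A" "act A 0 n (vtx n) z = Top A"
  shows "(A, yon A n z) \<in> U_obj n"
  using assms yoneda_map[OF dai_set[OF assms(1)] assms(2)]
  by (intro U_objI) (auto simp: yon_def vtx_in)

subsection \<open>Orthogonality of stretched and culf maps\<close>

lemma set_pullback_ex1:
  assumes "set_pullback P B C p q h k" "b \<in> B" "c \<in> C" "h b = k c"
  shows "\<exists>!x. x \<in> P \<and> p x = b \<and> q x = c"
proof -
  have bij: "bij_betw (\<lambda>x. (p x, q x)) P {(b, c). b \<in> B \<and> c \<in> C \<and> h b = k c}"
    using assms(1) by (simp add: set_pullback_def)
  then have "(b, c) \<in> (\<lambda>x. (p x, q x)) ` P" using assms(2-) by (auto simp: bij_betw_def)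
  then obtain x where "x \<in> P" "p x = b" "q x = c" by auto
  moreover have "x' = x" if "x' \<in> P" "p x' = b" "q x' = c" for x'
    using bij_betw_imp_inj_on[OF bij, THEN inj_onD, of x' x] that \<open>x \<in> P\<close> \<open>p x = b\<close> \<open>q x = c\<close> by auto
  ultimately show ?thesis by blast
qed

lemma set_pullbackI:
  assumes "\<And>x. x \<in> P \<Longrightarrow> p x \<in> B" "\<And>x. x \<in> P \<Longrightarrow> q x \<in> C" "\<And>x. x \<in> P \<Longrightarrow> h (p x) = k (q x)"
    "\<And>b c. b \<in> B \<Longrightarrow> c \<in> C \<Longrightarrow> h b = k c \<Longrightarrow> \<exists>x\<in>P. p x = b \<and> q x = c"
    "\<And>x y. x \<in> P \<Longrightarrow> y \<in> P \<Longrightarrow> p x = p y \<Longrightarrow> q x = q y \<Longrightarrow> x = y"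
  shows "set_pullback P B C p q h k"
  unfolding set_pullback_def bij_betw_def
proof
  show "inj_on (\<lambda>x. (p x, q x)) P" using assms(5) by (auto intro!: inj_onI)
  show "(\<lambda>x. (p x, q x)) ` P = {(b, c). b \<in> B \<and> c \<in> C \<and> h b = k c}"
  proof (intro equalityI subsetI)
    fix z assume "z \<in> {(b, c). b \<in> B \<and> c \<in> C \<and> h b = k c}"
    then obtain b c where "z = (b, c)" "b \<in> B" "c \<in> C" "h b = k c" by auto
    with assms(4) show "z \<in> (\<lambda>x. (p x, q x)) ` P" by (metis (mono_tags) image_eqI)
  qed (use assms in auto)
qed

lemma culf_map: "strict_culf A B \<phi> \<Longrightarrow> simplicial_map A B \<phi>"
  by (simp add: strict_culf_def)

lemma culf_ex1:
  assumes "strict_culf A B \<phi>" "active m n p" "y \<in> simps A m" "z \<in> simps B n" "\<phi> m y = act B m n p z"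
  shows "\<exists>!x. x \<in> simps A n \<and> act A m n p x = y \<and> \<phi> n x = z"
  using assms set_pullback_ex1[of "simps A n" "simps A m" "simps B n" "act A m n p" "\<phi> n" "\<phi> m" "act B m n p" y z]
  by (auto simp: strict_culf_def)

text \<open>A filler is forced on hulls: the hull of \<open>s\<close> has the long edge of the
  subdivision, whose image in \<open>B\<close> is prescribed by \<open>b\<close>, while its image in
  \<open>C\<close> is prescribed by \<open>u\<close>, so the culf condition for \<open>long\<close>
  leaves one value. The inner part of this value is the value of the filler at
  \<open>s\<close>.\<close>

lemma orthogonal:
  assumes x: "(A, a) \<in> U_obj m" and c: "strict_culf B C c" and B: "simplicial_set B"
    and b: "simplicial_map (std_simplex m) B b" and u: "simplicial_map A C u"
    and eq: "simp_comp (std_simplex m) c b = simp_comp (std_simplex m) u a"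
  shows "\<exists>!G. simplicial_map A B G \<and> simp_comp (std_simplex m) G a = b \<and> simp_comp A c G = u"
proof -
  note S = U_objD(2)[OF x]
  note cm = culf_map[OF c]
  have eq': "c k (b k q) = u k (a k q)" if "q \<in> Delta k m" for k q
    using fun_cong[OF fun_cong[OF eq, of k], of q] that by (simp add: simp_comp_apply)
  \<comment> \<open>\<open>isL k s t\<close> says that \<open>t\<close> is the value that a filler
    has to take at the hull of \<open>s\<close>.\<close>
  define isL where "isL = (\<lambda>k s t. t \<in> simps B (Suc (Suc k)) \<and> 
    act B 1 (Suc (Suc k)) (long (Suc (Suc k))) t = b 1 (long m) \<and> c (Suc (Suc k)) t = u (Suc (Suc k)) (hull A k s))"
  have L1: "\<exists>!t. isL k s t" if "s \<in> simps A k" for k s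
    unfolding isL_def
  proof (rule culf_ex1[OF c long_active(1)])
    note h = hullD[OF x that]
    show "b 1 (long m) \<in> simps B 1" using map_in[OF b, of "long m" 1] by simp
    show "u (Suc (Suc k)) (hull A k s) \<in> simps C (Suc (Suc k))" using map_in[OF u h(1)] .
    show "c 1 (b 1 (long m)) = act C 1 (Suc (Suc k)) (long (Suc (Suc k))) (u (Suc (Suc k)) (hull A k s))"
      using map_act[OF u long_in(1) h(1)] h(3) eq'[OF long_in(1)] by simp
  qed
  define L where "L = (\<lambda>k s. THE t. isL k s t)"
  have L: "isL k s (L k s)" if "s \<in> simps A k" for k s
    unfolding L_def by (rule theI'[OF L1[OF that]])
  have Leq: "L k s = t" if "s \<in> simps A k" "isL k s t" for k s t
    unfolding L_def by (rule the1_equality[OF L1]) (use that in auto)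
  have Lin: "L k s \<in> simps B (Suc (Suc k))" if "s \<in> simps A k" for k s
    using L[OF that] by (simp add: isL_def)
  have Lact: "L j (act A j k q s) = act B (Suc (Suc j)) (Suc (Suc k)) (hat j k q) (L k s)"
    if s: "s \<in> simps A k" and q: "q \<in> Delta j k" for j k s q
  proof (rule Leq[OF act_in[OF S q s]])
    have l: "L k s \<in> simps B (Suc (Suc k))" "act B 1 (Suc (Suc k)) (long (Suc (Suc k))) (L k s) = b 1 (long m)"
       "c (Suc (Suc k)) (L k s) = u (Suc (Suc k)) (hull A k s)"
      using L[OF s] by (auto simp: isL_def)
    show "isL j (act A j k q s) (act B (Suc (Suc j)) (Suc (Suc k)) (hat j k q) (L k s))"
      unfolding isL_def
    proof (intro conjI)
      show "act B (Suc (Suc j)) (Suc (Suc k)) (hat j k q) (L k s) \<in> simps B (Suc (Suc j))"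
        by (rule act_in[OF B hat_in[OF q] l(1)])
      show "act B 1 (Suc (Suc j)) (long (Suc (Suc j))) (act B (Suc (Suc j)) (Suc (Suc k)) (hat j k q) (L k s)) = b 1 (long m)"
        unfolding act_act[OF B long_in(1) hat_in[OF q] l(1)] active_long(1)[OF hat_active[OF q]] by (rule l(2))
      show "c (Suc (Suc j)) (act B (Suc (Suc j)) (Suc (Suc k)) (hat j k q) (L k s)) =
          u (Suc (Suc j)) (hull A j (act A j k q s))"
        unfolding hull_act[OF x s q] map_act[OF u hat_in[OF q] hullD(1)[OF x s]] map_act[OF cm hat_in[OF q] l(1)] l(3) ..
    qed
  qed
  define G where "G = (\<lambda>k. \<lambda>s\<in>simps A k. act B k (Suc (Suc k)) (up k) (L k s))"
  have Gap: "G k s = act B k (Suc (Suc k)) (up k) (L k s)" if "s \<in> simps A k" for k s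
    using that by (simp add: G_def)
  have G: "simplicial_map A B G"
    unfolding simplicial_map_def
  proof (intro conjI allI ballI)
    show "G n \<in> simps A n \<rightarrow>\<^sub>E simps B n" for n
      unfolding G_def using act_in[OF B up_in Lin] by auto
    fix j k q s assume q: "q \<in> Delta j k" and s: "s \<in> simps A k"
    show "G j (act A j k q s) = act B j k q (G k s)"
      unfolding Gap[OF act_in[OF S q s]] Gap[OF s] Lact[OF s q] act_act[OF B up_in hat_in[OF q] Lin[OF s]]
        act_act[OF B q up_in Lin[OF s]] hat_up[OF q] ..
  qed
  have Ga: "simp_comp (std_simplex m) G a = b"
  proof (rule map_eqI[OF map_comp[OF U_objD(3)[OF x] G std_simplicial_set] b])
    fix k q assume "q \<in> simps (std_simplex m) k"
    then have q: "q \<in> Delta k m" by simp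
    have d: "compose {..Suc (Suc k)} (kap m) (hat k m q) \<in> Delta (Suc (Suc k)) m"
      by (rule Delta_comp[OF hat_in[OF q] kap_in])
    have "L k (a k q) = b (Suc (Suc k)) (compose {..Suc (Suc k)} (kap m) (hat k m q))"
    proof (rule Leq[OF std_in[OF x q]])
      show "isL k (a k q) (b (Suc (Suc k)) (compose {..Suc (Suc k)} (kap m) (hat k m q)))"
        unfolding isL_def
      proof (intro conjI)
        show "b (Suc (Suc k)) (compose {..Suc (Suc k)} (kap m) (hat k m q)) \<in> simps B (Suc (Suc k))"
          using map_in[OF b] d by fastforce
        show "act B 1 (Suc (Suc k)) (long (Suc (Suc k))) (b (Suc (Suc k)) (compose {..Suc (Suc k)} (kap m) (hat k m q))) = b 1 (long m)"
          unfolding std_map_act[OF b d long_in(1)] active_long(1)[OF active_comp[OF hat_active[OF q] kap_active]] ..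
        show "c (Suc (Suc k)) (b (Suc (Suc k)) (compose {..Suc (Suc k)} (kap m) (hat k m q))) = u (Suc (Suc k)) (hull A k (a k q))"
          unfolding hull_std[OF x q] by (rule eq'[OF d])
      qed
    qed
    then have "G k (a k q) = b k q"
      using Gap[OF std_in[OF x q]] std_map_act[OF b d up_in] kap_hat_up_gen[OF q] by simp
    then show "simp_comp (std_simplex m) G a k q = b k q" using q by (simp add: simp_comp_apply)
  qed
  have cG: "simp_comp A c G = u"
  proof (rule map_eqI[OF map_comp[OF G cm S] u])
    fix k s assume s: "s \<in> simps A k"
    have "c k (G k s) = u k s"
      using map_act[OF cm up_in Lin[OF s]] map_act[OF u up_in hullD(1)[OF x s]] hullD(2)[OF x s] L[OF s] Gap[OF s]
      by (simp add: isL_def)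
    then show "simp_comp A c G k s = u k s" using s by (simp add: simp_comp_apply)
  qed
  have "G' = G" if G': "simplicial_map A B G'" "simp_comp (std_simplex m) G' a = b" "simp_comp A c G' = u" for G'
  proof (rule map_eqI[OF G'(1) G])
    fix k s assume s: "s \<in> simps A k"
    note h = hullD[OF x s]
    have "isL k s (G' (Suc (Suc k)) (hull A k s))"
      unfolding isL_def
    proof (intro conjI)
      show "G' (Suc (Suc k)) (hull A k s) \<in> simps B (Suc (Suc k))" by (rule map_in[OF G'(1) h(1)])
      have "act B 1 (Suc (Suc k)) (long (Suc (Suc k))) (G' (Suc (Suc k)) (hull A k s)) = G' 1 (a 1 (long m))"
        using map_act[OF G'(1) long_in(1) h(1)] h(3) by simp
      also have "\<dots> = b 1 (long m)"
        using fun_cong[OF fun_cong[OF G'(2), of 1], of "long m"] by (simp add: simp_comp_apply)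
      finally show "act B 1 (Suc (Suc k)) (long (Suc (Suc k))) (G' (Suc (Suc k)) (hull A k s)) = b 1 (long m)" .
      show "c (Suc (Suc k)) (G' (Suc (Suc k)) (hull A k s)) = u (Suc (Suc k)) (hull A k s)"
        using fun_cong[OF fun_cong[OF G'(3), of "Suc (Suc k)"], of "hull A k s"] h(1) by (simp add: simp_comp_apply)
    qed
    from Leq[OF s this] have "G k s = act B k (Suc (Suc k)) (up k) (G' (Suc (Suc k)) (hull A k s))"
      using Gap[OF s] by simp
    also have "\<dots> = G' k s" using map_act[OF G'(1) up_in h(1)] h(2) by simp
    finally show "G' k s = G k s" by simp
  qed
  then show ?thesis using G Ga cG by blast
qed

text \<open>Uniqueness in \<open>orthogonal\<close>, for the square that has \<open>F\<close> as a
  filler. Equations between maps into the source of a culf map are proved through this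
  lemma.\<close>

lemma cancel_culf:
  assumes x: "(A, a) \<in> U_obj m" and c: "strict_culf B C c" and B: "simplicial_set B"
    and F: "simplicial_map A B F" and G: "simplicial_map A B G"
    and a: "simp_comp (std_simplex m) F a = simp_comp (std_simplex m) G a"
    and eq: "simp_comp A c F = simp_comp A c G"
  shows "F = G"
proof -
  note am = U_objD(3)[OF x] and cm = culf_map[OF c] and S = U_objD(2)[OF x]
  have "\<exists>!H. simplicial_map A B H \<and> simp_comp (std_simplex m) H a = simp_comp (std_simplex m) F a \<and> simp_comp A c H = simp_comp A c F"
    by (rule orthogonal[OF x c B map_comp[OF am F std_simplicial_set] map_comp[OF F cm S]])
      (rule simp_comp_assoc[OF am])
  then show ?thesis using F G a eq by metis
qed

lemma filler_spec:
  assumes x: "(A, a) \<in> U_obj m" and y: "(B, b) \<in> U_obj m" and c: "strict_culf B C c"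
    and u: "simplicial_map A C u"
    and eq: "simp_comp (std_simplex m) c b = simp_comp (std_simplex m) u a"
  shows "simplicial_map A B (filler m (A, a) (B, b) u c)"
    "simp_comp (std_simplex m) (filler m (A, a) (B, b) u c) a = b"
    "simp_comp A c (filler m (A, a) (B, b) u c) = u"
  using theI'[OF orthogonal[OF x c U_objD(2)[OF y] U_objD(3)[OF y] u eq]]
  unfolding filler_def by auto

lemma isoD: "simplicial_iso A B F \<Longrightarrow> simplicial_map A B F"
  by (simp add: simplicial_iso_def)

lemma isoI: "simplicial_map A B F \<Longrightarrow> simplicial_map B A G \<Longrightarrow> simp_comp A G F = simp_id A \<Longrightarrow>
   simp_comp B F G = simp_id B \<Longrightarrow> simplicial_iso A B F"
  unfolding simplicial_iso_def by blast

lemma iso_inverse: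
  assumes "simplicial_iso A B F"
  obtains G where "simplicial_iso B A G" "simp_comp A G F = simp_id A" "simp_comp B F G = simp_id B"
    "\<And>n x. x \<in> simps A n \<Longrightarrow> G n (F n x) = x" "\<And>n x. x \<in> simps B n \<Longrightarrow> F n (G n x) = x"
proof -
  obtain G where G: "simplicial_map B A G" "simp_comp A G F = simp_id A" "simp_comp B F G = simp_id B"
    using assms unfolding simplicial_iso_def by blast
  moreover have "G n (F n x) = x" if "x \<in> simps A n" for n x
    using fun_cong[OF fun_cong[OF G(2), of n], of x] that by (simp add: simp_comp_apply simp_id_apply)
  moreover have "F n (G n x) = x" if "x \<in> simps B n" for n x
    using fun_cong[OF fun_cong[OF G(3), of n], of x] that by (simp add: simp_comp_apply simp_id_apply)
  ultimately show ?thesis using assms that unfolding simplicial_iso_def by blast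
qed

lemma iso_id: "simplicial_set A \<Longrightarrow> simplicial_iso A A (simp_id A)"
  by (rule isoI[OF map_id map_id]) (auto simp: simp_id_comp map_id)

lemma iso_comp:
  assumes "simplicial_iso A B F" "simplicial_iso B C G" "simplicial_set A" "simplicial_set C"
  shows "simplicial_iso A C (simp_comp A G F)"
proof -
  obtain F' where F': "simplicial_iso B A F'" "\<And>n x. x \<in> simps A n \<Longrightarrow> F' n (F n x) = x" 
     "\<And>n x. x \<in> simps B n \<Longrightarrow> F n (F' n x) = x"
    by (rule iso_inverse[OF assms(1)]) blast
  obtain G' where G': "simplicial_iso C B G'" "\<And>n x. x \<in> simps B n \<Longrightarrow> G' n (G n x) = x" 
     "\<And>n x. x \<in> simps C n \<Longrightarrow> G n (G' n x) = x"
    by (rule iso_inverse[OF assms(2)]) blast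
  note m = isoD[OF assms(1)] isoD[OF assms(2)] isoD[OF F'(1)] isoD[OF G'(1)]
  have "simplicial_map A C (simp_comp A G F)" "simplicial_map C A (simp_comp C F' G')"
    using m assms map_comp by blast+
  moreover have "simp_comp A (simp_comp C F' G') (simp_comp A G F) = simp_id A"
    by (rule map_eqI[OF map_comp[OF calculation assms(3)] map_id[OF assms(3)]])
      (use m F' G' in \<open>simp add: simp_comp_apply simp_id_apply map_in\<close>)
  moreover have "simp_comp C (simp_comp A G F) (simp_comp C F' G') = simp_id C"
    by (rule map_eqI[OF map_comp[OF calculation(2,1) assms(4)] map_id[OF assms(4)]])
      (use m F' G' in \<open>simp add: simp_comp_apply simp_id_apply map_in\<close>)
  ultimately show ?thesis by (rule isoI)
qed

text \<open>The inverse of \<open>F\<close> gives a square with a filler in the opposite direction.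
  Both composites agree with identities on the subdivision and after the culf map, so
  \<open>cancel_culf\<close> applies.\<close>

lemma filler_iso:
  fixes c d F :: "'u smap"
  assumes x: "(A, a) \<in> U_obj m" and y: "(B, b) \<in> U_obj m" and c: "strict_culf A C c" and d: "strict_culf B D d"
    and F: "simplicial_iso C D F"
    and eq: "simp_comp (std_simplex m) d b = simp_comp (std_simplex m) (simp_comp A F c) a"
  shows "simplicial_iso A B (filler m (A, a) (B, b) (simp_comp A F c) d)"
proof -
  obtain F' where F': "simplicial_iso D C F'" "\<And>n x. x \<in> simps C n \<Longrightarrow> F' n (F n x) = x" 
     "\<And>n x. x \<in> simps D n \<Longrightarrow> F n (F' n x) = x"
    by (rule iso_inverse[OF F]) blast
  note SA = U_objD(2)[OF x] and SB = U_objD(2)[OF y]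
  note am = U_objD(3)[OF x] and bm = U_objD(3)[OF y]
  note cm = culf_map[OF c] and dm = culf_map[OF d] and Fm = isoD[OF F] and F'm = isoD[OF F'(1)]
  let ?G = "filler m (A, a) (B, b) (simp_comp A F c) d"
  note G = filler_spec[OF x y d map_comp[OF cm Fm SA] eq]
  have eqp: "d k (b k q) = F k (c k (a k q))" if "q \<in> Delta k m" for k q
    using fun_cong[OF fun_cong[OF eq, of k], of q] that map_in[OF am, of q k] by (simp add: simp_comp_apply)
  have eq2: "simp_comp (std_simplex m) c a = simp_comp (std_simplex m) (simp_comp B F' d) b"
  proof (rule map_eqI[OF map_comp[OF am cm std_simplicial_set] map_comp[OF bm map_comp[OF dm F'm SB] std_simplicial_set]])
    fix k q assume "q \<in> simps (std_simplex m) k"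
    then show "simp_comp (std_simplex m) c a k q = simp_comp (std_simplex m) (simp_comp B F' d) b k q"
      using map_in[OF am, of q k] map_in[OF bm, of q k] by (simp add: simp_comp_apply eqp F'(2) map_in[OF cm])
  qed
  let ?H = "filler m (B, b) (A, a) (simp_comp B F' d) c"
  note H = filler_spec[OF y x c map_comp[OF dm F'm SB] eq2]
  have Ga: "?G k (a k q) = b k q" if "q \<in> Delta k m" for k q
    using fun_cong[OF fun_cong[OF G(2), of k], of q] that by (simp add: simp_comp_apply)
  have Hb: "?H k (b k q) = a k q" if "q \<in> Delta k m" for k q
    using fun_cong[OF fun_cong[OF H(2), of k], of q] that by (simp add: simp_comp_apply)
  have dG: "d k (?G k s) = F k (c k s)" if "s \<in> simps A k" for k s
    using fun_cong[OF fun_cong[OF G(3), of k], of s] that by (simp add: simp_comp_apply)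
  have cH: "c k (?H k s) = F' k (d k s)" if "s \<in> simps B k" for k s
    using fun_cong[OF fun_cong[OF H(3), of k], of s] that by (simp add: simp_comp_apply)
  have HG: "simp_comp A ?H ?G = simp_id A"
  proof (rule cancel_culf[OF x c SA map_comp[OF G(1) H(1) SA] map_id[OF SA]])
    show "simp_comp (std_simplex m) (simp_comp A ?H ?G) a = simp_comp (std_simplex m) (simp_id A) a"
      by (rule map_eqI[OF map_comp[OF am map_comp[OF G(1) H(1) SA] std_simplicial_set] map_comp[OF am map_id[OF SA] std_simplicial_set]])
        (simp add: simp_comp_apply simp_id_apply std_in[OF x] Ga Hb)
    show "simp_comp A c (simp_comp A ?H ?G) = simp_comp A c (simp_id A)"
      by (rule map_eqI[OF map_comp[OF map_comp[OF G(1) H(1) SA] cm SA] map_comp[OF map_id[OF SA] cm SA]])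
        (simp add: simp_comp_apply simp_id_apply cH dG F' map_in[OF G(1)] map_in[OF cm])
  qed
  have GH: "simp_comp B ?G ?H = simp_id B"
  proof (rule cancel_culf[OF y d SB map_comp[OF H(1) G(1) SB] map_id[OF SB]])
    show "simp_comp (std_simplex m) (simp_comp B ?G ?H) b = simp_comp (std_simplex m) (simp_id B) b"
      by (rule map_eqI[OF map_comp[OF bm map_comp[OF H(1) G(1) SB] std_simplicial_set] map_comp[OF bm map_id[OF SB] std_simplicial_set]])
        (simp add: simp_comp_apply simp_id_apply std_in[OF y] Ga Hb)
    show "simp_comp B d (simp_comp B ?G ?H) = simp_comp B d (simp_id B)"
      by (rule map_eqI[OF map_comp[OF map_comp[OF H(1) G(1) SB] dm SB] map_comp[OF map_id[OF SB] dm SB]])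
        (simp add: simp_comp_apply simp_id_apply cH dG F' map_in[OF H(1)] map_in[OF dm])
  qed
  show ?thesis by (rule isoI[OF G(1) H(1) HG GH])
qed

subsection \<open>The levels of the pseudo-simplicial groupoid\<close>

lemma U_level_sel [simp]: "Obj (U_level n) = U_obj n" "Arr (U_level n) = U_arr n"
  "Src (U_level n) (x, y, F) = x" "Tgt (U_level n) (x, y, F) = y"
  "Unit (U_level n) x = (x, x, simp_id (fst x))"
  "Comp (U_level n) (y, z, G) (x, y', F) = (x, z, simp_comp (fst x) G F)"
  by (auto simp: U_level_def)

lemma U_groupoid_sel [simp]: "level (U_groupoid ch) = U_level" "pull (U_groupoid ch) = U_pull ch"
   "coh (U_groupoid ch) = U_coh ch"
  by (auto simp: U_groupoid_def)

lemma U_arr_iff: "((A, a), (B, b), F) \<in> U_arr n \<longleftrightarrow> (A, a) \<in> U_obj n \<and> (B, b) \<in> U_obj n \<and>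
                simplicial_iso A B F \<and> simp_comp (std_simplex n) F a = b"
  by (auto simp: U_arr_def)

lemma U_hom: "t \<in> hom (U_level n) x y \<longleftrightarrow> (\<exists>F. t = (x, y, F) \<and> t \<in> U_arr n)"
  unfolding hom_def by (cases t) auto

lemma U_arr_apply:
  assumes "((A, a), (B, b), F) \<in> U_arr n" "q \<in> Delta k n"
  shows "F k (a k q) = b k q"
proof -
  have "simp_comp (std_simplex n) F a = b" using assms by (simp add: U_arr_iff)
  from fun_cong[OF fun_cong[OF this, of k], of q] assms show ?thesis by (simp add: simp_comp_apply)
qed

lemma U_arrI:
  assumes "(A, a) \<in> U_obj n" "(B, b) \<in> U_obj n" "simplicial_iso A B F" "\<And>k q. q \<in> Delta k n \<Longrightarrow> F k (a k q) = b k q"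
  shows "((A, a), (B, b), F) \<in> U_arr n"
proof -
  have "simp_comp (std_simplex n) F a = b"
    by (rule map_eqI[OF map_comp[OF U_objD(3)[OF assms(1)] isoD[OF assms(3)] std_simplicial_set] U_objD(3)[OF assms(2)]])
      (simp add: simp_comp_apply assms(4))
  then show ?thesis using assms by (simp add: U_arr_iff)
qed

lemma U_arr_inverse:
  assumes "((A, a), (B, b), F) \<in> U_arr n"
  obtains G where "((B, b), (A, a), G) \<in> U_arr n" "simp_comp A G F = simp_id A" "simp_comp B F G = simp_id B"
    "\<And>n x. x \<in> simps A n \<Longrightarrow> G n (F n x) = x" "\<And>n x. x \<in> simps B n \<Longrightarrow> F n (G n x) = x"
proof -
  have F: "(A, a) \<in> U_obj n" "(B, b) \<in> U_obj n" "simplicial_iso A B F" using assms by (auto simp: U_arr_iff)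
  obtain G where G: "simplicial_iso B A G" "simp_comp A G F = simp_id A" "simp_comp B F G = simp_id B"
    "\<And>n x. x \<in> simps A n \<Longrightarrow> G n (F n x) = x" "\<And>n x. x \<in> simps B n \<Longrightarrow> F n (G n x) = x"
    by (rule iso_inverse[OF F(3)]) blast
  have "((B, b), (A, a), G) \<in> U_arr n"
    by (rule U_arrI[OF F(2,1) G(1)]) (metis G(4) U_arr_apply[OF assms] std_in[OF F(1)])
  with G that show ?thesis by blast
qed

lemma U_invertible: "t \<in> U_arr n \<Longrightarrow> invertible (U_level n) t"
proof -
  assume t: "t \<in> U_arr n"
  obtain A a B b F where e: "t = ((A, a), (B, b), F)" by (metis surj_pair)
  obtain G where G: "((B, b), (A, a), G) \<in> U_arr n" "simp_comp A G F = simp_id A" "simp_comp B F G = simp_id B"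
    by (rule U_arr_inverse[OF t[unfolded e]]) blast
  then show ?thesis unfolding invertible_def e using t e
    by (auto simp: U_hom intro!: bexI[of _ "((B, b), (A, a), G)"])
qed

lemma U_arr_comp:
  assumes "((A, a), (B, b), F) \<in> U_arr n" "((B, b), (C, c), G) \<in> U_arr n"
  shows "((A, a), (C, c), simp_comp A G F) \<in> U_arr n"
proof -
  have F: "(A, a) \<in> U_obj n" "simplicial_iso A B F" using assms by (auto simp: U_arr_iff)
  have G: "(C, c) \<in> U_obj n" "simplicial_iso B C G" using assms by (auto simp: U_arr_iff)
  show ?thesis
    by (rule U_arrI[OF F(1) G(1) iso_comp[OF F(2) G(2) U_objD(2)[OF F(1)] U_objD(2)[OF G(1)]]])
      (simp add: simp_comp_apply std_in[OF F(1)] U_arr_apply[OF assms(1)] U_arr_apply[OF assms(2)])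
qed

section \<open>Restriction and pullback of subdivisions\<close>

definition res :: "nat \<Rightarrow> nat \<Rightarrow> (nat \<Rightarrow> nat) \<Rightarrow> (nat \<Rightarrow> (nat \<Rightarrow> nat) \<Rightarrow> 's) \<Rightarrow> nat \<Rightarrow> (nat \<Rightarrow> nat) \<Rightarrow> 's" where
  "res m n p a = simp_comp (std_simplex m) a (std_map m n p)"

lemma res_apply: "q \<in> Delta k m \<Longrightarrow> res m n p a k q = a k (compose {..k} p q)"
  by (simp add: res_def simp_comp_apply std_map_apply)

lemma res_map: "p \<in> Delta m n \<Longrightarrow> simplicial_map (std_simplex n) A a \<Longrightarrow> simplicial_map (std_simplex m) A (res m n p a)"
  unfolding res_def by (rule map_comp[OF std_map_in _ std_simplicial_set])

lemma res_obj:
  assumes p: "active m n p" and x: "(A, a) \<in> U_obj n"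
  shows "(A, res m n p a) \<in> U_obj m"
  using p U_objD[OF x] by (intro U_objI res_map) (auto simp: active_def res_apply vtx_in comp_vtx)

lemma res_arr:
  assumes p: "active m n p" and x: "((A, a), (B, b), F) \<in> U_arr n"
  shows "((A, res m n p a), (B, res m n p b), F) \<in> U_arr m"
  using x p by (intro U_arrI res_obj[OF p]) (auto simp: U_arr_iff res_apply Delta_comp active_in U_arr_apply[OF x])

locale choice =
  fixes ch :: "'u choice"
  assumes ch: "factorisation_choice ch"
begin

lemma ch_cases:
  assumes p: "p \<in> Delta m n" and x: "(A, a) \<in> U_obj n"
  obtains A' a' c where "ch m n p (A, a) = ((A', a'), c)" "(A', a') \<in> U_obj m" "strict_culf A' A c"
    "simp_comp (std_simplex m) c a' = res m n p a" "\<And>k q. q \<in> Delta k m \<Longrightarrow> c k (a' k q) = a k (compose {..k} p q)"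
proof -
  obtain A' a' c where e: "ch m n p (A, a) = ((A', a'), c)" by (metis surj_pair)
  with ch[unfolded factorisation_choice_def, rule_format, OF p x e]
  have *: "(A', a') \<in> U_obj m" "strict_culf A' A c" "simp_comp (std_simplex m) c a' = res m n p a"
    by (auto simp: U_obj_def res_def)
  have "c k (a' k q) = a k (compose {..k} p q)" if "q \<in> Delta k m" for k q
    using fun_cong[OF fun_cong[OF *(3), of k], of q] that by (simp add: simp_comp_apply res_apply)
  with * e that show ?thesis by blast
qed

lemma ch_active:
  assumes p: "active m n p" and x: "(A, a) \<in> U_obj n"
  shows "ch m n p (A, a) = ((A, res m n p a), simp_id A)"
proof -
  obtain A' a' c where e: "ch m n p (A, a) = ((A', a'), c)" by (metis surj_pair)
  from ch[unfolded factorisation_choice_def, rule_format, OF active_in[OF p] x e] p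
  have "A' = A" "c = simp_id A" "stretched (std_simplex m) A a'" "simp_comp (std_simplex m) c a' = res m n p a"
    by (auto simp: res_def)
  then show ?thesis using e by (auto simp: simp_id_comp stretched_def)
qed

lemma pull_ob: "x \<in> U_obj n \<Longrightarrow> ob_map (U_pull ch m n p) x = fst (ch m n p x)"
  by (simp add: U_pull_def)

lemma pull_ob_active: "active m n p \<Longrightarrow> (A, a) \<in> U_obj n \<Longrightarrow> ob_map (U_pull ch m n p) (A, a) = (A, res m n p a)"
  by (simp add: pull_ob ch_active)

text \<open>The last equation, together with the effect on the subdivision, determines
  \<open>G\<close> by \<open>cancel_culf\<close>; the definite description behind
  \<open>filler\<close> can thus stay folded from here on.\<close>

lemma pull_arr:
  assumes p: "p \<in> Delta m n" and F: "((A, a), (B, b), F) \<in> U_arr n"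
    and cA: "ch m n p (A, a) = ((A', a'), c)" and cB: "ch m n p (B, b) = ((B', b'), d)"
  obtains G where "arr_map (U_pull ch m n p) ((A, a), (B, b), F) = ((A', a'), (B', b'), G)"
    "((A', a'), (B', b'), G) \<in> U_arr m" "\<And>k s. s \<in> simps A' k \<Longrightarrow> d k (G k s) = F k (c k s)"
proof -
  have x: "(A, a) \<in> U_obj n" and y: "(B, b) \<in> U_obj n" and iso: "simplicial_iso A B F" using F by (auto simp: U_arr_iff)
  from ch_cases[OF p x] cA have A: "(A', a') \<in> U_obj m" "strict_culf A' A c" "\<And>k q. q \<in> Delta k m \<Longrightarrow> c k (a' k q) = a k (compose {..k} p q)"
    by (metis prod.inject)+
  from ch_cases[OF p y] cB have B: "(B', b') \<in> U_obj m" "strict_culf B' B d" "\<And>k q. q \<in> Delta k m \<Longrightarrow> d k (b' k q) = b k (compose {..k} p q)"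
    by (metis prod.inject)+
  note cm = culf_map[OF A(2)] and dm = culf_map[OF B(2)] and Fm = isoD[OF iso]
  note u = map_comp[OF cm Fm U_objD(2)[OF A(1)]]
  have eq: "simp_comp (std_simplex m) d b' = simp_comp (std_simplex m) (simp_comp A' F c) a'"
    by (rule map_eqI[OF map_comp[OF U_objD(3)[OF B(1)] dm std_simplicial_set] map_comp[OF U_objD(3)[OF A(1)] u std_simplicial_set]])
      (simp add: simp_comp_apply std_in[OF A(1)] A(3) B(3) U_arr_apply[OF F] Delta_comp[OF _ p])
  let ?G = "filler m (A', a') (B', b') (simp_comp A' F c) d"
  have 1: "arr_map (U_pull ch m n p) ((A, a), (B, b), F) = ((A', a'), (B', b'), ?G)"
    using F by (simp add: U_pull_def cA cB Let_def)
  note G = filler_spec[OF A(1) B(1,2) u eq]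
  have 2: "((A', a'), (B', b'), ?G) \<in> U_arr m"
    unfolding U_arr_iff using A(1) B(1) filler_iso[OF A(1) B(1) A(2) B(2) iso eq] G(2) by blast
  have 3: "d k (?G k s) = F k (c k s)" if "s \<in> simps A' k" for k s
    using fun_cong[OF fun_cong[OF G(3), of k], of s] that by (simp add: simp_comp_apply)
  from 1 2 3 that show ?thesis by blast
qed

lemma pull_arr_active:
  assumes p: "active m n p" and F: "((A, a), (B, b), F) \<in> U_arr n"
  shows "arr_map (U_pull ch m n p) ((A, a), (B, b), F) = ((A, res m n p a), (B, res m n p b), F)"
proof -
  have x: "(A, a) \<in> U_obj n" and y: "(B, b) \<in> U_obj n" and iso: "simplicial_iso A B F" using F by (auto simp: U_arr_iff)
  obtain G where G: "arr_map (U_pull ch m n p) ((A, a), (B, b), F) = ((A, res m n p a), (B, res m n p b), G)"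
    "((A, res m n p a), (B, res m n p b), G) \<in> U_arr m" "\<And>k s. s \<in> simps A k \<Longrightarrow> simp_id B k (G k s) = F k (simp_id A k s)"
    by (rule pull_arr[OF active_in[OF p] F ch_active[OF p x] ch_active[OF p y]]) blast
  have Gm: "simplicial_map A B G" using G(2) isoD by (auto simp: U_arr_iff)
  have "G = F" by (rule map_eqI[OF Gm isoD[OF iso]]) (use G(3) map_in[OF Gm] in \<open>auto simp: simp_id_apply\<close>)
  with G show ?thesis by simp
qed

end

subsection \<open>Pushouts of active maps along inert maps\<close>

definition shift :: "nat \<Rightarrow> nat \<Rightarrow> nat \<Rightarrow> nat" where
  "shift a k = (\<lambda>i\<in>{..k}. a + i)"

text \<open>Replaces the middle block \<open>[k]\<close> of \<open>[a + k + b]\<close> by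
  \<open>[m]\<close> along \<open>g\<close>, keeping \<open>a\<close> vertices before it and
  \<open>b\<close> after it. For active \<open>g\<close> this is the pushout of \<open>g\<close>
  along \<open>shift a k\<close>.\<close>

definition extend :: "nat \<Rightarrow> nat \<Rightarrow> nat \<Rightarrow> nat \<Rightarrow> (nat \<Rightarrow> nat) \<Rightarrow> nat \<Rightarrow> nat" where
  "extend a b k m g = (\<lambda>i\<in>{..a + k + b}. if i < a then i else if i \<le> a + k then a + g (i - a) else i - k + m)"

lemma shift_in: "a + k \<le> n \<Longrightarrow> shift a k \<in> Delta k n"
  by (intro DeltaI) (auto simp: shift_def)

lemma shift_inert: "a + k \<le> n \<Longrightarrow> inert k n (shift a k)"
  by (simp add: inert_def shift_in) (simp add: shift_def)

lemma shift_apply: "i \<le> k \<Longrightarrow> shift a k i = a + i"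
  by (simp add: shift_def)

lemma extend_simps:
  "i < a \<Longrightarrow> extend a b k m g i = i"
  "i \<le> k \<Longrightarrow> extend a b k m g (a + i) = a + g i"
  "j < b \<Longrightarrow> extend a b k m g (Suc (a + k + j)) = Suc (a + m + j)"
  by (auto simp: extend_def)

lemma extend_cases:
  assumes "i \<le> a + k + b"
  obtains "i < a" | j where "i = a + j" "j \<le> k" | j where "i = Suc (a + k + j)" "j < b"
proof -
  consider "i < a" | "a \<le> i" "i \<le> a + k" | "a + k < i" by linarith
  then show ?thesis
  proof cases
    case 2
    then show ?thesis using that(2)[of "i - a"] by auto
  next
    case 3
    then show ?thesis using that(3)[of "i - Suc (a + k)"] assms by auto
  qed (use that in auto)
qed

lemma extend_in:
  assumes g: "g \<in> Delta k m"
  shows "extend a b k m g \<in> Delta (a + k + b) (a + m + b)"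
proof (rule DeltaI)
  fix i assume "i \<le> a + k + b"
  then show "extend a b k m g i \<le> a + m + b"
    by (cases rule: extend_cases) (use Delta_le[OF g] in \<open>auto simp: extend_simps intro: trans_le_add1\<close>)
next
  fix i j assume ij: "i \<le> j" and j: "j \<le> a + k + b"
  from ij j have "i \<le> a + k + b" by simp
  then show "extend a b k m g i \<le> extend a b k m g j"
  proof (cases rule: extend_cases)
    case 1
    from j show ?thesis by (cases rule: extend_cases) (use 1 ij in \<open>auto simp: extend_simps\<close>)
  next
    case (2 i')
    from j show ?thesis
      by (cases rule: extend_cases) (use 2 ij Delta_le[OF g, of i'] Delta_mono[OF g, of i'] in \<open>auto simp: extend_simps\<close>)
  next
    case (3 i')
    from j show ?thesis by (cases rule: extend_cases) (use 3 ij in \<open>auto simp: extend_simps\<close>)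
  qed
qed (simp add: extend_def)

lemma extend_active: "active k m g \<Longrightarrow> active (a + k + b) (a + m + b) (extend a b k m g)"
  using extend_in[of g k m a b] unfolding active_def by (auto simp: extend_def)

lemma extend_shift:
  assumes g: "g \<in> Delta k m"
  shows "compose {..k} (extend a b k m g) (shift a k) = compose {..k} (shift a m) g"
proof (rule Delta_eqI)
  show "compose {..k} (extend a b k m g) (shift a k) \<in> Delta k (a + m + b)"
    by (rule Delta_comp[OF shift_in extend_in[OF g]]) simp
  show "compose {..k} (shift a m) g \<in> Delta k (a + m + b)"
    by (rule Delta_comp[OF g shift_in]) simp
qed (simp add: comp_apply shift_apply extend_simps Delta_le[OF g])

text \<open>The map out of a cocone is glued from \<open>v\<close> before and after the middle block
  and \<open>u\<close> on it. As \<open>g\<close> is active, \<open>u\<close> and \<open>v\<close>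
  agree at both ends of the block, which makes the glued map monotone.\<close>

lemma delta_pushout_extend:
  assumes g: "active k m g"
  shows "delta_pushout k m (a + k + b) (a + m + b) g (shift a k) (shift a m) (extend a b k m g)"
  unfolding delta_pushout_def
proof (intro conjI allI ballI impI)
  have gD: "g \<in> Delta k m" "g 0 = 0" "g k = m" using g by (auto simp: active_def)
  show "g \<in> Delta k m" by fact
  show "shift a k \<in> Delta k (a + k + b)" "shift a m \<in> Delta m (a + m + b)" by (rule shift_in, simp)+
  show "extend a b k m g \<in> Delta (a + k + b) (a + m + b)" by (rule extend_in[OF gD(1)])
  show "compose {..k} (shift a m) g = compose {..k} (extend a b k m g) (shift a k)" by (simp add: extend_shift gD)
  fix e u v assume u: "u \<in> Delta m e" and v: "v \<in> Delta (a + k + b) e" and eq: "compose {..k} u g = compose {..k} v (shift a k)"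
  have eq': "u (g i) = v (a + i)" if "i \<le> k" for i
    using fun_cong[OF eq, of i] that by (simp add: comp_apply shift_apply)
  define h where "h = (\<lambda>i\<in>{..a + m + b}. if i < a then v i else if i \<le> a + m then u (i - a) else v (i - m + k))"
  have hs: "i < a \<Longrightarrow> h i = v i" "i \<le> m \<Longrightarrow> h (a + i) = u i" "j < b \<Longrightarrow> h (Suc (a + m + j)) = v (Suc (a + k + j))" for i j
    by (auto simp: h_def add_ac)
  have va: "i < a \<Longrightarrow> v i \<le> u 0" for i using eq'[of 0] gD Delta_mono[OF v, of i a] by simp
  have vb: "j < b \<Longrightarrow> u m \<le> v (Suc (a + k + j))" for j
    using eq'[of k] gD Delta_mono[OF v, of "a + k" "Suc (a + k + j)"] by simp
  have h: "h \<in> Delta (a + m + b) e"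
  proof (rule DeltaI)
    fix i assume "i \<le> a + m + b"
    then show "h i \<le> e" by (cases rule: extend_cases) (auto simp: hs Delta_le[OF u] Delta_le[OF v])
  next
    fix i j assume ij: "i \<le> j" and j: "j \<le> a + m + b"
    from ij j have "i \<le> a + m + b" by simp
    then show "h i \<le> h j"
    proof (cases rule: extend_cases)
      case 1
      from j show ?thesis
      proof (cases rule: extend_cases)
        case (2 j')
        then show ?thesis using 1 va[of i] Delta_mono[OF u, of 0 j'] by (simp add: hs)
      qed (use 1 ij in \<open>auto simp: hs Delta_mono[OF v]\<close>)
    next
      case (2 i')
      from j show ?thesis
      proof (cases rule: extend_cases)
        case (3 j')
        then show ?thesis using 2 vb[of j'] Delta_mono[OF u, of i' m] by (simp add: hs)
      qed (use 2 ij in \<open>auto simp: hs Delta_mono[OF u]\<close>)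
    next
      case (3 i')
      from j show ?thesis by (cases rule: extend_cases) (use 3 ij in \<open>auto simp: hs Delta_mono[OF v]\<close>)
    qed
  qed (simp add: h_def)
  have h1: "compose {..m} h (shift a m) = u"
    by (rule Delta_eqI[OF Delta_comp[OF shift_in h] u]) (simp_all add: comp_apply shift_apply hs)
  have h2: "compose {..a + k + b} h (extend a b k m g) = v"
  proof (rule Delta_eqI[OF Delta_comp[OF extend_in[OF gD(1)] h] v])
    fix i assume i: "i \<le> a + k + b"
    then show "compose {..a + k + b} h (extend a b k m g) i = v i"
      by (cases rule: extend_cases) (use i in \<open>auto simp: comp_apply extend_simps hs eq' Delta_le[OF gD(1)]\<close>)
  qed
  have "h' = h" if "h' \<in> Delta (a + m + b) e" "compose {..m} h' (shift a m) = u" "compose {..a + k + b} h' (extend a b k m g) = v" for h'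
  proof (rule Delta_eqI[OF that(1) h])
    have *: "h' (a + i) = u i" if "i \<le> m" for i
      using fun_cong[OF \<open>compose {..m} h' (shift a m) = u\<close>, of i] that by (simp add: comp_apply shift_apply)
    have **: "h' (extend a b k m g i) = v i" if "i \<le> a + k + b" for i
      using fun_cong[OF \<open>compose {..a + k + b} h' (extend a b k m g) = v\<close>, of i] that by (simp add: comp_apply)
    fix i assume "i \<le> a + m + b"
    then show "h' i = h i"
    proof (cases rule: extend_cases)
      case 1
      then show ?thesis using **[of i] by (simp add: hs extend_simps)
    next
      case (2 j)
      then show ?thesis using * by (simp add: hs)
    next
      case (3 j)
      then show ?thesis using **[of "Suc (a + k + j)"] by (simp add: hs extend_simps)
    qed
  qed
  with h h1 h2 show "\<exists>!h. h \<in> Delta (a + m + b) e \<and> compose {..m} h (shift a m) = u \<and> compose {..a + k + b} h (extend a b k m g) = v"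
    by blast
qed

lemma up_shift: "up k = shift 1 k"
  by (auto simp: up_def shift_def fun_eq_iff)

text \<open>With one vertex kept on each side, the pushout of \<open>g\<close> is
  \<open>hat\<close>; general gluing thereby becomes the gluing used for insertions.\<close>

lemma hat_extend: "hat k m g = extend 1 1 k m g"
  by (auto simp: hat_def extend_def fun_eq_iff)

subsection \<open>Groupoids\<close>

lemma homD: "f \<in> hom C x y \<Longrightarrow> f \<in> Arr C \<and> Src C f = x \<and> Tgt C f = y" by (simp add: hom_def)
lemma gpd_cat: "is_groupoid C \<Longrightarrow> is_category C" by (simp add: is_groupoid_def)

lemma cat_arr: "is_category C \<Longrightarrow> f \<in> Arr C \<Longrightarrow> Src C f \<in> Obj C \<and> Tgt C f \<in> Obj C"
  by (simp add: is_category_def)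

lemma cat_unit: "is_category C \<Longrightarrow> x \<in> Obj C \<Longrightarrow> Unit C x \<in> hom C x x"
  by (simp add: is_category_def)

lemma hom_obj:
  assumes "is_category C" "f \<in> hom C x y"
  shows "x \<in> Obj C" "y \<in> Obj C"
  using cat_arr[OF assms(1), of f] assms(2) by (auto simp: hom_def)

lemma cat_comp:
  assumes C: "is_category C" and f: "f \<in> hom C x y" and g: "g \<in> hom C y z"
  shows "Comp C g f \<in> hom C x z"
proof -
  have "\<forall>x \<in> Obj C. \<forall>y \<in> Obj C. \<forall>z \<in> Obj C. \<forall>f \<in> hom C x y. \<forall>g \<in> hom C y z. Comp C g f \<in> hom C x z"
    using C unfolding is_category_def by (elim conjE)
  then show ?thesis using hom_obj[OF C f] hom_obj[OF C g] f g by blast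
qed

lemma cat_unit_comp:
  assumes C: "is_category C" and f: "f \<in> hom C x y"
  shows "Comp C f (Unit C x) = f \<and> Comp C (Unit C y) f = f"
proof -
  have "\<forall>x \<in> Obj C. \<forall>y \<in> Obj C. \<forall>f \<in> hom C x y. Comp C f (Unit C x) = f \<and> Comp C (Unit C y) f = f"
    using C unfolding is_category_def by (elim conjE)
  then show ?thesis using hom_obj[OF C f] f by blast
qed

lemma cat_assoc:
  assumes C: "is_category C" and f: "f \<in> hom C w x" and g: "g \<in> hom C x y" and h: "h \<in> hom C y z"
  shows "Comp C h (Comp C g f) = Comp C (Comp C h g) f"
proof -
  have "\<forall>w \<in> Obj C. \<forall>x \<in> Obj C. \<forall>y \<in> Obj C. \<forall>z \<in> Obj C.
        \<forall>f \<in> hom C w x. \<forall>g \<in> hom C x y. \<forall>h \<in> hom C y z. Comp C h (Comp C g f) = Comp C (Comp C h g) f"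
    using C unfolding is_category_def by (elim conjE)
  then show ?thesis using hom_obj[OF C f] hom_obj[OF C h] f g h by blast
qed

lemma gpd_inv:
  assumes "is_groupoid C" "f \<in> hom C x y"
  obtains g where "g \<in> hom C y x" "Comp C g f = Unit C x" "Comp C f g = Unit C y"
  using assms unfolding is_groupoid_def invertible_def by (auto simp: hom_def)

lemma inv_unique:
  assumes C: "is_category C" and f: "f \<in> hom C x y" and g: "g \<in> hom C y x" "Comp C g f = Unit C x"
    and h: "h \<in> hom C y x" "Comp C f h = Unit C y"
  shows "g = h"
proof -
  have "g = Comp C g (Comp C f h)" using cat_unit_comp[OF C g(1)] h(2) by simp
  also have "\<dots> = Comp C (Comp C g f) h" by (rule cat_assoc[OF C h(1) f g(1)])
  also have "\<dots> = h" using cat_unit_comp[OF C h(1)] g(2) by simp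
  finally show ?thesis .
qed

locale sgpd =
  fixes X :: "('o, 'a) simplicial"
  assumes X: "simplicial_groupoid X"
begin

abbreviation "Ob n \<equiv> Obj (level X n)"
abbreviation "Ar n \<equiv> Arr (level X n)"
abbreviation "P m n p \<equiv> ob_map (pull X m n p)"
abbreviation "Q m n p \<equiv> arr_map (pull X m n p)"

lemma gpd: "is_groupoid (level X n)" using X by (simp add: simplicial_groupoid_def)
lemmas cat = gpd_cat[OF gpd]

lemma pull_functor: "p \<in> Delta m n \<Longrightarrow> is_functor (level X n) (level X m) (pull X m n p)"
  using X by (simp add: simplicial_groupoid_def)

lemma P_in: "p \<in> Delta m n \<Longrightarrow> x \<in> Ob n \<Longrightarrow> P m n p x \<in> Ob m"
  using pull_functor unfolding is_functor_def by blast

lemma Q_in: "p \<in> Delta m n \<Longrightarrow> f \<in> Ar n \<Longrightarrow> Q m n p f \<in> Ar m"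
  using pull_functor unfolding is_functor_def by blast

lemma Q_src: "p \<in> Delta m n \<Longrightarrow> f \<in> Ar n \<Longrightarrow> Src (level X m) (Q m n p f) = P m n p (Src (level X n) f)"
  using pull_functor unfolding is_functor_def by blast

lemma Q_tgt: "p \<in> Delta m n \<Longrightarrow> f \<in> Ar n \<Longrightarrow> Tgt (level X m) (Q m n p f) = P m n p (Tgt (level X n) f)"
  using pull_functor unfolding is_functor_def by blast

lemma Q_hom: "p \<in> Delta m n \<Longrightarrow> f \<in> hom (level X n) x y \<Longrightarrow> Q m n p f \<in> hom (level X m) (P m n p x) (P m n p y)"
  by (simp add: hom_def Q_in Q_src Q_tgt)

lemma Q_unit: "p \<in> Delta m n \<Longrightarrow> x \<in> Ob n \<Longrightarrow> Q m n p (Unit (level X n) x) = Unit (level X m) (P m n p x)"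
  using pull_functor unfolding is_functor_def by blast

lemma Q_comp: "p \<in> Delta m n \<Longrightarrow> f \<in> hom (level X n) x y \<Longrightarrow> g \<in> hom (level X n) y z \<Longrightarrow>
  Q m n p (Comp (level X n) g f) = Comp (level X m) (Q m n p g) (Q m n p f)"
  using pull_functor[of p m n] unfolding is_functor_def hom_def by simp

lemma arr_ob: "f \<in> hom (level X n) x y \<Longrightarrow> x \<in> Ob n \<and> y \<in> Ob n"
  using cat_arr[OF cat] by (auto simp: hom_def)

lemma P_P: "q \<in> Delta l m \<Longrightarrow> p \<in> Delta m n \<Longrightarrow> x \<in> Ob n \<Longrightarrow> P l m q (P m n p x) = P l n (compose {..l} p q) x"
  using X unfolding simplicial_groupoid_def comp_functor_def by (simp add: compose_def)

lemma Q_Q: "q \<in> Delta l m \<Longrightarrow> p \<in> Delta m n \<Longrightarrow> x \<in> Ar n \<Longrightarrow> Q l m q (Q m n p x) = Q l n (compose {..l} p q) x"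
  using X unfolding simplicial_groupoid_def comp_functor_def by (simp add: compose_def)

lemma P_id: "x \<in> Ob n \<Longrightarrow> P n n (delta_id n) x = x"
  using X unfolding simplicial_groupoid_def id_functor_def by simp

lemma Q_id: "x \<in> Ar n \<Longrightarrow> Q n n (delta_id n) x = x"
  using X unfolding simplicial_groupoid_def id_functor_def by simp

end

section \<open>Gluing and lifting in a rigid decomposition groupoid\<close>

locale rigid = sgpd +
  assumes rigid: "rigid_decomposition_groupoid X"
begin

lemma extend_pullback:
  assumes g: "active k m g"
  shows "strict_pullback (level X (a + m + b)) (level X m) (level X (a + k + b))
     (pull X m (a + m + b) (shift a m)) (pull X (a + k + b) (a + m + b) (extend a b k m g))
     (pull X k m g) (pull X k (a + k + b) (shift a k))"
  using rigid g shift_inert[of a k "a + k + b"] delta_pushout_extend[OF g]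
  unfolding rigid_decomposition_groupoid_def by (metis le_add1)

lemma extend_ob_ex1:
  assumes "active k m g" "y \<in> Ob m" "w \<in> Ob (a + k + b)" "P k m g y = P k (a + k + b) (shift a k) w"
  shows "\<exists>!Y. Y \<in> Ob (a + m + b) \<and> P m (a + m + b) (shift a m) Y = y \<and>
    P (a + k + b) (a + m + b) (extend a b k m g) Y = w"
  by (rule set_pullback_ex1[OF conjunct1[OF extend_pullback[OF assms(1), of a b, unfolded strict_pullback_def]] assms(2-4)])

lemma extend_ar_ex1:
  assumes "active k m g" "y \<in> Ar m" "w \<in> Ar (a + k + b)" "Q k m g y = Q k (a + k + b) (shift a k) w"
  shows "\<exists>!Y. Y \<in> Ar (a + m + b) \<and> Q m (a + m + b) (shift a m) Y = y \<and>
    Q (a + k + b) (a + m + b) (extend a b k m g) Y = w"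
  by (rule set_pullback_ex1[OF conjunct2[OF extend_pullback[OF assms(1), of a b, unfolded strict_pullback_def]] assms(2-4)])

text \<open>The form in which the decomposition condition is mostly used: \<open>y\<close> refines
  the inner part of \<open>w\<close> along \<open>g\<close>, while the two ends of \<open>w\<close>
  are kept.\<close>

lemma hat_ob_ex1:
  assumes "active k m g" "y \<in> Ob m" "w \<in> Ob (Suc (Suc k))" "P k m g y = P k (Suc (Suc k)) (up k) w"
  shows "\<exists>!Y. Y \<in> Ob (Suc (Suc m)) \<and> P m (Suc (Suc m)) (up m) Y = y \<and>
    P (Suc (Suc k)) (Suc (Suc m)) (hat k m g) Y = w"
  using extend_ob_ex1[of k m g y w 1 1] assms unfolding up_shift hat_extend by simp

lemma hat_ar_ex1:
  assumes "active k m g" "y \<in> Ar m" "w \<in> Ar (Suc (Suc k))" "Q k m g y = Q k (Suc (Suc k)) (up k) w"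
  shows "\<exists>!Y. Y \<in> Ar (Suc (Suc m)) \<and> Q m (Suc (Suc m)) (up m) Y = y \<and>
    Q (Suc (Suc k)) (Suc (Suc m)) (hat k m g) Y = w"
  using extend_ar_ex1[of k m g y w 1 1] assms unfolding up_shift hat_extend by simp

lemma hat_ob_eqI:
  assumes g: "active k m g" and Y: "Y \<in> Ob (Suc (Suc m))" "Y' \<in> Ob (Suc (Suc m))"
   "P m (Suc (Suc m)) (up m) Y = P m (Suc (Suc m)) (up m) Y'"
   "P (Suc (Suc k)) (Suc (Suc m)) (hat k m g) Y = P (Suc (Suc k)) (Suc (Suc m)) (hat k m g) Y'"
  shows "Y = Y'"
proof -
  note gi = active_in[OF g]
  have "P k m g (P m (Suc (Suc m)) (up m) Y) = P k (Suc (Suc k)) (up k) (P (Suc (Suc k)) (Suc (Suc m)) (hat k m g) Y)"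
    using Y(1) gi by (simp add: P_P hat_in hat_up)
  from hat_ob_ex1[OF g P_in[OF up_in Y(1)] P_in[OF hat_in[OF gi] Y(1)] this] Y show ?thesis by metis
qed

lemma edge_lift: "e \<in> Ob 2 \<Longrightarrow> f \<in> Ar 1 \<Longrightarrow> Tgt (level X 1) f = P 1 2 (long 2) e \<Longrightarrow>
   \<exists>!g. g \<in> Ar 2 \<and> Tgt (level X 2) g = e \<and> Q 1 2 (long 2) g = f"
proof -
  have "coface 1 1 = long 2" by (auto simp: fun_eq_iff coface_def long_def)
  with rigid show "e \<in> Ob 2 \<Longrightarrow> f \<in> Ar 1 \<Longrightarrow> Tgt (level X 1) f = P 1 2 (long 2) e \<Longrightarrow>
    \<exists>!g. g \<in> Ar 2 \<and> Tgt (level X 2) g = e \<and> Q 1 2 (long 2) g = f"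
    unfolding rigid_decomposition_groupoid_def discrete_fibration_def by auto
qed

lemma long_1: "long (Suc 0) = delta_id (Suc 0)"
  by (auto simp: fun_eq_iff long_def delta_id_def)

text \<open>Subdividing the last edge presents level \<open>n + 2\<close> as a pullback of levels
  \<open>n + 1\<close> and \<open>2\<close> over level \<open>1\<close>, for objects and for arrows.
  A lift is therefore glued from a lift one dimension lower and a lift along the given discrete
  fibration.\<close>

lemma lift_tgt:
  assumes "e \<in> Ob (Suc n)" "f \<in> Ar 1" "Tgt (level X 1) f = P 1 (Suc n) (long (Suc n)) e"
  shows "\<exists>!g. g \<in> Ar (Suc n) \<and> Tgt (level X (Suc n)) g = e \<and> Q 1 (Suc n) (long (Suc n)) g = f"
  using assms
proof (induction n arbitrary: e)
  case 0
  show ?case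
  proof (rule ex1I[of _ f])
    show "f \<in> Ar (Suc 0) \<and> Tgt (level X (Suc 0)) f = e \<and> Q 1 (Suc 0) (long (Suc 0)) f = f"
      using 0 by (simp add: long_1 P_id Q_id)
    fix g assume "g \<in> Ar (Suc 0) \<and> Tgt (level X (Suc 0)) g = e \<and> Q 1 (Suc 0) (long (Suc 0)) g = f"
    then show "g = f" using Q_id[of g "Suc 0"] by (simp add: long_1)
  qed
next
  case (Suc n)
  \<comment> \<open>\<open>d : [n + 1] \<rightarrow> [n + 2]\<close> omits the vertex
    \<open>n + 1\<close>, \<open>s\<close> is the \<open>2\<close>-simplex on the last three
    vertices of \<open>[n + 2]\<close>, and \<open>t\<close> is the last edge of
    \<open>[n + 1]\<close>.\<close>
  define d where "d = extend n 0 1 2 (long 2)"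
  define s where "s = shift n 2"
  define t where "t = shift n 1"
  have dact: "active (Suc n) (Suc (Suc n)) d" using extend_active[OF long_active(1), of n 0 2] by (simp add: d_def)
  note d = active_in[OF dact]
  have s: "s \<in> Delta 2 (Suc (Suc n))" unfolding s_def by (rule shift_in) simp
  have t: "t \<in> Delta 1 (Suc n)" unfolding t_def by (rule shift_in) simp
  have sq: "compose {..1} d t = compose {..1} s (long 2)"
    unfolding d_def s_def t_def by (rule extend_shift) simp
  have ld: "compose {..1} d (long (Suc n)) = long (Suc (Suc n))" by (rule active_long(1)[OF dact])
  note e = Suc.prems(1) and f = Suc.prems(2)
  have "Tgt (level X 1) f = P 1 (Suc n) (long (Suc n)) (P (Suc n) (Suc (Suc n)) d e)"
    using Suc.prems(3) by (simp only: P_P[OF long_in(1) d e] ld)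
  from Suc.IH[OF P_in[OF d e] f this] obtain g where g: "g \<in> Ar (Suc n)"
    "Tgt (level X (Suc n)) g = P (Suc n) (Suc (Suc n)) d e" "Q 1 (Suc n) (long (Suc n)) g = f"
    and gu: "\<And>g'. g' \<in> Ar (Suc n) \<Longrightarrow> Tgt (level X (Suc n)) g' = P (Suc n) (Suc (Suc n)) d e \<Longrightarrow>
       Q 1 (Suc n) (long (Suc n)) g' = f \<Longrightarrow> g' = g" by blast
  have "Tgt (level X 1) (Q 1 (Suc n) t g) = P 1 2 (long 2) (P 2 (Suc (Suc n)) s e)"
    by (simp only: Q_tgt[OF t g(1)] g(2) P_P[OF t d e] P_P[OF long_in(1) s e] sq)
  from edge_lift[OF P_in[OF s e] Q_in[OF t g(1)] this]
  obtain h where h: "h \<in> Ar 2" "Tgt (level X 2) h = P 2 (Suc (Suc n)) s e" "Q 1 2 (long 2) h = Q 1 (Suc n) t g"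
    and hu: "\<And>h'. h' \<in> Ar 2 \<Longrightarrow> Tgt (level X 2) h' = P 2 (Suc (Suc n)) s e \<Longrightarrow> 
      Q 1 2 (long 2) h' = Q 1 (Suc n) t g \<Longrightarrow> h' = h" by blast
  have "\<exists>!Y. Y \<in> Ar (Suc (Suc n)) \<and> Q 2 (Suc (Suc n)) s Y = h \<and> Q (Suc n) (Suc (Suc n)) d Y = g"
    using extend_ar_ex1[OF long_active(1) h(1), of g n 0] g(1) h(3) unfolding d_def s_def t_def by simp
  then obtain Y where Y: "Y \<in> Ar (Suc (Suc n))" "Q 2 (Suc (Suc n)) s Y = h" "Q (Suc n) (Suc (Suc n)) d Y = g"
    and Yu: "\<And>Y'. Y' \<in> Ar (Suc (Suc n)) \<Longrightarrow> Q 2 (Suc (Suc n)) s Y' = h \<Longrightarrow> Q (Suc n) (Suc (Suc n)) d Y' = g \<Longrightarrow> Y' = Y"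
    by blast
  have ty: "Tgt (level X (Suc (Suc n))) Y \<in> Ob (Suc (Suc n))" using cat_arr[OF cat Y(1)] by simp
  \<comment> \<open>Gluing is unique on objects as well, and the target of \<open>Y\<close> has the
    same two parts as \<open>e\<close>; hence it is \<open>e\<close>.\<close>
  have "P 1 2 (long 2) (P 2 (Suc (Suc n)) s e) = P 1 (Suc n) t (P (Suc n) (Suc (Suc n)) d e)"
    by (simp only: P_P[OF t d e] P_P[OF long_in(1) s e] sq)
  then have "\<exists>!E. E \<in> Ob (Suc (Suc n)) \<and> P 2 (Suc (Suc n)) s E = P 2 (Suc (Suc n)) s e \<and>
     P (Suc n) (Suc (Suc n)) d E = P (Suc n) (Suc (Suc n)) d e"
    using extend_ob_ex1[OF long_active(1) P_in[OF s e], of "P (Suc n) (Suc (Suc n)) d e" n 0] P_in[OF d e]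
    unfolding d_def s_def t_def by simp
  moreover have "P 2 (Suc (Suc n)) s (Tgt (level X (Suc (Suc n))) Y) = P 2 (Suc (Suc n)) s e"
    "P (Suc n) (Suc (Suc n)) d (Tgt (level X (Suc (Suc n))) Y) = P (Suc n) (Suc (Suc n)) d e"
    using Q_tgt[OF s Y(1)] Q_tgt[OF d Y(1)] Y g h by simp_all
  ultimately have tgt: "Tgt (level X (Suc (Suc n))) Y = e" using ty e by blast
  show ?case
  proof (rule ex1I[of _ Y])
    show "Y \<in> Ar (Suc (Suc n)) \<and> Tgt (level X (Suc (Suc n))) Y = e \<and> Q 1 (Suc (Suc n)) (long (Suc (Suc n))) Y = f"
      using Y(1) tgt g(3) Q_Q[OF long_in(1) d Y(1)] ld Y(3) by simp
    fix Y' assume Y': "Y' \<in> Ar (Suc (Suc n)) \<and> Tgt (level X (Suc (Suc n))) Y' = e \<and> Q 1 (Suc (Suc n)) (long (Suc (Suc n))) Y' = f"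
    then have Yi: "Y' \<in> Ar (Suc (Suc n))" by simp
    have g': "Q (Suc n) (Suc (Suc n)) d Y' = g"
      by (rule gu) (use Y' in \<open>simp_all only: Q_in[OF d Yi] Q_tgt[OF d Yi] Q_Q[OF long_in(1) d Yi] ld\<close>)
    have "Q 1 2 (long 2) (Q 2 (Suc (Suc n)) s Y') = Q 1 (Suc n) t g"
      unfolding g'[symmetric] by (simp only: Q_Q[OF long_in(1) s Yi] Q_Q[OF t d Yi] sq)
    then have h': "Q 2 (Suc (Suc n)) s Y' = h"
      by (intro hu) (use Y' in \<open>simp_all only: Q_in[OF s Yi] Q_tgt[OF s Yi]\<close>)
    show "Y' = Y" by (rule Yu[OF Yi h' g'])
  qed
qed

lemma arr_inv:
  assumes "f \<in> hom (level X n) x y"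
  obtains g where "g \<in> hom (level X n) y x" "Comp (level X n) g f = Unit (level X n) x"
    "Comp (level X n) f g = Unit (level X n) y"
  by (rule gpd_inv[OF gpd assms]) blast

lemma Q_inv:
  assumes p: "p \<in> Delta m n" and f: "f \<in> hom (level X n) x y" and g: "g \<in> hom (level X n) y x"
    and i: "Comp (level X n) g f = Unit (level X n) x" "Comp (level X n) f g = Unit (level X n) y"
  shows "Comp (level X m) (Q m n p g) (Q m n p f) = Unit (level X m) (P m n p x)"
    "Comp (level X m) (Q m n p f) (Q m n p g) = Unit (level X m) (P m n p y)"
  using Q_comp[OF p f g] Q_comp[OF p g f] i Q_unit[OF p] arr_ob[OF f] by auto

text \<open>In a groupoid a lift with given source is the inverse of a lift with given target;
  uniqueness is carried over by uniqueness of inverses.\<close>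

lemma lift_src:
  assumes e: "e \<in> Ob (Suc n)" and f: "f \<in> Ar 1" and s: "Src (level X 1) f = P 1 (Suc n) (long (Suc n)) e"
  shows "\<exists>!g. g \<in> Ar (Suc n) \<and> Src (level X (Suc n)) g = e \<and> Q 1 (Suc n) (long (Suc n)) g = f"
proof -
  let ?Q = "Q 1 (Suc n) (long (Suc n))" and ?P = "P 1 (Suc n) (long (Suc n))"
  let ?y = "Tgt (level X 1) f"
  have fh: "f \<in> hom (level X 1) (?P e) ?y" using f s by (simp add: hom_def)
  obtain f' where f': "f' \<in> hom (level X 1) ?y (?P e)" "Comp (level X 1) f' f = Unit (level X 1) (?P e)"
    "Comp (level X 1) f f' = Unit (level X 1) ?y" by (rule arr_inv[OF fh])
  have ex: "\<exists>!g. g \<in> Ar (Suc n) \<and> Tgt (level X (Suc n)) g = e \<and> ?Q g = f'"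
    by (rule lift_tgt[OF e]) (use f' in \<open>auto simp: hom_def\<close>)
  then obtain g' where g': "g' \<in> Ar (Suc n)" "Tgt (level X (Suc n)) g' = e" "?Q g' = f'" by blast
  let ?x = "Src (level X (Suc n)) g'"
  have g'h: "g' \<in> hom (level X (Suc n)) ?x e" using g' by (simp add: hom_def)
  have x: "?P ?x = ?y" using Q_src[OF long_in(1) g'(1)] g'(3) f'(1) by (simp add: hom_def)
  obtain g where g: "g \<in> hom (level X (Suc n)) e ?x" "Comp (level X (Suc n)) g g' = Unit (level X (Suc n)) ?x"
    "Comp (level X (Suc n)) g' g = Unit (level X (Suc n)) e" by (rule arr_inv[OF g'h])
  have "?Q g = f"
    by (rule inv_unique[OF cat f'(1) fh f'(3) Q_hom[OF long_in(1) g(1), unfolded x]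
        Q_inv(1)[OF long_in(1) g(1) g'h g(3,2), unfolded g'(3)], symmetric])
  moreover have "h = g" if h: "h \<in> Ar (Suc n)" "Src (level X (Suc n)) h = e" "?Q h = f" for h
  proof -
    let ?z = "Tgt (level X (Suc n)) h"
    have hh: "h \<in> hom (level X (Suc n)) e ?z" using h by (simp add: hom_def)
    have z: "?P ?z = ?y" using Q_tgt[OF long_in(1) h(1)] h(3) by simp
    obtain h' where h': "h' \<in> hom (level X (Suc n)) ?z e" "Comp (level X (Suc n)) h' h = Unit (level X (Suc n)) e"
      "Comp (level X (Suc n)) h h' = Unit (level X (Suc n)) ?z" by (rule arr_inv[OF hh])
    have "?Q h' = f'"
      by (rule inv_unique[OF cat fh f'(1,2) Q_hom[OF long_in(1) h'(1), unfolded z]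
          Q_inv(2)[OF long_in(1) hh h'(1) h'(2,3), unfolded h(3) z], symmetric])
    then have eq: "h' = g'" using ex g' homD[OF h'(1)] by blast
    have zx: "?z = ?x" using homD[OF h'(1)] eq by simp
    show "h = g" by (rule inv_unique[OF cat g'h hh[unfolded zx] h'(3)[unfolded eq zx] g(1,3)])
  qed
  ultimately show ?thesis using g(1) by (auto simp: hom_def intro!: ex1I[of _ g])
qed

end

subsection \<open>Uniqueness of strict culf maps\<close>

context choice
begin

lemma U_arr_map: "((A, a), (B, b), F) \<in> U_arr n \<Longrightarrow> simplicial_map A B F"
  by (auto simp: U_arr_iff isoD)

text \<open>Exposes the two equations that characterise the coherence isomorphism: on the
  subdivision, and over the interval \<open>A\<close>.\<close>

lemma coh_cases:
  assumes q: "q \<in> Delta l m" and p: "p \<in> Delta m n" and x: "(A, a) \<in> U_obj n"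
    and 1: "ch m n p (A, a) = ((A1, a1), c1)" and 2: "ch l m q (A1, a1) = ((A2, a2), c2)"
    and 3: "ch l n (compose {..l} p q) (A, a) = ((D, d), c3)"
  obtains K where "U_coh ch l m n q p (A, a) = ((A2, a2), (D, d), K)" "simplicial_map A2 D K"
    "\<And>k r. r \<in> Delta k l \<Longrightarrow> K k (a2 k r) = d k r" "\<And>k t. t \<in> simps A2 k \<Longrightarrow> c3 k (K k t) = c1 k (c2 k t)"
proof -
  from ch_cases[OF p x] 1 have A1: "(A1, a1) \<in> U_obj m" "strict_culf A1 A c1"
    "\<And>k r. r \<in> Delta k m \<Longrightarrow> c1 k (a1 k r) = a k (compose {..k} p r)"
    by (metis prod.inject)+
  from ch_cases[OF q A1(1)] 2 have A2: "(A2, a2) \<in> U_obj l" "strict_culf A2 A1 c2"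
    "\<And>k r. r \<in> Delta k l \<Longrightarrow> c2 k (a2 k r) = a1 k (compose {..k} q r)"
    by (metis prod.inject)+
  from ch_cases[OF Delta_comp[OF q p] x] 3 have D: "(D, d) \<in> U_obj l" "strict_culf D A c3"
    "\<And>k r. r \<in> Delta k l \<Longrightarrow> c3 k (d k r) = a k (compose {..k} (compose {..l} p q) r)"
    by (metis prod.inject)+
  note u = map_comp[OF culf_map[OF A2(2)] culf_map[OF A1(2)] U_objD(2)[OF A2(1)]]
  have eq: "simp_comp (std_simplex l) c3 d = simp_comp (std_simplex l) (simp_comp A2 c1 c2) a2"
    by (rule map_eqI[OF map_comp[OF U_objD(3)[OF D(1)] culf_map[OF D(2)] std_simplicial_set] map_comp[OF U_objD(3)[OF A2(1)] u std_simplicial_set]])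
      (simp add: simp_comp_apply std_in[OF A2(1)] A1(3) A2(3) D(3) Delta_comp[OF _ q] Delta_assoc)
  note K = filler_spec[OF A2(1) D(1,2) u eq]
  let ?K = "filler l (A2, a2) (D, d) (simp_comp A2 c1 c2) c3"
  have "U_coh ch l m n q p (A, a) = ((A2, a2), (D, d), ?K)"
    by (simp add: U_coh_def 1 2 3 Let_def)
  moreover have "?K k (a2 k r) = d k r" if "r \<in> Delta k l" for k r
    using fun_cong[OF fun_cong[OF K(2), of k], of r] that by (simp add: simp_comp_apply)
  moreover have "c3 k (?K k t) = c1 k (c2 k t)" if "t \<in> simps A2 k" for k t
    using fun_cong[OF fun_cong[OF K(3), of k], of t] that by (simp add: simp_comp_apply)
  ultimately show ?thesis using K(1) that by blast
qed

end

section \<open>Strict culf maps in components\<close>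

locale rigid_choice = rigid X + choice ch for X :: "('o, 'a) simplicial" and ch :: "'u choice"
begin

abbreviation "U \<equiv> U_groupoid ch"
abbreviation "scm J \<equiv> strict_culf_map X U J"
abbreviation "jo J n x \<equiv> ob_map (cmpt J n) x"
definition IA :: "('o, 'a, 'u subdiv, 'u subdiv_arr) pseudonat \<Rightarrow> nat \<Rightarrow> 'o \<Rightarrow> 'u interval" where
  "IA J n x = fst (jo J n x)"
definition ia :: "('o, 'a, 'u subdiv, 'u subdiv_arr) pseudonat \<Rightarrow> nat \<Rightarrow> 'o \<Rightarrow> nat \<Rightarrow> (nat \<Rightarrow> nat) \<Rightarrow> 'u" where
  "ia J n x = snd (jo J n x)"
definition jf :: "('o, 'a, 'u subdiv, 'u subdiv_arr) pseudonat \<Rightarrow> nat \<Rightarrow> 'a \<Rightarrow> 'u smap" where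
  "jf J n f = snd (snd (arr_map (cmpt J n) f))"
definition S :: "('o, 'a, 'u subdiv, 'u subdiv_arr) pseudonat \<Rightarrow> nat \<Rightarrow> nat \<Rightarrow> (nat \<Rightarrow> nat) \<Rightarrow> 'o \<Rightarrow> 'u smap" where
  "S J m n p x = snd (snd (struct_iso J m n p x))"

lemma jo_eq [simp]: "jo J n x = (IA J n x, ia J n x)"
  by (simp add: IA_def ia_def)

lemma pn: "scm J \<Longrightarrow> pseudonatural X U J" by (simp add: strict_culf_map_def)

lemma J_functor: "scm J \<Longrightarrow> is_functor (level X n) (U_level n) (cmpt J n)"
  using pn[of J] by (simp add: pseudonatural_def)

lemma J_ob:
  assumes "scm J" "x \<in> Ob n"
  shows "(IA J n x, ia J n x) \<in> U_obj n"
proof -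
  have "ob_map (cmpt J n) \<in> Ob n \<rightarrow>\<^sub>E U_obj n"
    using J_functor[OF assms(1), of n] unfolding is_functor_def U_level_sel by (rule conjunct1)
  from PiE_mem[OF this assms(2)] show ?thesis by (simp only: jo_eq)
qed

lemma J_ar:
  assumes "scm J" "f \<in> hom (level X n) x y"
  shows "arr_map (cmpt J n) f = ((IA J n x, ia J n x), (IA J n y, ia J n y), jf J n f)"
   "((IA J n x, ia J n x), (IA J n y, ia J n y), jf J n f) \<in> U_arr n"
proof -
  have F: "arr_map (cmpt J n) f \<in> U_arr n" "Src (U_level n) (arr_map (cmpt J n) f) = jo J n x"
    "Tgt (U_level n) (arr_map (cmpt J n) f) = jo J n y"
    using J_functor[OF assms(1), of n] assms(2) unfolding is_functor_def hom_def by auto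
  then show 1: "arr_map (cmpt J n) f = ((IA J n x, ia J n x), (IA J n y, ia J n y), jf J n f)"
    by (cases "arr_map (cmpt J n) f") (simp add: jf_def)
  show "((IA J n x, ia J n x), (IA J n y, ia J n y), jf J n f) \<in> U_arr n"
    using F(1) 1 by simp
qed

lemma struct_hom:
  assumes J: "scm J" and p: "p \<in> Delta m n" and x: "x \<in> Ob n"
  shows "struct_iso J m n p x \<in> hom (U_level m) (fst (ch m n p (IA J n x, ia J n x))) (jo J m (P m n p x))"
proof -
  have "struct_iso J m n p x \<in> hom (U_level m) (ob_map (U_pull ch m n p) (jo J n x)) (jo J m (P m n p x))"
    using pn[OF J] p x unfolding pseudonatural_def U_groupoid_sel by (elim conjE) blast
  then show ?thesis using J_ob[OF J x] by (simp add: pull_ob)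
qed

lemma struct_natural:
  assumes J: "scm J" and p: "p \<in> Delta m n" and f: "f \<in> hom (level X n) x y"
  shows "Comp (U_level m) (struct_iso J m n p y) (arr_map (U_pull ch m n p) (arr_map (cmpt J n) f)) =
     Comp (U_level m) (arr_map (cmpt J m) (Q m n p f)) (struct_iso J m n p x)"
proof -
  have "\<forall>f\<in>Ar n. Comp (U_level m) (struct_iso J m n p (Tgt (level X n) f)) (arr_map (U_pull ch m n p) (arr_map (cmpt J n) f)) =
     Comp (U_level m) (arr_map (cmpt J m) (Q m n p f)) (struct_iso J m n p (Src (level X n) f))"
    using pn[OF J] p unfolding pseudonatural_def U_groupoid_sel by (elim conjE) blast
  then show ?thesis using f by (auto simp: hom_def)
qed

lemma struct_coh:
  assumes J: "scm J" and q: "q \<in> Delta l m" and p: "p \<in> Delta m n" and x: "x \<in> Ob n"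
  shows "Comp (U_level l) (struct_iso J l m q (P m n p x)) (arr_map (U_pull ch l m q) (struct_iso J m n p x)) =
     Comp (U_level l) (struct_iso J l n (compose {..l} p q) x) (U_coh ch l m n q p (jo J n x))"
  using pn[OF J] p q x unfolding pseudonatural_def U_groupoid_sel by (elim conjE) blast

lemma struct_eq:
  assumes "scm J" "p \<in> Delta m n" "x \<in> Ob n"
  shows "struct_iso J m n p x = (fst (ch m n p (IA J n x, ia J n x)), (IA J m (P m n p x), ia J m (P m n p x)), S J m n p x)"
    "(fst (ch m n p (IA J n x, ia J n x)), (IA J m (P m n p x), ia J m (P m n p x)), S J m n p x) \<in> U_arr m"
  using struct_hom[OF assms] by (auto simp: U_hom S_def)

lemma struct_active:
  assumes "scm J" "active m n p" "x \<in> Ob n"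
  shows "struct_iso J m n p x = Unit (U_level m) (ob_map (U_pull ch m n p) (jo J n x))"
  using assms by (simp add: strict_culf_map_def)

text \<open>The structure isomorphism along an active map is an identity, so its source and target
  coincide. In particular the interval assigned to \<open>x\<close> depends only on the long edge of
  \<open>x\<close>.\<close>

lemma J_active:
  assumes J: "scm J" and p: "active m n p" and x: "x \<in> Ob n"
  shows "IA J m (P m n p x) = IA J n x" "ia J m (P m n p x) = res m n p (ia J n x)"
proof -
  have "struct_iso J m n p x = ((IA J n x, res m n p (ia J n x)), (IA J n x, res m n p (ia J n x)), simp_id (IA J n x))"
    using struct_active[OF assms] pull_ob_active[OF p J_ob[OF J x]] by simp
  with struct_eq(1)[OF J active_in[OF p] x]
  show "IA J m (P m n p x) = IA J n x" "ia J m (P m n p x) = res m n p (ia J n x)" by auto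
qed

lemma J_active_apply: 
  assumes "scm J" "active m n p" "x \<in> Ob n" "q \<in> Delta k m"
  shows "ia J m (P m n p x) k q = ia J n x k (compose {..k} p q)"
  using J_active(2)[OF assms(1-3)] res_apply[OF assms(4)] by simp

text \<open>With identities as structure isomorphisms naturality is strict, so the isomorphism
  assigned to an arrow depends only on the long edge of that arrow.\<close>

lemma jf_active:
  assumes J: "scm J" and p: "active m n p" and f: "f \<in> hom (level X n) x y"
  shows "jf J m (Q m n p f) = jf J n f"
proof -
  note pD = active_in[OF p]
  have x: "x \<in> Ob n" and y: "y \<in> Ob n" using arr_ob[OF f] by auto
  have fa: "f \<in> Ar n" "Src (level X n) f = x" "Tgt (level X n) f = y" using f by (auto simp: hom_def)
  have n: "Comp (U_level m) (struct_iso J m n p y) (arr_map (U_pull ch m n p) (arr_map (cmpt J n) f)) =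
     Comp (U_level m) (arr_map (cmpt J m) (Q m n p f)) (struct_iso J m n p x)"
    by (rule struct_natural[OF J pD f])
  note A = J_ar[OF J f] and B = J_ar[OF J Q_hom[OF pD f]]
  have FA: "simplicial_map (IA J n x) (IA J n y) (jf J n f)" using A(2) U_arr_map by blast
  have FB: "simplicial_map (IA J n x) (IA J n y) (jf J m (Q m n p f))" 
    using U_arr_map[OF B(2)] J_active(1)[OF J p] x y by simp
  show ?thesis using n
    unfolding struct_active[OF J p x] struct_active[OF J p y] A(1) pull_arr_active[OF p A(2)] B(1)
    using pull_ob_active[OF p J_ob[OF J x]] pull_ob_active[OF p J_ob[OF J y]] FA FB
    by (simp add: J_active[OF J p x] J_active[OF J p y] simp_id_comp comp_simp_id)
qed

section \<open>Simplices of the intervals as simplices of \<open>X\<close>\<close>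

lemma J_pullback_ob:
  assumes J: "scm J" and p: "active m n p" and x: "x \<in> Ob m" and b: "(A, b) \<in> U_obj n"
    and eq: "(IA J m x, ia J m x) = (A, res m n p b)"
  shows "\<exists>!y. y \<in> Ob n \<and> P m n p y = x \<and> (IA J n y, ia J n y) = (A, b)"
proof -
  have "strict_pullback (level X n) (level X m) (U_level n) (pull X m n p) (cmpt J n) (cmpt J m) (U_pull ch m n p)"
    using J p by (simp add: strict_culf_map_def)
  then have sp: "set_pullback (Ob n) (Ob m) (U_obj n) (P m n p) (jo J n) (jo J m) (ob_map (U_pull ch m n p))"
    unfolding strict_pullback_def U_level_sel by (rule conjunct1)
  show ?thesis using set_pullback_ex1[OF sp x b] eq by (simp add: pull_ob_active[OF p b])
qed

lemma long_long: "active m n p \<Longrightarrow> x \<in> Ob n \<Longrightarrow> P 1 m (long m) (P m n p x) = P 1 n (long n) x"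
  by (simp only: P_P[OF long_in(1) active_in] active_long(1))

lemma IA_long:
  assumes J: "scm J" and x: "x \<in> Ob n" and y: "y \<in> Ob m" and eq: "P 1 m (long m) y = P 1 n (long n) x"
  shows "IA J m y = IA J n x"
  using J_active(1)[OF J long_active(1) x] J_active(1)[OF J long_active(1) y] eq by simp

text \<open>Existence applies the strict pullback for \<open>[1] \<rightarrow> [k + 2]\<close> to
  the subdivision given by the hull of \<open>s\<close>. Uniqueness holds because inner part and
  long edge determine a hull.\<close>

lemma rep_ex1:
  assumes J: "scm J" and x: "x \<in> Ob n" and s: "s \<in> simps (IA J n x) k"
  shows "\<exists>!y. y \<in> Ob (Suc (Suc k)) \<and> P 1 (Suc (Suc k)) (long (Suc (Suc k))) y = P 1 n (long n) x \<and>
     ia J (Suc (Suc k)) y k (up k) = s"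
proof -
  note o = J_ob[OF J x]
  let ?A = "IA J n x" and ?k = "Suc (Suc k)"
  note h = hullD[OF o s]
  let ?b = "yon ?A ?k (hull ?A k s)"
  have b: "(?A, ?b) \<in> U_obj ?k" by (rule yon_obj[OF U_objD(1)[OF o] h(1,4,5)])
  let ?f = "P 1 n (long n) x"
  have f: "?f \<in> Ob 1" by (rule P_in[OF long_in(1) x])
  have fA: "IA J 1 ?f = ?A" by (rule J_active(1)[OF J long_active(1) x])
  have fo: "(?A, ia J 1 ?f) \<in> U_obj 1" using J_ob[OF J f] fA by simp
  \<comment> \<open>Both are subdivisions of \<open>?A\<close> by \<open>[1]\<close>; they agree
    because the edge from the initial to the terminal object is unique.\<close>
  have eq: "(IA J 1 ?f, ia J 1 ?f) = (?A, res 1 ?k (long ?k) ?b)"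
  proof -
    have ro: "(?A, res 1 ?k (long ?k) ?b) \<in> U_obj 1" by (rule res_obj[OF long_active(1) b])
    have "ia J 1 ?f = res 1 ?k (long ?k) ?b"
      by (rule std_map_eqI[OF U_objD(3)[OF fo] U_objD(3)[OF ro]])
        (use std_long[OF fo ro] in \<open>simp add: long_1\<close>)
    then show ?thesis using fA by simp
  qed
  have bu: "?b k (up k) = s" using h(2) by (simp add: yon_apply)
  from J_pullback_ob[OF J long_active(1) f b eq] obtain y where y: "y \<in> Ob ?k" "P 1 ?k (long ?k) y = ?f" "(IA J ?k y, ia J ?k y) = (?A, ?b)"
    and yu: "\<And>z. z \<in> Ob ?k \<Longrightarrow> P 1 ?k (long ?k) z = ?f \<Longrightarrow> (IA J ?k z, ia J ?k z) = (?A, ?b) \<Longrightarrow> z = y" by blast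
  show ?thesis
  proof (rule ex1I[of _ y])
    show "y \<in> Ob ?k \<and> P 1 ?k (long ?k) y = ?f \<and> ia J ?k y k (up k) = s" using y bu by simp
    fix z assume z: "z \<in> Ob ?k \<and> P 1 ?k (long ?k) z = ?f \<and> ia J ?k z k (up k) = s"
    have zA: "IA J ?k z = ?A" by (rule IA_long[OF J x]) (use z in auto)
    have zo: "(?A, ia J ?k z) \<in> U_obj ?k" using J_ob[OF J, of z ?k] z zA by simp
    \<comment> \<open>The top simplex of a competing subdivision \<open>ia J ?k z\<close> has inner
      part \<open>s\<close> and the same long edge, so it is the hull of \<open>s\<close>.\<close>
    have "hull ?A k s = ia J ?k z ?k (delta_id ?k)"
      by (rule hull_unique[OF o s std_in[OF zo]])
        (use z in \<open>auto simp: obj_act[OF zo] comp_id_left std_long[OF zo o, simplified]\<close>)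
    then have "ia J ?k z = ?b"
      by (intro std_map_eqI[OF U_objD(3)[OF zo] U_objD(3)[OF b]])
       (simp add: yon_apply act_id[OF U_objD(2)[OF o]] std_in[OF zo])
    then have "(IA J ?k z, ia J ?k z) = (?A, ?b)" using zA by simp
    then show "z = y" using yu z by blast
  qed
qed

definition rep :: "('o, 'a, 'u subdiv, 'u subdiv_arr) pseudonat \<Rightarrow> nat \<Rightarrow> 'o \<Rightarrow> nat \<Rightarrow> 'u \<Rightarrow> 'o" where
  "rep J n x k s = (THE y. y \<in> Ob (Suc (Suc k)) \<and> P 1 (Suc (Suc k)) (long (Suc (Suc k))) y = P 1 n (long n) x \<and>
     ia J (Suc (Suc k)) y k (up k) = s)"

lemma rep:
  assumes "scm J" "x \<in> Ob n" "s \<in> simps (IA J n x) k"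
  shows "rep J n x k s \<in> Ob (Suc (Suc k))" "P 1 (Suc (Suc k)) (long (Suc (Suc k))) (rep J n x k s) = P 1 n (long n) x"
     "ia J (Suc (Suc k)) (rep J n x k s) k (up k) = s"
  using theI'[OF rep_ex1[OF assms]] unfolding rep_def by auto

lemma rep_eq:
  assumes "scm J" "x \<in> Ob n" "y \<in> Ob (Suc (Suc k))" "P 1 (Suc (Suc k)) (long (Suc (Suc k))) y = P 1 n (long n) x"
  shows "ia J (Suc (Suc k)) y k (up k) \<in> simps (IA J n x) k" "rep J n x k (ia J (Suc (Suc k)) y k (up k)) = y"
proof -
  have "IA J (Suc (Suc k)) y = IA J n x" by (rule IA_long[OF assms])
  then show *: "ia J (Suc (Suc k)) y k (up k) \<in> simps (IA J n x) k"
    using std_in[OF J_ob[OF assms(1,3)], of "up k" k] by simp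
  show "rep J n x k (ia J (Suc (Suc k)) y k (up k)) = y"
    unfolding rep_def by (rule the1_equality[OF rep_ex1[OF assms(1,2) *]]) (use assms in simp)
qed

text \<open>\<open>s\<close> is replaced by the \<open>(k + 2)\<close>-simplex of \<open>X\<close>
  that represents it under \<open>J\<close>, and this simplex is then read under
  \<open>J'\<close>.\<close>

definition tr :: "('o, 'a, 'u subdiv, 'u subdiv_arr) pseudonat \<Rightarrow> ('o, 'a, 'u subdiv, 'u subdiv_arr) pseudonat \<Rightarrow> nat \<Rightarrow> 'o \<Rightarrow> 'u smap" where
  "tr J J' n x = (\<lambda>k. \<lambda>s\<in>simps (IA J n x) k. ia J' (Suc (Suc k)) (rep J n x k s) k (up k))"

lemma tr_apply:
  assumes "scm J" "x \<in> Ob n" "y \<in> Ob (Suc (Suc k))" "P 1 (Suc (Suc k)) (long (Suc (Suc k))) y = P 1 n (long n) x"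
  shows "tr J J' n x k (ia J (Suc (Suc k)) y k (up k)) = ia J' (Suc (Suc k)) y k (up k)"
  using rep_eq[OF assms] by (simp add: tr_def)

text \<open>The representative of a face or degeneracy is obtained from that of \<open>s\<close> by
  pulling back along \<open>hat\<close>, an operation in \<open>X\<close> that involves neither
  \<open>J\<close> nor \<open>J'\<close>.\<close>

lemma tr_map:
  assumes J: "scm J" and J': "scm J'" and x: "x \<in> Ob n"
  shows "simplicial_map (IA J n x) (IA J' n x) (tr J J' n x)"
  unfolding simplicial_map_def
proof (intro conjI allI ballI)
  fix k
  show "tr J J' n x k \<in> simps (IA J n x) k \<rightarrow>\<^sub>E simps (IA J' n x) k"
  proof
    fix s assume s: "s \<in> simps (IA J n x) k"
    show "tr J J' n x k s \<in> simps (IA J' n x) k"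
      using rep[OF J x s] rep_eq(1)[OF J' x] s by (simp add: tr_def)
  qed (simp add: tr_def)
next
  fix j k q s assume q: "q \<in> Delta j k" and s: "s \<in> simps (IA J n x) k"
  define y where "y = rep J n x k s"
  note y = rep[OF J x s, folded y_def]
  let ?y = "P (Suc (Suc j)) (Suc (Suc k)) (hat j k q) y"
  have y': "?y \<in> Ob (Suc (Suc j))" "P 1 (Suc (Suc j)) (long (Suc (Suc j))) ?y = P 1 n (long n) x"
    using P_in[OF hat_in[OF q] y(1)] long_long[OF hat_active[OF q] y(1)] y(2) by simp_all
  have key: "ia K (Suc (Suc j)) ?y j (up j) = act (IA K n x) j k q (ia K (Suc (Suc k)) y k (up k))" if K: "scm K" for K
  proof -
    have "ia K (Suc (Suc j)) ?y j (up j) = ia K (Suc (Suc k)) y j (compose {..j} (up k) q)"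
      using J_active_apply[OF K hat_active[OF q] y(1) up_in] by (simp add: hat_up[OF q])
    also have "\<dots> = act (IA K n x) j k q (ia K (Suc (Suc k)) y k (up k))"
      using obj_act[OF J_ob[OF K y(1)] up_in q] IA_long[OF K x y(1,2)] by simp
    finally show ?thesis .
  qed
  have "act (IA J n x) j k q s = ia J (Suc (Suc j)) ?y j (up j)" using key[OF J] y(3) by simp
  then have "tr J J' n x j (act (IA J n x) j k q s) = ia J' (Suc (Suc j)) ?y j (up j)"
    using tr_apply[OF J x y'] by simp
  also have "\<dots> = act (IA J' n x) j k q (tr J J' n x k s)"
    using key[OF J'] tr_apply[OF J x y(1,2)] y(3) by simp
  finally show "tr J J' n x j (act (IA J n x) j k q s) = act (IA J' n x) j k q (tr J J' n x k s)" .
qed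

lemma tr_comp_apply:
  assumes J: "scm J" and J': "scm J'" and x: "x \<in> Ob n" and s: "s \<in> simps (IA J n x) k"
  shows "tr J' J'' n x k (tr J J' n x k s) = tr J J'' n x k s"
  using tr_apply[OF J x rep(1,2)[OF J x s]] tr_apply[OF J' x rep(1,2)[OF J x s]] rep(3)[OF J x s] by simp

lemma tr_self:
  assumes J: "scm J" and x: "x \<in> Ob n"
  shows "tr J J n x = simp_id (IA J n x)"
  by (rule map_eqI[OF tr_map[OF J J x] map_id[OF U_objD(2)[OF J_ob[OF J x]]]])
   (simp add: simp_id_apply, simp add: tr_def rep(3)[OF J x])

lemma tr_comp:
  assumes J: "scm J" and J': "scm J'" and J'': "scm J''" and x: "x \<in> Ob n"
  shows "simp_comp (IA J n x) (tr J' J'' n x) (tr J J' n x) = tr J J'' n x"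
  by (rule map_eqI[OF map_comp[OF tr_map[OF J J' x] tr_map[OF J' J'' x] U_objD(2)[OF J_ob[OF J x]]] tr_map[OF J J'' x]])
   (simp add: simp_comp_apply tr_comp_apply[OF J J' x])

text \<open>The simplex \<open>q\<close> of the subdivision is represented by the pullback of
  \<open>x\<close> along \<open>q\<close> with the ends added, whichever strict culf map is
  used.\<close>

lemma tr_std:
  assumes J: "scm J" and x: "x \<in> Ob n" and q: "q \<in> Delta k n" and J': "scm J'"
  shows "tr J J' n x k (ia J n x k q) = ia J' n x k q"
proof -
  let ?p = "compose {..Suc (Suc k)} (kap n) (hat k n q)"
  have p: "active (Suc (Suc k)) n ?p" by (rule active_comp[OF hat_active[OF q] kap_active])
  let ?y = "P (Suc (Suc k)) n ?p x"
  have "ia K n x k q = ia K (Suc (Suc k)) ?y k (up k)" if "scm K" for K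
    using J_active_apply[OF that p x up_in] kap_hat_up_gen[OF q] by simp
  then show ?thesis using tr_apply[OF J x P_in[OF active_in[OF p] x] long_long[OF p x]] J J' by simp
qed

lemma tr_iso:
  assumes J: "scm J" and J': "scm J'" and x: "x \<in> Ob n"
  shows "simplicial_iso (IA J n x) (IA J' n x) (tr J J' n x)"
  by (rule isoI[OF tr_map[OF J J' x] tr_map[OF J' J x]]) (simp_all add: tr_comp J J' x tr_self)

lemma tr_arr:
  assumes J: "scm J" and J': "scm J'" and x: "x \<in> Ob n"
  shows "((IA J n x, ia J n x), (IA J' n x, ia J' n x), tr J J' n x) \<in> U_arr n"
  by (rule U_arrI[OF J_ob[OF J x] J_ob[OF J' x] tr_iso[OF assms] tr_std[OF J x _ J']])

section \<open>Culf maps induced by structure isomorphisms\<close>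

lemma S_inj:
  assumes "scm J" "p \<in> Delta m n" "x \<in> Ob n" "ch m n p (IA J n x, ia J n x) = ((A, a), c)"
  shows "((A, a), (IA J m (P m n p x), ia J m (P m n p x)), S J m n p x) \<in> U_arr m"
  using struct_eq(2)[OF assms(1-3)] assms(4) by simp

text \<open>The culf map from the interval of \<open>p\<^sup>* x\<close> to that of \<open>x\<close> given by the structure isomorphism.
  In contrast to the structure isomorphism it is independent of the chosen factorisations, and
  the coherence conditions say that it is functorial in \<open>p\<close>.\<close>

definition cj :: "('o, 'a, 'u subdiv, 'u subdiv_arr) pseudonat \<Rightarrow> nat \<Rightarrow> nat \<Rightarrow> (nat \<Rightarrow> nat) \<Rightarrow> 'o \<Rightarrow> nat \<Rightarrow> 'u \<Rightarrow> 'u" where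
  "cj J m n p x k s = snd (ch m n p (IA J n x, ia J n x)) k 
    (THE t. t \<in> simps (fst (fst (ch m n p (IA J n x, ia J n x)))) k \<and> S J m n p x k t = s)"

lemma S_bij:
  assumes "scm J" "p \<in> Delta m n" "x \<in> Ob n" "ch m n p (IA J n x, ia J n x) = ((A, a), c)" "s \<in> simps (IA J m (P m n p x)) k"
  shows "\<exists>!t. t \<in> simps A k \<and> S J m n p x k t = s"
proof -
  obtain G where G: "((IA J m (P m n p x), ia J m (P m n p x)), (A, a), G) \<in> U_arr m"
    "\<And>k t. t \<in> simps A k \<Longrightarrow> G k (S J m n p x k t) = t" "\<And>k s. s \<in> simps (IA J m (P m n p x)) k \<Longrightarrow> S J m n p x k (G k s) = s"
    by (rule U_arr_inverse[OF S_inj[OF assms(1-4)]]) blast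
  have "G k s \<in> simps A k" using map_in[OF U_arr_map assms(5)] G(1) by blast
  then show ?thesis using G(2,3) assms(5) by metis
qed

lemma cj_S:
  assumes J: "scm J" and p: "p \<in> Delta m n" and x: "x \<in> Ob n" and c: "ch m n p (IA J n x, ia J n x) = ((A, a), c)" and t: "t \<in> simps A k"
  shows "cj J m n p x k (S J m n p x k t) = c k t"
proof -
  have "S J m n p x k t \<in> simps (IA J m (P m n p x)) k"
    using map_in[OF U_arr_map t] S_inj[OF J p x c] by blast
  from S_bij[OF J p x c this] show ?thesis unfolding cj_def c using t by (auto intro!: arg_cong[where f="c k"] the1_equality)
qed

lemma cj_in:
  assumes J: "scm J" and p: "p \<in> Delta m n" and x: "x \<in> Ob n" and s: "s \<in> simps (IA J m (P m n p x)) k"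
  shows "cj J m n p x k s \<in> simps (IA J n x) k"
proof -
  obtain A a c where c: "ch m n p (IA J n x, ia J n x) = ((A, a), c)" "strict_culf A (IA J n x) c"
    using ch_cases[OF p J_ob[OF J x]] by metis
  obtain t where t: "t \<in> simps A k" "S J m n p x k t = s"
    using S_bij[OF J p x c(1) s] by blast
  show ?thesis using cj_S[OF J p x c(1) t(1)] t map_in[OF culf_map[OF c(2)] t(1)] by simp
qed

lemma cj_std:
  assumes J: "scm J" and p: "p \<in> Delta m n" and x: "x \<in> Ob n" and q: "q \<in> Delta k m"
  shows "cj J m n p x k (ia J m (P m n p x) k q) = ia J n x k (compose {..k} p q)"
proof -
  obtain A a c where c: "ch m n p (IA J n x, ia J n x) = ((A, a), c)" "(A, a) \<in> U_obj m"
    "\<And>k q. q \<in> Delta k m \<Longrightarrow> c k (a k q) = ia J n x k (compose {..k} p q)"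
    using ch_cases[OF p J_ob[OF J x]] by metis
  show ?thesis using cj_S[OF J p x c(1) std_in[OF c(2) q]] U_arr_apply[OF S_inj[OF J p x c(1)] q] c(3)[OF q] by simp
qed

lemma cj_active:
  assumes J: "scm J" and p: "active m n p" and x: "x \<in> Ob n" and s: "s \<in> simps (IA J n x) k"
  shows "cj J m n p x k s = s"
proof -
  have c: "ch m n p (IA J n x, ia J n x) = ((IA J n x, res m n p (ia J n x)), simp_id (IA J n x))"
    using ch_active[OF p J_ob[OF J x]] by simp
  have "S J m n p x = simp_id (IA J n x)"
    using struct_active[OF J p x] pull_ob_active[OF p J_ob[OF J x]] by (simp add: S_def)
  then show ?thesis using cj_S[OF J active_in[OF p] x c s] s by (simp add: simp_id_apply)
qed

text \<open>The element \<open>s\<close> is carried back through the isomorphisms to the iterated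
  factorisation \<open>A2\<close>. There the coherence axiom compares \<open>G\<close> with
  \<open>K\<close>, and both sides become \<open>c1\<close> after \<open>c2\<close>.\<close>

lemma cj_comp:
  assumes J: "scm J" and q: "q \<in> Delta l m" and p: "p \<in> Delta m n" and x: "x \<in> Ob n"
    and s: "s \<in> simps (IA J l (P l n (compose {..l} p q) x)) k"
  shows "cj J l n (compose {..l} p q) x k s = cj J m n p x k (cj J l m q (P m n p x) k s)"
proof -
  let ?x = "P m n p x" and ?r = "compose {..l} p q"
  note r = Delta_comp[OF q p]
  have x': "?x \<in> Ob m" by (rule P_in[OF p x])
  have PP: "P l m q ?x = P l n ?r x" by (rule P_P[OF q p x])
  note o = J_ob[OF J x] and o' = J_ob[OF J x']
  obtain A1 a1 c1 where c1: "ch m n p (IA J n x, ia J n x) = ((A1, a1), c1)" "(A1, a1) \<in> U_obj m"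
    using ch_cases[OF p o] by metis
  obtain A2 a2 c2 where c2: "ch l m q (A1, a1) = ((A2, a2), c2)" "(A2, a2) \<in> U_obj l" "strict_culf A2 A1 c2"
    using ch_cases[OF q c1(2)] by metis
  obtain A3 a3 c3 where c3: "ch l m q (IA J m ?x, ia J m ?x) = ((A3, a3), c3)" "(A3, a3) \<in> U_obj l"
    using ch_cases[OF q o'] by metis
  obtain A4 a4 c4 where c4: "ch l n ?r (IA J n x, ia J n x) = ((A4, a4), c4)" "(A4, a4) \<in> U_obj l"
    using ch_cases[OF r o] by metis
  note c1' = c1(1) and c3' = c3(1) and c4' = c4(1)
  note Sp = S_inj[OF J p x c1'] and Sq = S_inj[OF J q x' c3'] and Sr = S_inj[OF J r x c4']
  obtain G where G: "arr_map (U_pull ch l m q) ((A1, a1), (IA J m ?x, ia J m ?x), S J m n p x) = ((A2, a2), (A3, a3), G)"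
    "((A2, a2), (A3, a3), G) \<in> U_arr l" "\<And>k t. t \<in> simps A2 k \<Longrightarrow> c3 k (G k t) = S J m n p x k (c2 k t)"
    by (rule pull_arr[OF q Sp c2(1) c3(1)]) blast
  obtain K where K: "U_coh ch l m n q p (IA J n x, ia J n x) = ((A2, a2), (A4, a4), K)" "simplicial_map A2 A4 K"
    "\<And>k t. t \<in> simps A2 k \<Longrightarrow> c4 k (K k t) = c1 k (c2 k t)"
    by (rule coh_cases[OF q p o c1(1) c2(1) c4(1)]) blast
  have "Comp (U_level l) (struct_iso J l m q ?x) (arr_map (U_pull ch l m q) (struct_iso J m n p x)) =
     Comp (U_level l) (struct_iso J l n ?r x) (U_coh ch l m n q p (jo J n x))"
    by (rule struct_coh[OF J q p x])
  then have SG: "simp_comp A2 (S J l m q ?x) G = simp_comp A2 (S J l n ?r x) K"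
    unfolding struct_eq(1)[OF J q x'] struct_eq(1)[OF J p x] struct_eq(1)[OF J r x] c1' c3' c4'
    using K(1) G(1) c1' c3' c4' by simp
  have SGt: "S J l m q ?x k (G k t) = S J l n ?r x k (K k t)" if "t \<in> simps A2 k" for t
    using fun_cong[OF fun_cong[OF SG, of k], of t] that by (simp add: simp_comp_apply)
  obtain b where b: "b \<in> simps A3 k" "S J l m q ?x k b = s"
    using S_bij[OF J q x' c3', of s k] s PP by auto
  obtain G' where G': "((A3, a3), (A2, a2), G') \<in> U_arr l" "\<And>k t. t \<in> simps A3 k \<Longrightarrow> G k (G' k t) = t"
    by (rule U_arr_inverse[OF G(2)]) blast
  define t where "t = G' k b"
  have t: "t \<in> simps A2 k" "G k t = b"
    unfolding t_def by (rule map_in[OF U_arr_map[OF G'(1)] b(1)], rule G'(2)[OF b(1)])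
  have "cj J l m q ?x k s = c3 k b" using cj_S[OF J q x' c3' b(1)] b(2) by simp
  also have "\<dots> = S J m n p x k (c2 k t)" using G(3)[OF t(1)] t(2) by simp
  finally have "cj J m n p x k (cj J l m q ?x k s) = c1 k (c2 k t)"
    using cj_S[OF J p x c1' map_in[OF culf_map[OF c2(3)] t(1)]] by simp
  moreover have "cj J l n ?r x k s = c4 k (K k t)"
    using cj_S[OF J r x c4' map_in[OF K(2) t(1)]] SGt[OF t(1)] t(2) b(2) by simp
  ultimately show ?thesis using K(3)[OF t(1)] by simp
qed

text \<open>The decomposition pullback for the pushout of \<open>[1] \<rightarrow> [k]\<close> along
  the middle edge of \<open>[3]\<close>. The last right-hand side is the \<open>3\<close>-simplex
  \<open>(0, p 0, p m, n)\<close> of \<open>x\<close>; its middle edge is the long edge of the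
  pullback of \<open>x\<close> along \<open>p\<close>.\<close>

lemma insert_ex1:
  assumes p: "p \<in> Delta m n" and x: "x \<in> Ob n" and y: "y \<in> Ob k" "P 1 k (long k) y = P 1 m (long m) (P m n p x)"
  shows "\<exists>!Y. Y \<in> Ob (Suc (Suc k)) \<and> P k (Suc (Suc k)) (up k) Y = y \<and>
    P (Suc (Suc 1)) (Suc (Suc k)) (hat 1 k (long k)) Y =
      P (Suc (Suc 1)) n (compose {..Suc (Suc 1)} (kap n) (hat 1 n (compose {..1} p (long m)))) x"
proof (rule hat_ob_ex1[OF long_active(1) y(1)])
  have pl: "compose {..1} p (long m) \<in> Delta 1 n" by (rule Delta_comp[OF long_in(1) p])
  have w: "compose {..Suc (Suc 1)} (kap n) (hat 1 n (compose {..1} p (long m))) \<in> Delta (Suc (Suc 1)) n"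
    by (rule Delta_comp[OF hat_in[OF pl] kap_in])
  show "P (Suc (Suc 1)) n (compose {..Suc (Suc 1)} (kap n) (hat 1 n (compose {..1} p (long m)))) x \<in> Ob (Suc (Suc 1))"
    by (rule P_in[OF w x])
  show "P 1 k (long k) y = P 1 (Suc (Suc 1)) (up 1)
     (P (Suc (Suc 1)) n (compose {..Suc (Suc 1)} (kap n) (hat 1 n (compose {..1} p (long m)))) x)"
    unfolding P_P[OF up_in w x] kap_hat_up_gen[OF pl] y(2) P_P[OF long_in(1) p x] ..
qed

text \<open>Evaluates \<open>cj\<close> along a zigzag of maps: \<open>p\<close> after
  \<open>long m\<close> equals an active map after \<open>up 1\<close>, and \<open>Y\<close> lies
  over the same \<open>3\<close>-simplex as \<open>x\<close>. Along active maps \<open>cj\<close> is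
  the identity, so what remains is \<open>cj\<close> along an inclusion, at a simplex of the
  subdivision, where \<open>cj_std\<close> gives the value.\<close>

lemma cj_insert:
  assumes J: "scm J" and p: "p \<in> Delta m n" and x: "x \<in> Ob n" 
    and y: "y \<in> Ob (Suc (Suc k))" "P 1 (Suc (Suc k)) (long (Suc (Suc k))) y = P 1 m (long m) (P m n p x)"
    and Y: "Y \<in> Ob (Suc (Suc (Suc (Suc k))))" "P (Suc (Suc k)) (Suc (Suc (Suc (Suc k)))) (up (Suc (Suc k))) Y = y"
     "P (Suc (Suc 1)) (Suc (Suc (Suc (Suc k)))) (hat 1 (Suc (Suc k)) (long (Suc (Suc k)))) Y =
      P (Suc (Suc 1)) n (compose {..Suc (Suc 1)} (kap n) (hat 1 n (compose {..1} p (long m)))) x"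
  shows "cj J m n p x k (ia J (Suc (Suc k)) y k (up k)) =
     ia J (Suc (Suc (Suc (Suc k)))) Y k (compose {..k} (up (Suc (Suc k))) (up k))"
proof -
  let ?k = "Suc (Suc k)" and ?kk = "Suc (Suc (Suc (Suc k)))"
  let ?s = "ia J ?k y k (up k)"
  have pl: "compose {..1} p (long m) \<in> Delta 1 n" by (rule Delta_comp[OF long_in(1) p])
  let ?w = "compose {..Suc (Suc 1)} (kap n) (hat 1 n (compose {..1} p (long m)))"
  have wa: "active (Suc (Suc 1)) n ?w"
    by (rule active_comp[OF hat_active[OF pl] kap_active])
  note w = active_in[OF wa]
  have x': "P m n p x \<in> Ob m" by (rule P_in[OF p x])
  have f: "P 1 ?k (long ?k) y \<in> Ob 1" by (rule P_in[OF long_in(1) y(1)])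
  have s: "?s \<in> simps (IA J ?k y) k" using std_in[OF J_ob[OF J y(1)]] by simp
  have A: "IA J ?k y = IA J m (P m n p x)" by (rule IA_long[OF J x' y])
  have A1: "IA J 1 (P 1 ?k (long ?k) y) = IA J ?k y" by (rule J_active(1)[OF J long_active(1) y(1)])
  have A2: "IA J 1 (P 1 n (compose {..1} p (long m)) x) = IA J ?k y"
    using A1 unfolding y(2) P_P[OF long_in(1) p x] .
  have e1: "cj J 1 n (compose {..1} p (long m)) x k ?s = cj J m n p x k ?s"
    using cj_comp[OF J long_in(1) p x s[folded A2]] cj_active[OF J long_active(1) x' s[unfolded A]] by simp
  let ?W = "P (Suc (Suc 1)) n ?w x"
  have W: "?W \<in> Ob (Suc (Suc 1))" by (rule P_in[OF w x])
  have upW: "P 1 n (compose {..1} p (long m)) x = P 1 (Suc (Suc 1)) (up 1) ?W"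
    unfolding P_P[OF up_in w x] kap_hat_up_gen[OF pl] ..
  have sW: "cj J 1 (Suc (Suc 1)) (up 1) ?W k ?s \<in> simps (IA J (Suc (Suc 1)) ?W) k"
    by (rule cj_in[OF J up_in W s[folded A2, unfolded upW]])
  have e2: "cj J 1 n (compose {..1} p (long m)) x k ?s = cj J 1 (Suc (Suc 1)) (up 1) ?W k ?s"
  proof -
    have "cj J 1 n (compose {..1} ?w (up 1)) x k ?s = cj J (Suc (Suc 1)) n ?w x k (cj J 1 (Suc (Suc 1)) (up 1) ?W k ?s)"
      by (rule cj_comp[OF J up_in w x]) 
        (use s A2 in \<open>simp only: kap_hat_up_gen[OF pl]\<close>)
    also have "\<dots> = cj J 1 (Suc (Suc 1)) (up 1) ?W k ?s"
      by (rule cj_active[OF J wa x]) (use sW in \<open>simp only: J_active(1)[OF J wa x]\<close>)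
    finally show ?thesis by (simp only: kap_hat_up_gen[OF pl])
  qed
  let ?h = "hat 1 ?k (long ?k)"
  have ha: "active (Suc (Suc 1)) ?kk ?h" by (rule hat_active[OF long_in(1)])
  \<comment> \<open>The map from \<open>[1]\<close> to the inserted block of \<open>[k + 4]\<close>
    factors in two ways: through the \<open>3\<close>-simplex \<open>?W\<close> here, and through
    \<open>y\<close> in \<open>e4\<close>.\<close>
  have e3: "cj J 1 ?kk (compose {..1} ?h (up 1)) Y k ?s = cj J 1 (Suc (Suc 1)) (up 1) ?W k ?s"
  proof -
    have "cj J 1 ?kk (compose {..1} ?h (up 1)) Y k ?s = cj J (Suc (Suc 1)) ?kk ?h Y k (cj J 1 (Suc (Suc 1)) (up 1) ?W k ?s)"
      unfolding Y(3)[symmetric]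
      by (rule cj_comp[OF J up_in active_in[OF ha] Y(1)])
        (use s A1 Y(2) in \<open>simp only: hat_up[OF long_in(1)] P_P[OF long_in(1) up_in Y(1), symmetric]\<close>)
    also have "\<dots> = cj J 1 (Suc (Suc 1)) (up 1) ?W k ?s"
      by (rule cj_active[OF J ha Y(1)]) (use sW in \<open>simp only: J_active(1)[OF J ha Y(1), symmetric] Y(3)\<close>)
    finally show ?thesis .
  qed
  have e4: "cj J 1 ?kk (compose {..1} (up ?k) (long ?k)) Y k ?s = cj J ?k ?kk (up ?k) Y k ?s"
  proof -
    have "cj J 1 ?kk (compose {..1} (up ?k) (long ?k)) Y k ?s = cj J ?k ?kk (up ?k) Y k (cj J 1 ?k (long ?k) y k ?s)"
      unfolding Y(2)[symmetric]
      by (rule cj_comp[OF J long_in(1) up_in Y(1)])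
        (use s A1 Y(2) in \<open>simp only: P_P[OF long_in(1) up_in Y(1), symmetric]\<close>)
    also have "cj J 1 ?k (long ?k) y k ?s = ?s" by (rule cj_active[OF J long_active(1) y(1) s])
    finally show ?thesis .
  qed
  have "cj J m n p x k ?s = cj J ?k ?kk (up ?k) Y k ?s"
    using e1 e2 e3 e4 hat_up[OF long_in(1), of ?k] by simp
  also have "\<dots> = ia J ?kk Y k (compose {..k} (up ?k) (up k))"
    using cj_std[OF J up_in Y(1) up_in] Y(2) by simp
  finally show ?thesis .
qed

text \<open>The insertion \<open>Y\<close>, and the simplex left after deleting its second and its
  second to last vertex, are built in \<open>X\<close> from \<open>x\<close> and \<open>y\<close>
  alone. By \<open>cj_insert\<close> the latter represents the value of the culf map both for
  \<open>J\<close> and for \<open>J'\<close>.\<close>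

lemma cj_tr:
  assumes J: "scm J" and J': "scm J'" and p: "p \<in> Delta m n" and x: "x \<in> Ob n" and s: "s \<in> simps (IA J m (P m n p x)) k"
  shows "cj J' m n p x k (tr J J' m (P m n p x) k s) = tr J J' n x k (cj J m n p x k s)"
proof -
  let ?k = "Suc (Suc k)" and ?kk = "Suc (Suc (Suc (Suc k)))"
  have x': "P m n p x \<in> Ob m" by (rule P_in[OF p x])
  define y where "y = rep J m (P m n p x) k s"
  note y = rep[OF J x' s, folded y_def]
  from insert_ex1[OF p x y(1,2)] obtain Y where Y: "Y \<in> Ob ?kk" "P ?k ?kk (up ?k) Y = y"
     "P (Suc (Suc 1)) ?kk (hat 1 ?k (long ?k)) Y =
      P (Suc (Suc 1)) n (compose {..Suc (Suc 1)} (kap n) (hat 1 n (compose {..1} p (long m)))) x" by blast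
  have pl: "compose {..1} p (long m) \<in> Delta 1 n" by (rule Delta_comp[OF long_in(1) p])
  have wa: "active (Suc (Suc 1)) n (compose {..Suc (Suc 1)} (kap n) (hat 1 n (compose {..1} p (long m))))"
    by (rule active_comp[OF hat_active[OF pl] kap_active])
  have lY: "P 1 ?kk (long ?kk) Y = P 1 n (long n) x"
    using long_long[OF hat_active[OF long_in(1)] Y(1)] long_long[OF wa x] Y(3) by simp
  let ?y = "P ?k ?kk (hat k ?k (up k)) Y"
  have y2: "?y \<in> Ob ?k" "P 1 ?k (long ?k) ?y = P 1 n (long n) x"
    using P_in[OF hat_in[OF up_in] Y(1)] long_long[OF hat_active[OF up_in] Y(1)] lY by simp_all
  have k: "ia K ?kk Y k (compose {..k} (up ?k) (up k)) = ia K ?k ?y k (up k)" if K: "scm K" for K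
    using J_active_apply[OF K hat_active[OF up_in] Y(1) up_in] by (simp add: hat_up[OF up_in])
  have "cj J' m n p x k (tr J J' m (P m n p x) k s) = ia J' ?k ?y k (up k)"
    using tr_apply[OF J x' y(1,2), of J'] y(3) cj_insert[OF J' p x y(1,2) Y] k[OF J'] by simp
  also have "\<dots> = tr J J' n x k (ia J ?k ?y k (up k))"
    using tr_apply[OF J x y2] by simp
  also have "\<dots> = tr J J' n x k (cj J m n p x k s)"
    using cj_insert[OF J p x y(1,2) Y] k[OF J] y(3) by simp
  finally show ?thesis .
qed

section \<open>The comparison modification and its uniqueness\<close>

definition tmod :: "('o, 'a, 'u subdiv, 'u subdiv_arr) pseudonat \<Rightarrow> ('o, 'a, 'u subdiv, 'u subdiv_arr) pseudonat \<Rightarrow> nat \<Rightarrow> 'o \<Rightarrow> 'u subdiv_arr" where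
  "tmod J J' n = (\<lambda>x\<in>Ob n. ((IA J n x, ia J n x), (IA J' n x, ia J' n x), tr J J' n x))"

text \<open>The long edge of \<open>f\<close> lifts to an arrow \<open>g\<close> out of the
  representative \<open>y\<close>. Since \<open>jf\<close> depends only on the long edge,
  \<open>f\<close> acts on \<open>s\<close> as \<open>g\<close> acts on the subdivision given by
  \<open>y\<close>.\<close>

lemma tr_natural:
  assumes J: "scm J" and J': "scm J'" and f: "f \<in> hom (level X n) x x'" and s: "s \<in> simps (IA J n x) k"
  shows "tr J J' n x' k (jf J n f k s) = jf J' n f k (tr J J' n x k s)"
proof -
  let ?k = "Suc (Suc k)"
  have x: "x \<in> Ob n" and x': "x' \<in> Ob n" using arr_ob[OF f] by auto
  have fa: "f \<in> Ar n" "Src (level X n) f = x" "Tgt (level X n) f = x'" using f by (auto simp: hom_def)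
  define y where "y = rep J n x k s"
  note y = rep[OF J x s, folded y_def]
  note lf = Q_in[OF long_in(1) fa(1)]
  have "Src (level X 1) (Q 1 n (long n) f) = P 1 ?k (long ?k) y"
    using Q_src[OF long_in(1) fa(1)] fa(2) y(2) by simp
  from lift_src[OF y(1) lf this] obtain g where g: "g \<in> Ar ?k" "Src (level X ?k) g = y" "Q 1 ?k (long ?k) g = Q 1 n (long n) f"
    by blast
  let ?y = "Tgt (level X ?k) g"
  have gh: "g \<in> hom (level X ?k) y ?y" using g by (simp add: hom_def)
  have y': "?y \<in> Ob ?k" "P 1 ?k (long ?k) ?y = P 1 n (long n) x'"
    using arr_ob[OF gh] Q_tgt[OF long_in(1) g(1)] g(3) Q_tgt[OF long_in(1) fa(1)] fa(3) by auto
  have jj: "jf K n f k (ia K ?k y k (up k)) = ia K ?k ?y k (up k)" if K: "scm K" for K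
  proof -
    have "jf K n f = jf K ?k g" using jf_active[OF K long_active(1) f] jf_active[OF K long_active(1) gh] g(3) by simp
    then show ?thesis using U_arr_apply[OF J_ar(2)[OF K gh] up_in] by simp
  qed
  show ?thesis
    using jj[OF J] jj[OF J'] tr_apply[OF J x y(1,2), of J'] tr_apply[OF J x' y', of J'] y(3) by simp
qed

text \<open>Compatibility with the structure isomorphisms is an equation between isomorphisms of
  subdivisions. It is tested after the culf part \<open>c'\<close> of the chosen factorisation,
  where it becomes \<open>cj_tr\<close>.\<close>

lemma tmod_modification:
  assumes J: "scm J" and J': "scm J'"
  shows "modification X U J J' (tmod J J')"
  unfolding modification_def U_groupoid_sel
proof (intro conjI allI ballI)
  fix n
  show "tmod J J' n \<in> extensional (Ob n)" by (simp add: tmod_def)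
  show "tmod J J' n x \<in> hom (U_level n) (jo J n x) (jo J' n x)" if x: "x \<in> Ob n" for x
    using tr_arr[OF J J' x] x by (simp add: tmod_def U_hom)
  show "Comp (U_level n) (tmod J J' n (Tgt (level X n) f)) (arr_map (cmpt J n) f) =
      Comp (U_level n) (arr_map (cmpt J' n) f) (tmod J J' n (Src (level X n) f))" if f: "f \<in> Ar n" for f
  proof -
    let ?x = "Src (level X n) f" and ?y = "Tgt (level X n) f"
    have fh: "f \<in> hom (level X n) ?x ?y" using f by (simp add: hom_def)
    have x: "?x \<in> Ob n" and y: "?y \<in> Ob n" using arr_ob[OF fh] by auto
    note a = J_ar[OF J fh] and a' = J_ar[OF J' fh]
    note m = U_arr_map[OF a(2)] U_arr_map[OF a'(2)]
    have "simp_comp (IA J n ?x) (tr J J' n ?y) (jf J n f) = simp_comp (IA J n ?x) (jf J' n f) (tr J J' n ?x)"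
      by (rule map_eqI[OF map_comp[OF m(1) tr_map[OF J J' y]] map_comp[OF tr_map[OF J J' x] m(2)]])
        (auto simp: U_objD(2)[OF J_ob[OF J x]] simp_comp_apply tr_natural[OF J J' fh])
    then show ?thesis unfolding a(1) a'(1) using x y by (simp add: tmod_def)
  qed
next
  fix m n p x assume p: "p \<in> Delta m n" and x: "x \<in> Ob n"
  let ?x = "P m n p x"
  have x': "?x \<in> Ob m" by (rule P_in[OF p x])
  obtain A a c where c: "ch m n p (IA J n x, ia J n x) = ((A, a), c)" "(A, a) \<in> U_obj m"
    using ch_cases[OF p J_ob[OF J x]] by metis
  obtain A' a' c' where c': "ch m n p (IA J' n x, ia J' n x) = ((A', a'), c')" "(A', a') \<in> U_obj m" "strict_culf A' (IA J' n x) c'"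
    using ch_cases[OF p J_ob[OF J' x]] by metis
  note cx = c(1) and cx' = c'(1)
  note Sa = S_inj[OF J p x cx] and Sa' = S_inj[OF J' p x cx']
  obtain G where G: "arr_map (U_pull ch m n p) ((IA J n x, ia J n x), (IA J' n x, ia J' n x), tr J J' n x) = ((A, a), (A', a'), G)"
    "((A, a), (A', a'), G) \<in> U_arr m" "\<And>k s. s \<in> simps A k \<Longrightarrow> c' k (G k s) = tr J J' n x k (c k s)"
    by (rule pull_arr[OF p tr_arr[OF J J' x] c(1) c'(1)]) blast
  obtain V where V: "((IA J' m ?x, ia J' m ?x), (A', a'), V) \<in> U_arr m"
    "\<And>k s. s \<in> simps (IA J' m ?x) k \<Longrightarrow> S J' m n p x k (V k s) = s"
    by (rule U_arr_inverse[OF Sa']) blast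
  \<comment> \<open>The comparison at \<open>?x\<close>, transported through the structure
    isomorphisms to the chosen factorisations; it is to be identified with the image
    \<open>G\<close> of the comparison at \<open>x\<close> under \<open>U_pull\<close>.\<close>
  let ?H = "simp_comp A (simp_comp (IA J m ?x) V (tr J J' m ?x)) (S J m n p x)"
  have H: "((A, a), (A', a'), ?H) \<in> U_arr m"
    by (rule U_arr_comp[OF Sa U_arr_comp[OF tr_arr[OF J J' x'] V(1)]])
  have Sm: "simplicial_map A (IA J m ?x) (S J m n p x)" "simplicial_map (IA J' m ?x) A' V" "simplicial_map A A' G" "simplicial_map A A' ?H"
     "simplicial_map A' (IA J' m ?x) (S J' m n p x)"
    by (rule U_arr_map, fact)+
  have Happ: "?H k s = V k (tr J J' m ?x k (S J m n p x k s))" if "s \<in> simps A k" for k s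
    using that map_in[OF Sm(1) that] by (simp add: simp_comp_apply)
  have "c' k (?H k s) = c' k (G k s)" if s: "s \<in> simps A k" for k s
  proof -
    let ?t = "S J m n p x k s"
    have t: "?t \<in> simps (IA J m ?x) k" by (rule map_in[OF Sm(1) s])
    have t': "tr J J' m ?x k ?t \<in> simps (IA J' m ?x) k" by (rule map_in[OF tr_map[OF J J' x'] t])
    have "c' k (V k (tr J J' m ?x k ?t)) = cj J' m n p x k (tr J J' m ?x k ?t)"
      using cj_S[OF J' p x cx' map_in[OF Sm(2) t']] V(2)[OF t'] by simp
    also have "\<dots> = tr J J' n x k (cj J m n p x k ?t)" by (rule cj_tr[OF J J' p x t])
    also have "\<dots> = c' k (G k s)" using cj_S[OF J p x cx s] G(3)[OF s] by simp
    finally show ?thesis using Happ[OF s] by simp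
  qed
  then have "simp_comp A c' ?H = simp_comp A c' G"
    by (intro map_eqI[OF map_comp[OF Sm(4) culf_map[OF c'(3)]] map_comp[OF Sm(3) culf_map[OF c'(3)]]])
      (auto simp: U_objD(2)[OF c(2)] simp_comp_apply[of _ A])
  then have HG: "?H = G"
    using H G(2) by (intro cancel_culf[OF c(2) c'(3) U_objD(2)[OF c'(2)] Sm(4,3)]) (auto simp: U_arr_iff)
  have "simp_comp A (S J' m n p x) G = simp_comp A (tr J J' m ?x) (S J m n p x)"
  proof (rule map_eqI[OF map_comp[OF Sm(3,5)] map_comp[OF Sm(1) tr_map[OF J J' x']]])
    fix k s assume s: "s \<in> simps A k"
    show "simp_comp A (S J' m n p x) G k s = simp_comp A (tr J J' m ?x) (S J m n p x) k s"
      using Happ[OF s] HG V(2)[OF map_in[OF tr_map[OF J J' x'] map_in[OF Sm(1) s]]] s by (simp add: simp_comp_apply)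
  qed (rule U_objD(2)[OF c(2)])+
  then show "Comp (U_level m) (struct_iso J' m n p x) (arr_map (U_pull ch m n p) (tmod J J' n x)) =
     Comp (U_level m) (tmod J J' m ?x) (struct_iso J m n p x)"
    unfolding struct_eq(1)[OF J p x] struct_eq(1)[OF J' p x] using G(1) x x' cx cx' by (simp add: tmod_def)
qed

text \<open>Compatibility with active maps makes the component at \<open>x\<close> equal to the
  component at every simplex with the same long edge. At the simplex that represents
  \<open>s\<close> the component has to preserve subdivisions, and this fixes its value on
  \<open>s\<close>.\<close>

lemma modification_unique:
  assumes J: "scm J" and J': "scm J'" and M: "modification X U J J' \<Gamma>"
  shows "\<Gamma> = tmod J J'"
proof (intro ext)
  fix n x
  have Mh: "\<Gamma> n x \<in> hom (U_level n) (jo J n x) (jo J' n x)" if "x \<in> Ob n" for n x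
    using M that unfolding modification_def U_groupoid_sel by blast
  define g where "g = (\<lambda>n x. snd (snd (\<Gamma> n x)))"
  have Mg: "\<Gamma> n x = ((IA J n x, ia J n x), (IA J' n x, ia J' n x), g n x)"
    "((IA J n x, ia J n x), (IA J' n x, ia J' n x), g n x) \<in> U_arr n" if "x \<in> Ob n" for n x
    using Mh[OF that] unfolding g_def by (auto simp: U_hom)
  have gm: "simplicial_map (IA J n x) (IA J' n x) (g n x)" if "x \<in> Ob n" for n x
    using Mg(2)[OF that] U_arr_map by blast
  have act: "g m (P m n p x) = g n x" if p: "active m n p" and x: "x \<in> Ob n" for m n p x
  proof -
    note x' = P_in[OF active_in[OF p] x]
    have e: "Comp (U_level m) (struct_iso J' m n p x) (arr_map (U_pull ch m n p) (\<Gamma> n x)) =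
      Comp (U_level m) (\<Gamma> m (P m n p x)) (struct_iso J m n p x)"
      using M active_in[OF p] x unfolding modification_def U_groupoid_sel by blast
    have m1: "simplicial_map (IA J n x) (IA J' n x) (g m (P m n p x))"
      using gm[OF x'] J_active(1)[OF J p x] J_active(1)[OF J' p x] by simp
    show ?thesis using e unfolding struct_active[OF J p x] struct_active[OF J' p x] Mg(1)[OF x] Mg(1)[OF x']
        pull_arr_active[OF p Mg(2)[OF x]]
      using pull_ob_active[OF p J_ob[OF J x]] pull_ob_active[OF p J_ob[OF J' x]] gm[OF x] m1
      by (simp add: J_active[OF J p x] J_active[OF J' p x] simp_id_comp comp_simp_id)
  qed
  have gl: "g m y = g n x" if "x \<in> Ob n" "y \<in> Ob m" "P 1 m (long m) y = P 1 n (long n) x" for n x m y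
    using act[OF long_active(1) that(1)] act[OF long_active(1) that(2)] that(3) by simp
  show "\<Gamma> n x = tmod J J' n x"
  proof (cases "x \<in> Ob n")
    case True
    have "g n x = tr J J' n x"
    proof (rule map_eqI[OF gm[OF True] tr_map[OF J J' True]])
      fix k s assume s: "s \<in> simps (IA J n x) k"
      define y where "y = rep J n x k s"
      note y = rep[OF J True s, folded y_def]
      have "g n x k s = ia J' (Suc (Suc k)) y k (up k)"
        using gl[OF True y(1,2)] U_arr_apply[OF Mg(2)[OF y(1)] up_in] y(3) by simp
      then show "g n x k s = tr J J' n x k s" using s by (simp add: tr_def y_def)
    qed
    then show ?thesis using Mg(1)[OF True] True by (simp add: tmod_def)
  next
    case False
    have "\<Gamma> n \<in> extensional (Ob n)" using M unfolding modification_def by blast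
    then show ?thesis using False by (simp add: tmod_def extensional_def)
  qed
qed

lemma mod_id_tmod: "scm J \<Longrightarrow> mod_id X U J = tmod J J"
  by (auto simp: mod_id_def tmod_def fun_eq_iff tr_self restrict_def)

lemma mod_comp_tmod:
  assumes "scm J" "scm J'" "scm J''"
  shows "mod_comp X U (tmod J' J'') (tmod J J') = tmod J J''"
proof (intro ext)
  fix n x
  show "mod_comp X U (tmod J' J'') (tmod J J') n x = tmod J J'' n x"
    using tr_comp[OF assms, of x n] by (cases "x \<in> Ob n") (auto simp: mod_comp_def tmod_def)
qed

end

subsection \<open>The interval of an edge\<close>

definition init :: "nat \<Rightarrow> nat \<Rightarrow> nat" where
  "init n = (\<lambda>i\<in>{..n}. i)"

lemma init_in: "init n \<in> Delta n (Suc n)"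
  by (intro DeltaI) (auto simp: init_def)

lemma init_apply: "i \<le> n \<Longrightarrow> init n i = i"
  by (simp add: init_def)

lemma init_edg: "Suc i \<le> n \<Longrightarrow> compose {..1} (init n) (edg i) = edg i"
  by (auto simp: fun_eq_iff compose_def edg_def init_def)

lemma edg_0: "edg 0 = delta_id 1"
  by (auto simp: fun_eq_iff edg_def delta_id_def)

text \<open>Induction on the length of the chain: attaching one edge at the end of a simplex of
  positive dimension is a bijection, and in dimension one the spine is the edge itself.\<close>

lemma segalI:
  assumes A: "simplicial_set A"
    and glue: "\<And>n x e. x \<in> simps A (Suc n) \<Longrightarrow> e \<in> simps A 1 \<Longrightarrow> act A 0 (Suc n) (vtx (Suc n)) x = act A 0 1 (vtx 0) e \<Longrightarrow>
      \<exists>!z. z \<in> simps A (Suc (Suc n)) \<and> act A (Suc n) (Suc (Suc n)) (init (Suc n)) z = x \<and> act A 1 (Suc (Suc n)) (edg (Suc n)) z = e"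
  shows "strict_segal A"
proof -
  let ?C = "\<lambda>n. {e \<in> {..<n} \<rightarrow>\<^sub>E simps A 1. \<forall>i. Suc i < n \<longrightarrow> act A 0 1 (vtx 1) (e i) = act A 0 1 (vtx 0) (e (Suc i))}"
  let ?s = "\<lambda>n x. \<lambda>i\<in>{..<n}. act A 1 n (edg i) x"
  have ei: "act A 1 (Suc n) (edg i) z = act A 1 n (edg i) (act A n (Suc n) (init n) z)"
    if "z \<in> simps A (Suc n)" "Suc i \<le> n" for n i z
    using act_act[OF A edg_in(1)[OF that(2)] init_in that(1)] init_edg[OF that(2)] by simp
  have maps: "?s (Suc n) x \<in> ?C (Suc n)" if x: "x \<in> simps A (Suc n)" for n x
  proof -
    have "act A 0 1 (vtx 1) (act A 1 (Suc n) (edg i) x) = act A 0 1 (vtx 0) (act A 1 (Suc n) (edg (Suc i)) x)" if "i < n" for i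
      using that by (simp add: act_act[OF A vtx_in edg_in(2) x] comp_vtx edg_val)
    then show ?thesis using act_in[OF A edg_in(1) x] by auto
  qed
  have bij: "inj_on (?s (Suc n)) (simps A (Suc n)) \<and> ?C (Suc n) \<subseteq> ?s (Suc n) ` simps A (Suc n)" for n
  proof (induction n)
    case 0
    have a: "act A 1 1 (edg 0) x = x" if "x \<in> simps A 1" for x
      using act_id[OF A that] by (simp add: edg_0)
    have inj1: "x = y" if "x \<in> simps A 1" "y \<in> simps A 1" "?s 1 x = ?s 1 y" for x y
      using fun_cong[OF that(3), of 0] a that by simp
    have sur1: "e \<in> ?s 1 ` simps A 1" if e: "e \<in> ?C 1" for e
    proof -
      have e': "e \<in> {..<1} \<rightarrow>\<^sub>E simps A 1" using e by blast
      have e0: "e 0 \<in> simps A 1" using e' by auto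
      have "e = ?s 1 (e 0)"
      proof
        fix i show "e i = ?s 1 (e 0) i" using PiE_arb[OF e', of i] a[OF e0] by (cases "i = 0") auto
      qed
      then show ?thesis using e0 by blast
    qed
    show ?case unfolding One_nat_def[symmetric]
      by (intro conjI inj_onI subsetI) (rule inj1, assumption+, rule sur1, assumption)
  next
    case (Suc n)
    let ?m = "Suc n"
    have inj: "inj_on (?s (Suc ?m)) (simps A (Suc ?m))"
    proof (rule inj_onI)
      fix x y assume x: "x \<in> simps A (Suc ?m)" and y: "y \<in> simps A (Suc ?m)" and eq: "?s (Suc ?m) x = ?s (Suc ?m) y"
      have eq': "act A 1 (Suc ?m) (edg i) x = act A 1 (Suc ?m) (edg i) y" if "i < Suc ?m" for i
        using fun_cong[OF eq, of i] that by simp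
      have ix: "act A ?m (Suc ?m) (init ?m) x \<in> simps A ?m" by (rule act_in[OF A init_in x])
      have iy: "act A ?m (Suc ?m) (init ?m) y \<in> simps A ?m" by (rule act_in[OF A init_in y])
      have "?s ?m (act A ?m (Suc ?m) (init ?m) x) = ?s ?m (act A ?m (Suc ?m) (init ?m) y)"
        using eq' ei[OF x] ei[OF y] by (auto simp: fun_eq_iff Suc_le_eq)
      then have 1: "act A ?m (Suc ?m) (init ?m) x = act A ?m (Suc ?m) (init ?m) y"
        using inj_onD[OF conjunct1[OF Suc] _ ix iy] by blast
      have e: "act A 1 (Suc ?m) (edg ?m) x \<in> simps A 1" by (rule act_in[OF A edg_in(1) x]) simp
      have v: "act A 0 ?m (vtx ?m) (act A ?m (Suc ?m) (init ?m) x) = act A 0 1 (vtx 0) (act A 1 (Suc ?m) (edg ?m) x)"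
        by (simp add: act_act[OF A vtx_in init_in x] act_act[OF A vtx_in edg_in(2) x] comp_vtx edg_val init_apply)
      show "x = y" using glue[OF ix e v] x y 1 eq'[of ?m] by auto
    qed
    moreover have "e \<in> ?s (Suc ?m) ` simps A (Suc ?m)" if e: "e \<in> ?C (Suc ?m)" for e
    proof -
      have e': "e \<in> {..<Suc ?m} \<rightarrow>\<^sub>E simps A 1" 
        and ch: "\<And>i. Suc i < Suc ?m \<Longrightarrow> act A 0 1 (vtx 1) (e i) = act A 0 1 (vtx 0) (e (Suc i))" using e by auto
      have "(\<lambda>i\<in>{..<?m}. e i) \<in> ?C ?m" using e' ch by auto
      then obtain x where x: "x \<in> simps A ?m" "(\<lambda>i\<in>{..<?m}. e i) = ?s ?m x" using Suc by blast
      have xe: "act A 1 ?m (edg i) x = e i" if "i < ?m" for i using fun_cong[OF x(2), of i] that by simp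
      have en: "e ?m \<in> simps A 1" using e' by auto
      have "act A 0 ?m (vtx ?m) x = act A 0 1 (vtx 1) (act A 1 ?m (edg n) x)"
        by (simp add: act_act[OF A vtx_in edg_in(2) x(1)] comp_vtx edg_val)
      also have "\<dots> = act A 0 1 (vtx 0) (e ?m)" using xe[of n] ch[of n] by simp
      finally have "act A 0 ?m (vtx ?m) x = act A 0 1 (vtx 0) (e ?m)" .
      from glue[OF x(1) en this] obtain z where z: "z \<in> simps A (Suc ?m)" "act A ?m (Suc ?m) (init ?m) z = x"
        "act A 1 (Suc ?m) (edg ?m) z = e ?m" by blast
      have ze: "act A 1 (Suc ?m) (edg i) z = e i" if "i < Suc ?m" for i
        using that ei[OF z(1), of i] z(2,3) xe[of i] by (cases "i = ?m") auto
      have "e = ?s (Suc ?m) z"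
      proof
        fix i show "e i = ?s (Suc ?m) z i" using ze[of i] PiE_arb[OF e', of i] by (cases "i < Suc ?m") auto
      qed
      then show ?thesis using z(1) by blast
    qed
    ultimately show ?case by blast
  qed
  have "bij_betw (?s n) (simps A n) (?C n)" if n1: "n \<ge> 1" for n
  proof -
    obtain k where n: "n = Suc k" using Suc_le_D[of 0 n] n1 by auto
    show ?thesis unfolding n bij_betw_def using bij[of k] maps[of _ k] by blast
  qed
  then show ?thesis unfolding strict_segal_def coface_vtx edg_def by blast
qed

lemma codegen0_active: "active (Suc 0) 0 codegen0" "active 1 0 codegen0"
  by (auto simp: active_def codegen0_def intro!: DeltaI)

text \<open>Continuing a simplex beyond its last vertex keeps the added top vertex in place, so it
  amounts to subdividing the last edge. This turns \<open>hat\<close> of an initial segment into a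
  pushout of \<open>long 2\<close>.\<close>

lemma extend_init: "extend (Suc n) 0 1 2 (long 2) = hat n (Suc n) (init n)"
  by (auto simp: fun_eq_iff extend_def hat_def init_def long_def)

lemma hat_edg_shift: "compose {..2} (hat 1 (Suc n) (edg n)) (shift 1 2) = shift (Suc n) 2"
  by (auto simp: fun_eq_iff compose_def hat_def edg_def shift_def le_Suc_eq numeral_2_eq_2)

lemma extend_vtx0: "extend 1 0 1 2 (long 2) = hat 0 1 (vtx 0)"
  by (auto simp: fun_eq_iff extend_def hat_def vtx_def long_def)

lemma hat_vtx_shift: "i \<le> n \<Longrightarrow> compose {..1} (hat 0 n (vtx i)) (shift 1 1) = (\<lambda>j\<in>{..1}. if j = 0 then Suc i else Suc (Suc n))"
  "i \<le> n \<Longrightarrow> compose {..1} (hat 0 n (vtx i)) (shift 0 1) = (\<lambda>j\<in>{..1}. if j = 0 then 0 else Suc i)"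
  by (auto simp: fun_eq_iff compose_def hat_def vtx_def shift_def le_Suc_eq)

lemma shift_edge: "shift a 1 = (\<lambda>j\<in>{..1}. if j = 0 then a else Suc a)"
  by (auto simp: fun_eq_iff shift_def le_Suc_eq)

lemma kap_hat_vtx0_shift: "compose {..1} (compose {..Suc (Suc 0)} (kap 1) (hat 0 1 (vtx 0))) (shift 0 1) = compose {..1} (vtx 0) codegen0"
  by (auto simp: fun_eq_iff compose_def hat_def vtx_def shift_def le_Suc_eq kap_def codegen0_def)

lemma kap_hat_vtx1_shift: "compose {..1} (compose {..Suc (Suc 0)} (kap 1) (hat 0 1 (vtx 1))) (shift 1 1) = compose {..1} (vtx 1) codegen0"
  by (auto simp: fun_eq_iff compose_def hat_def vtx_def shift_def le_Suc_eq kap_def codegen0_def)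

text \<open>The map \<open>q\<close> with the vertices \<open>0\<close> and \<open>n\<close> added,
  as an active map to \<open>[n]\<close>; hulls of simplices of a subdivision have this
  form.\<close>

abbreviation kh :: "nat \<Rightarrow> nat \<Rightarrow> (nat \<Rightarrow> nat) \<Rightarrow> nat \<Rightarrow> nat" where
  "kh k n q \<equiv> compose {..Suc (Suc k)} (kap n) (hat k n q)"

lemma kh_active: "q \<in> Delta k n \<Longrightarrow> active (Suc (Suc k)) n (kh k n q)"
  by (rule active_comp[OF hat_active kap_active])

lemma kh_in: "q \<in> Delta k n \<Longrightarrow> kh k n q \<in> Delta (Suc (Suc k)) n"
  by (rule active_in[OF kh_active])

lemma kh_hat:
  assumes "q \<in> Delta j k" "p \<in> Delta k n"
  shows "compose {..Suc (Suc j)} (kh k n p) (hat j k q) = kh j n (compose {..j} p q)"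
  by (simp add: Delta_assoc[OF hat_in[OF assms(1)], symmetric] hat_hat[OF assms])

lemma active_kh:
  assumes g: "active m n g" and q: "q \<in> Delta k m"
  shows "compose {..Suc (Suc k)} g (kh k m q) = kh k n (compose {..k} g q)"
proof -
  have "compose {..Suc (Suc k)} g (kh k m q) = compose {..Suc (Suc k)} (compose {..Suc (Suc m)} g (kap m)) (hat k m q)"
    by (rule Delta_assoc[OF hat_in[OF q]])
  also have "\<dots> = compose {..Suc (Suc k)} (compose {..Suc (Suc m)} (kap n) (hat m n g)) (hat k m q)"
    by (simp only: kap_hat[OF g])
  also have "\<dots> = kh k n (compose {..k} g q)" by (rule kh_hat[OF q active_in[OF g]])
  finally show ?thesis .
qed

section \<open>Composition and degeneracy in the interval of an edge\<close>

context rigid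
begin

text \<open>In the interval of an edge, \<open>e\<close> starts at the last vertex of
  \<open>x\<close>. It refines the last edge of the simplex \<open>x\<close> of \<open>X\<close> by
  a \<open>2\<close>-simplex, and the decomposition pullback for \<open>long 2\<close> along this
  edge composes the two.\<close>

lemma glue_ex1:
  assumes x: "x \<in> Ob (Suc (Suc n))" and e: "e \<in> Ob (Suc (Suc 1))"
    and v: "P (Suc (Suc 0)) (Suc (Suc n)) (hat 0 n (vtx n)) x = P (Suc (Suc 0)) (Suc (Suc 1)) (hat 0 1 (vtx 0)) e"
  shows "\<exists>!z. z \<in> Ob (Suc (Suc (Suc n))) \<and> P (Suc (Suc n)) (Suc (Suc (Suc n))) (hat n (Suc n) (init n)) z = x \<and>
     P (Suc (Suc 1)) (Suc (Suc (Suc n))) (hat 1 (Suc n) (edg n)) z = e"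
proof -
  have s: "shift 1 2 \<in> Delta 2 (Suc (Suc 1))" by (rule shift_in) simp
  have s1: "shift 1 1 \<in> Delta 1 (Suc (Suc 0))" by (rule shift_in) simp
  have hn: "hat 0 n (vtx n) \<in> Delta (Suc (Suc 0)) (Suc (Suc n))" by (intro hat_in vtx_in) simp
  have h0: "hat 0 1 (vtx 0) \<in> Delta (Suc (Suc 0)) (Suc (Suc 1))" by (intro hat_in vtx_in) simp
  have hi: "hat n (Suc n) (init n) \<in> Delta (Suc (Suc n)) (Suc (Suc (Suc n)))" by (intro hat_in init_in)
  have he: "hat 1 (Suc n) (edg n) \<in> Delta (Suc (Suc 1)) (Suc (Suc (Suc n)))" by (intro hat_in edg_in) simp
  \<comment> \<open>The face of the \<open>3\<close>-simplex \<open>e\<close> opposite its first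
    vertex; its long edge is the last edge of \<open>x\<close>.\<close>
  let ?t = "P 2 (Suc (Suc 1)) (shift 1 2) e"
  have t: "?t \<in> Ob 2" by (rule P_in[OF s e])
  have lt: "P 1 2 (long 2) ?t = P 1 (Suc (Suc n)) (shift (Suc n) 1) x"
  proof -
    have "compose {..1} (shift 1 2) (long 2) = compose {..1} (hat 0 1 (vtx 0)) (shift 1 1)"
      by (simp only: hat_vtx_shift le0) (auto simp: fun_eq_iff compose_def shift_def long_def le_Suc_eq)
    then have "P 1 2 (long 2) ?t = P 1 (Suc (Suc 0)) (shift 1 1) (P (Suc (Suc 0)) (Suc (Suc 1)) (hat 0 1 (vtx 0)) e)"
      by (simp only: P_P[OF long_in(1) s e] P_P[OF s1 h0 e])
    also have "\<dots> = P 1 (Suc (Suc n)) (shift (Suc n) 1) x"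
      unfolding v[symmetric] P_P[OF s1 hn x] hat_vtx_shift(1)[OF le_refl] unfolding shift_edge ..
    finally show ?thesis .
  qed
  have "\<exists>!z. z \<in> Ob (Suc n + 2 + 0) \<and> P 2 (Suc n + 2 + 0) (shift (Suc n) 2) z = ?t \<and>
    P (Suc n + 1 + 0) (Suc n + 2 + 0) (extend (Suc n) 0 1 2 (long 2)) z = x"
    by (rule extend_ob_ex1[OF long_active(1) t]) (use x lt in simp_all)
  then have ex: "\<exists>!z. z \<in> Ob (Suc (Suc (Suc n))) \<and> P 2 (Suc (Suc (Suc n))) (shift (Suc n) 2) z = ?t \<and>
    P (Suc (Suc n)) (Suc (Suc (Suc n))) (hat n (Suc n) (init n)) z = x"
    unfolding extend_init by simp
  then obtain z where z: "z \<in> Ob (Suc (Suc (Suc n)))" "P 2 (Suc (Suc (Suc n))) (shift (Suc n) 2) z = ?t"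
    "P (Suc (Suc n)) (Suc (Suc (Suc n))) (hat n (Suc n) (init n)) z = x" by blast
  have ss: "P 2 (Suc (Suc 1)) (shift 1 2) (P (Suc (Suc 1)) (Suc (Suc (Suc n))) (hat 1 (Suc n) (edg n)) z') = 
    P 2 (Suc (Suc (Suc n))) (shift (Suc n) 2) z'" if "z' \<in> Ob (Suc (Suc (Suc n)))" for z'
    unfolding P_P[OF s he that] hat_edg_shift ..
  let ?e = "P (Suc (Suc 1)) (Suc (Suc (Suc n))) (hat 1 (Suc n) (edg n)) z"
  have e': "?e \<in> Ob (Suc (Suc 1))" by (rule P_in[OF he z(1)])
  have "P (Suc (Suc 0)) (Suc (Suc 1)) (hat 0 1 (vtx 0)) ?e = P (Suc (Suc 0)) (Suc (Suc n)) (hat 0 n (vtx n)) x"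
    unfolding z(3)[symmetric] P_P[OF h0 he z(1)] P_P[OF hn hi z(1)]
    by (simp add: hat_hat vtx_in edg_in init_in comp_vtx edg_val init_apply)
  then have ev: "P (Suc (Suc 0)) (Suc (Suc 1)) (hat 0 1 (vtx 0)) ?e = P (Suc (Suc 0)) (Suc (Suc 1)) (hat 0 1 (vtx 0)) e"
    using v by simp
  have ar: "1 + 1 + 0 = Suc (Suc 0)" "1 + 2 + 0 = Suc (Suc 1)" by simp_all
  \<comment> \<open>A \<open>3\<close>-simplex is determined by its face opposite the vertex
    \<open>0\<close> and its face on the vertices \<open>0\<close>, \<open>1\<close>,
    \<open>3\<close>, by the same pullback with one preceding vertex; hence
    \<open>?e = e\<close>.\<close>
  have "\<exists>!w. w \<in> Ob (1 + 2 + 0) \<and> P 2 (1 + 2 + 0) (shift 1 2) w = ?t \<and> P (1 + 1 + 0) (1 + 2 + 0) (extend 1 0 1 2 (long 2)) w = 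
      P (Suc (Suc 0)) (Suc (Suc 1)) (hat 0 1 (vtx 0)) e"
  proof (rule extend_ob_ex1[OF long_active(1) t])
    show "P (Suc (Suc 0)) (Suc (Suc 1)) (hat 0 1 (vtx 0)) e \<in> Ob (1 + 1 + 0)" using P_in[OF h0 e] by simp
    have "P 1 2 (long 2) ?t = P 1 (Suc (Suc 0)) (shift 1 1) (P (Suc (Suc 0)) (Suc (Suc 1)) (hat 0 1 (vtx 0)) e)"
      unfolding lt v[symmetric] P_P[OF s1 hn x] hat_vtx_shift(1)[OF le_refl] unfolding shift_edge ..
    then show "P 1 2 (long 2) ?t = P 1 (1 + 1 + 0) (shift 1 1) (P (Suc (Suc 0)) (Suc (Suc 1)) (hat 0 1 (vtx 0)) e)"
      by simp
  qed
  then have "\<exists>!w. w \<in> Ob (Suc (Suc 1)) \<and> P 2 (Suc (Suc 1)) (shift 1 2) w = ?t \<and> P (Suc (Suc 0)) (Suc (Suc 1)) (hat 0 1 (vtx 0)) w = 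
      P (Suc (Suc 0)) (Suc (Suc 1)) (hat 0 1 (vtx 0)) e" unfolding extend_vtx0 ar .
  moreover have "P 2 (Suc (Suc 1)) (shift 1 2) ?e = ?t" unfolding ss[OF z(1)] by (rule z(2))
  ultimately have "?e = e" using e e' ev by blast
  moreover have "z' = z" if z': "z' \<in> Ob (Suc (Suc (Suc n)))" "P (Suc (Suc n)) (Suc (Suc (Suc n))) (hat n (Suc n) (init n)) z' = x"
     "P (Suc (Suc 1)) (Suc (Suc (Suc n))) (hat 1 (Suc n) (edg n)) z' = e" for z'
    using ex z z' ss[OF z'(1)] by metis
  ultimately show ?thesis using z by blast
qed

text \<open>The decomposition pullback for the pushout of \<open>[1] \<rightarrow> [0]\<close> along
  the first edge of \<open>[n + 1]\<close>: a degenerate first edge forces the whole simplex to be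
  degenerate there.\<close>

lemma first_degenerate:
  assumes z: "z \<in> Ob (Suc n)" and v: "v \<in> Ob 0" and e: "P 1 (Suc n) (shift 0 1) z = P 1 0 codegen0 v"
  obtains x where "x \<in> Ob n" "z = P (Suc n) n (extend 0 n 1 0 codegen0) x"
proof -
  have "\<exists>!x. x \<in> Ob (0 + 0 + n) \<and> P 0 (0 + 0 + n) (shift 0 0) x = v \<and> P (0 + 1 + n) (0 + 0 + n) (extend 0 n 1 0 codegen0) x = z"
    by (rule extend_ob_ex1[OF codegen0_active(2) v]) (use z e in simp_all)
  then show ?thesis using that by auto
qed

lemma last_degenerate:
  assumes z: "z \<in> Ob (Suc n)" and v: "v \<in> Ob 0" and e: "P 1 (Suc n) (shift n 1) z = P 1 0 codegen0 v"
  obtains x where "x \<in> Ob n" "z = P (Suc n) n (extend n 0 1 0 codegen0) x"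
proof -
  have "\<exists>!x. x \<in> Ob (n + 0 + 0) \<and> P 0 (n + 0 + 0) (shift n 0) x = v \<and> P (n + 1 + 0) (n + 0 + 0) (extend n 0 1 0 codegen0) x = z"
    by (rule extend_ob_ex1[OF codegen0_active(2) v]) (use z e in simp_all)
  then show ?thesis using that by auto
qed

text \<open>The hypothesis says that the first vertex of \<open>z\<close>, as a simplex of the
  interval of \<open>f\<close>, is the degenerate \<open>2\<close>-simplex \<open>(0, 0, 1)\<close>
  of \<open>f\<close>, the future initial object. Hence the first edge of \<open>z\<close> in
  \<open>X\<close> is degenerate.\<close>

lemma first_edge_degenerate:
  assumes f: "f \<in> Ob 1" and z: "z \<in> Ob (Suc (Suc n))" 
    and e: "P (Suc (Suc 0)) (Suc (Suc n)) (hat 0 n (vtx 0)) z = P (Suc (Suc 0)) 1 (kh 0 1 (vtx 0)) f"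
  obtains x where "x \<in> Ob (Suc n)" "z = P (Suc (Suc n)) (Suc n) (extend 0 (Suc n) 1 0 codegen0) x"
proof (rule first_degenerate[OF z P_in[OF vtx_in f, of 0]])
  have s1: "shift 0 1 \<in> Delta 1 (Suc (Suc 0))" by (rule shift_in) simp
  have h: "hat 0 n (vtx 0) \<in> Delta (Suc (Suc 0)) (Suc (Suc n))" by (intro hat_in vtx_in) simp
  have k: "kh 0 1 (vtx 0) \<in> Delta (Suc (Suc 0)) 1" by (intro kh_in vtx_in) simp
  have "P 1 (Suc (Suc n)) (shift 0 1) z = P 1 (Suc (Suc 0)) (shift 0 1) (P (Suc (Suc 0)) (Suc (Suc n)) (hat 0 n (vtx 0)) z)"
    unfolding P_P[OF s1 h z] hat_vtx_shift(2)[OF le0] unfolding shift_edge ..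
  also have "\<dots> = P 1 0 codegen0 (P 0 1 (vtx 0) f)"
    unfolding e P_P[OF s1 k f] kap_hat_vtx0_shift P_P[OF active_in[OF codegen0_active(2)] vtx_in[OF le0] f] ..
  finally show "P 1 (Suc (Suc n)) (shift 0 1) z = P 1 0 codegen0 (P 0 1 (vtx 0) f)" .
qed (use that in auto)

lemma last_edge_degenerate:
  assumes f: "f \<in> Ob 1" and z: "z \<in> Ob (Suc (Suc n))" 
    and e: "P (Suc (Suc 0)) (Suc (Suc n)) (hat 0 n (vtx n)) z = P (Suc (Suc 0)) 1 (kh 0 1 (vtx 1)) f"
  shows "P 1 (Suc (Suc n)) (shift (Suc n) 1) z = P 1 0 codegen0 (P 0 1 (vtx 1) f)"
proof -
  have s1: "shift 1 1 \<in> Delta 1 (Suc (Suc 0))" by (rule shift_in) simp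
  have h: "hat 0 n (vtx n) \<in> Delta (Suc (Suc 0)) (Suc (Suc n))" by (intro hat_in vtx_in) simp
  have k: "kh 0 1 (vtx 1) \<in> Delta (Suc (Suc 0)) 1" by (intro kh_in vtx_in) simp
  have "P 1 (Suc (Suc n)) (shift (Suc n) 1) z = P 1 (Suc (Suc 0)) (shift 1 1) (P (Suc (Suc 0)) (Suc (Suc n)) (hat 0 n (vtx n)) z)"
    unfolding P_P[OF s1 h z] hat_vtx_shift(1)[OF le_refl] unfolding shift_edge ..
  also have "\<dots> = P 1 0 codegen0 (P 0 1 (vtx 1) f)"
    unfolding e P_P[OF s1 k f] kap_hat_vtx1_shift P_P[OF active_in[OF codegen0_active(2)] vtx_in[OF le_refl] f] ..
  finally show ?thesis .
qed

text \<open>Peeling off the degeneracy at the first edge and then the one at the last edge exhibits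
  \<open>z\<close> as a degeneracy along \<open>kap n\<close>. This lets an end-to-end simplex of
  the interval come from an \<open>n\<close>-simplex of \<open>X\<close>.\<close>

lemma degenerate_ends:
  assumes f: "f \<in> Ob 1" and z: "z \<in> Ob (Suc (Suc n))" 
    and e0: "P (Suc (Suc 0)) (Suc (Suc n)) (hat 0 n (vtx 0)) z = P (Suc (Suc 0)) 1 (kh 0 1 (vtx 0)) f"
    and e1: "P (Suc (Suc 0)) (Suc (Suc n)) (hat 0 n (vtx n)) z = P (Suc (Suc 0)) 1 (kh 0 1 (vtx 1)) f"
  shows "z = P (Suc (Suc n)) n (kap n) (P n (Suc (Suc n)) (up n) z)"
proof -
  obtain z1 where z1: "z1 \<in> Ob (Suc n)" "z = P (Suc (Suc n)) (Suc n) (extend 0 (Suc n) 1 0 codegen0) z1"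
    by (rule first_edge_degenerate[OF f z e0])
  have s: "shift 1 (Suc n) \<in> Delta (Suc n) (Suc (Suc n))" by (rule shift_in) simp
  have sn: "shift n 1 \<in> Delta 1 (Suc n)" by (rule shift_in) simp
  have x0: "extend 0 (Suc n) 1 0 codegen0 \<in> Delta (Suc (Suc n)) (Suc n)"
    using extend_in[OF active_in[OF codegen0_active(2)], of 0 "Suc n"] by simp
  have xn: "extend n 0 1 0 codegen0 \<in> Delta (Suc n) n"
    using extend_in[OF active_in[OF codegen0_active(2)], of n 0] by simp
  \<comment> \<open>The face of \<open>z\<close> that omits the first vertex recovers
    \<open>z1\<close>, so the degenerate last edge of \<open>z\<close> is also the last edge of
    \<open>z1\<close>.\<close>
  have "compose {..Suc n} (extend 0 (Suc n) 1 0 codegen0) (shift 1 (Suc n)) = delta_id (Suc n)"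
    by (auto simp: fun_eq_iff compose_def extend_def shift_def delta_id_def codegen0_def)
  then have sz: "P (Suc n) (Suc (Suc n)) (shift 1 (Suc n)) z = z1"
    unfolding z1(2) P_P[OF s x0 z1(1)] by (simp add: P_id z1(1))
  have "compose {..1} (shift 1 (Suc n)) (shift n 1) = shift (Suc n) 1"
    by (auto simp: fun_eq_iff compose_def shift_def)
  then have "P 1 (Suc n) (shift n 1) z1 = P 1 (Suc (Suc n)) (shift (Suc n) 1) z"
    unfolding sz[symmetric] P_P[OF sn s z] by simp
  then have l: "P 1 (Suc n) (shift n 1) z1 = P 1 0 codegen0 (P 0 1 (vtx 1) f)"
    using last_edge_degenerate[OF f z e1] by simp
  obtain z2 where z2: "z2 \<in> Ob n" "z1 = P (Suc n) n (extend n 0 1 0 codegen0) z2"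
    by (rule last_degenerate[OF z1(1) P_in[OF vtx_in f] l]) auto
  have "compose {..Suc (Suc n)} (extend n 0 1 0 codegen0) (extend 0 (Suc n) 1 0 codegen0) = kap n"
    by (auto simp: fun_eq_iff compose_def extend_def kap_def codegen0_def min_def)
  then have zk: "z = P (Suc (Suc n)) n (kap n) z2"
    unfolding z1(2) z2(2) P_P[OF x0 xn z2(1)] by simp
  have "P n (Suc (Suc n)) (up n) z = z2"
    unfolding zk P_P[OF up_in kap_in z2(1)] kap_up by (rule P_id[OF z2(1)])
  then show ?thesis using zk by simp
qed

text \<open>Edges of the interval out of the initial object have a degenerate first edge in
  \<open>X\<close>; \<open>?d\<close> inserts this degeneracy, and its section
  \<open>hat 0 1 (vtx 1)\<close> removes it and returns the end vertex \<open>x\<close>.\<close>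

lemma bot_edge_raw:
  assumes f: "f \<in> Ob 1" and x: "x \<in> Ob (Suc (Suc 0))" "P 1 (Suc (Suc 0)) (long (Suc (Suc 0))) x = f"
  shows "\<exists>!e. e \<in> Ob (Suc (Suc 1)) \<and> P (Suc (Suc 0)) (Suc (Suc 1)) (hat 0 1 (vtx 0)) e = P (Suc (Suc 0)) 1 (kh 0 1 (vtx 0)) f \<and>
     P (Suc (Suc 0)) (Suc (Suc 1)) (hat 0 1 (vtx 1)) e = x"
proof -
  let ?d = "extend 0 (Suc 1) 1 0 codegen0"
  have d: "?d \<in> Delta (Suc (Suc 1)) (Suc 1)"
    using extend_in[OF active_in[OF codegen0_active(2)], of 0 "Suc 1"] by simp
  have d': "?d \<in> Delta (Suc (Suc 1)) (Suc (Suc 0))" using d by simp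
  have x': "x \<in> Ob (Suc 1)" using x by simp
  have h0: "hat 0 1 (vtx 0) \<in> Delta (Suc (Suc 0)) (Suc (Suc 1))" by (intro hat_in vtx_in) simp
  have h1: "hat 0 1 (vtx 1) \<in> Delta (Suc (Suc 0)) (Suc (Suc 1))" by (intro hat_in vtx_in) simp
  have k: "kh 0 1 (vtx 0) \<in> Delta (Suc (Suc 0)) 1" by (intro kh_in vtx_in) simp
  have c1: "compose {..Suc (Suc 0)} ?d (hat 0 1 (vtx 1)) = delta_id (Suc (Suc 0))"
    by (auto simp: fun_eq_iff compose_def extend_def hat_def vtx_def delta_id_def codegen0_def le_Suc_eq)
  have c0: "compose {..Suc (Suc 0)} ?d (hat 0 1 (vtx 0)) = compose {..Suc (Suc 0)} (long (Suc (Suc 0))) (kh 0 1 (vtx 0))"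
    by (auto simp: fun_eq_iff compose_def extend_def hat_def vtx_def long_def kap_def codegen0_def le_Suc_eq)
  have p1: "P (Suc (Suc 0)) (Suc (Suc 1)) (hat 0 1 (vtx 1)) (P (Suc (Suc 1)) (Suc 1) ?d w) = w" if "w \<in> Ob (Suc 1)" for w
    unfolding P_P[OF h1 d that] c1 using P_id that by simp
  have p0: "P (Suc (Suc 0)) (Suc (Suc 1)) (hat 0 1 (vtx 0)) (P (Suc (Suc 1)) (Suc 1) ?d x) = P (Suc (Suc 0)) 1 (kh 0 1 (vtx 0)) f"
    unfolding P_P[OF h0 d x'] c0 using P_P[OF k long_in(1) x(1)] x(2) by simp
  show ?thesis
  proof (rule ex1I[of _ "P (Suc (Suc 1)) (Suc 1) ?d x"], intro conjI)
    show "P (Suc (Suc 1)) (Suc 1) ?d x \<in> Ob (Suc (Suc 1))" by (rule P_in[OF d x'])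
  next
    fix e assume e: "e \<in> Ob (Suc (Suc 1)) \<and> P (Suc (Suc 0)) (Suc (Suc 1)) (hat 0 1 (vtx 0)) e = P (Suc (Suc 0)) 1 (kh 0 1 (vtx 0)) f \<and>
     P (Suc (Suc 0)) (Suc (Suc 1)) (hat 0 1 (vtx 1)) e = x"
    obtain w where w: "w \<in> Ob (Suc 1)" "e = P (Suc (Suc 1)) (Suc 1) ?d w"
      by (rule first_edge_degenerate[OF f, of e 1]) (use e in auto)
    show "e = P (Suc (Suc 1)) (Suc 1) ?d x" using p1[OF w(1)] w e by simp
  qed (rule p0, rule p1[OF x'])
qed

lemma top_edge_raw:
  assumes f: "f \<in> Ob 1" and x: "x \<in> Ob (Suc (Suc 0))" "P 1 (Suc (Suc 0)) (long (Suc (Suc 0))) x = f"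
  shows "\<exists>!e. e \<in> Ob (Suc (Suc 1)) \<and> P (Suc (Suc 0)) (Suc (Suc 1)) (hat 0 1 (vtx 0)) e = x \<and>
     P (Suc (Suc 0)) (Suc (Suc 1)) (hat 0 1 (vtx 1)) e = P (Suc (Suc 0)) 1 (kh 0 1 (vtx 1)) f"
proof -
  let ?d = "extend (Suc 1) 0 1 0 codegen0"
  have d: "?d \<in> Delta (Suc (Suc 1)) (Suc 1)"
    using extend_in[OF active_in[OF codegen0_active(2)], of "Suc 1" 0] by simp
  have x': "x \<in> Ob (Suc 1)" using x by simp
  have h0: "hat 0 1 (vtx 0) \<in> Delta (Suc (Suc 0)) (Suc (Suc 1))" by (intro hat_in vtx_in) simp
  have h1: "hat 0 1 (vtx 1) \<in> Delta (Suc (Suc 0)) (Suc (Suc 1))" by (intro hat_in vtx_in) simp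
  have k: "kh 0 1 (vtx 1) \<in> Delta (Suc (Suc 0)) 1" by (intro kh_in vtx_in) simp
  have c0: "compose {..Suc (Suc 0)} ?d (hat 0 1 (vtx 0)) = delta_id (Suc (Suc 0))"
    by (auto simp: fun_eq_iff compose_def extend_def hat_def vtx_def delta_id_def codegen0_def le_Suc_eq)
  have c1: "compose {..Suc (Suc 0)} ?d (hat 0 1 (vtx 1)) = compose {..Suc (Suc 0)} (long (Suc (Suc 0))) (kh 0 1 (vtx 1))"
    by (auto simp: fun_eq_iff compose_def extend_def hat_def vtx_def long_def kap_def codegen0_def le_Suc_eq)
  have p0: "P (Suc (Suc 0)) (Suc (Suc 1)) (hat 0 1 (vtx 0)) (P (Suc (Suc 1)) (Suc 1) ?d w) = w" if "w \<in> Ob (Suc 1)" for w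
    unfolding P_P[OF h0 d that] c0 using P_id that by simp
  have p1: "P (Suc (Suc 0)) (Suc (Suc 1)) (hat 0 1 (vtx 1)) (P (Suc (Suc 1)) (Suc 1) ?d x) = P (Suc (Suc 0)) 1 (kh 0 1 (vtx 1)) f"
    unfolding P_P[OF h1 d x'] c1 using P_P[OF k long_in(1) x(1)] x(2) by simp
  show ?thesis
  proof (rule ex1I[of _ "P (Suc (Suc 1)) (Suc 1) ?d x"], intro conjI)
    show "P (Suc (Suc 1)) (Suc 1) ?d x \<in> Ob (Suc (Suc 1))" by (rule P_in[OF d x'])
  next
    fix e assume e: "e \<in> Ob (Suc (Suc 1)) \<and> P (Suc (Suc 0)) (Suc (Suc 1)) (hat 0 1 (vtx 0)) e = x \<and>
     P (Suc (Suc 0)) (Suc (Suc 1)) (hat 0 1 (vtx 1)) e = P (Suc (Suc 0)) 1 (kh 0 1 (vtx 1)) f"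
    have l: "P 1 (Suc (Suc 1)) (shift (Suc 1) 1) e = P 1 0 codegen0 (P 0 1 (vtx 1) f)"
      by (rule last_edge_degenerate[OF f]) (use e in auto)
    obtain w where w: "w \<in> Ob (Suc 1)" "e = P (Suc (Suc 1)) (Suc 1) ?d w"
      by (rule last_degenerate[OF _ P_in[OF vtx_in f] l]) (use e in auto)
    show "e = P (Suc (Suc 1)) (Suc 1) ?d x" using p0[OF w(1)] w e by simp
  qed (rule p0[OF x'], rule p1)
qed

end

section \<open>The interval of an edge, with simplices in the universe\<close>

locale encoded = rigid_choice X ch for X :: "('o, 'a) simplicial" and ch :: "'u choice" +
  fixes enc :: "nat \<Rightarrow> 'o \<Rightarrow> 'u"
  assumes enc_inj: "inj_on (enc n) (Obj (level X n))"
begin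

text \<open>The simplices of the intervals must lie in \<open>'u\<close>, so the objects of
  \<open>X\<close> are coded there, level by level, by \<open>enc\<close>.\<close>

definition dec :: "nat \<Rightarrow> 'u \<Rightarrow> 'o" where
  "dec n = inv_into (Ob n) (enc n)"

abbreviation "E k \<equiv> enc (Suc (Suc k))"
abbreviation "D k \<equiv> dec (Suc (Suc k))"
abbreviation "lg n x \<equiv> P 1 n (long n) x"
abbreviation "H m k p \<equiv> P (Suc (Suc m)) (Suc (Suc k)) (hat m k p)"

definition fib :: "'o \<Rightarrow> nat \<Rightarrow> 'o set" where
  "fib f k = {y \<in> Ob (Suc (Suc k)). lg (Suc (Suc k)) y = f}"

lemma fibD: "y \<in> fib f k \<Longrightarrow> y \<in> Ob (Suc (Suc k))" "y \<in> fib f k \<Longrightarrow> lg (Suc (Suc k)) y = f"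
  by (auto simp: fib_def)

lemma fibI: "y \<in> Ob (Suc (Suc k)) \<Longrightarrow> lg (Suc (Suc k)) y = f \<Longrightarrow> y \<in> fib f k"
  by (auto simp: fib_def)

lemma D_E: "y \<in> fib f k \<Longrightarrow> D k (E k y) = y"
  unfolding dec_def by (rule inv_into_f_f[OF enc_inj fibD(1)])

lemma E_eq: "y \<in> fib f k \<Longrightarrow> z \<in> fib f' k \<Longrightarrow> E k y = E k z \<longleftrightarrow> y = z"
  using D_E by metis

lemma fib_H: "p \<in> Delta m k \<Longrightarrow> y \<in> fib f k \<Longrightarrow> H m k p y \<in> fib f m"
  by (rule fibI[OF P_in[OF hat_in fibD(1)]]) (simp_all only: long_long[OF hat_active fibD(1)] fibD(2))

lemma fib_active: "active (Suc (Suc k)) n p \<Longrightarrow> x \<in> Ob n \<Longrightarrow> P (Suc (Suc k)) n p x \<in> fib (lg n x) k"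
  by (rule fibI[OF P_in[OF active_in]]) (simp_all only: long_long)

lemma lg_1: "f \<in> Ob 1 \<Longrightarrow> lg 1 f = f"
  using P_id by (simp add: long_1)

text \<open>The end points are the degenerate \<open>2\<close>-simplices \<open>(0, 0, 1)\<close>
  and \<open>(0, 1, 1)\<close> of \<open>f\<close>. The action decodes, applies \<open>hat\<close>
  in \<open>X\<close> and encodes again; its default values are those demanded by
  \<open>simplicial_set\<close>.\<close>

definition Iv :: "'o \<Rightarrow> 'u interval" where
  "Iv f = \<lparr>simps = (\<lambda>k. E k ` fib f k),
     act = (\<lambda>m k p. if p \<in> Delta m k then (\<lambda>u\<in>E k ` fib f k. E m (H m k p (D k u))) else (\<lambda>_. undefined)),
     Bot = E 0 (P (Suc (Suc 0)) 1 (kh 0 1 (vtx 0)) f),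
     Top = E 0 (P (Suc (Suc 0)) 1 (kh 0 1 (vtx 1)) f)\<rparr>"

lemma Iv_simps [simp]: "simps (Iv f) k = E k ` fib f k"
  by (simp add: Iv_def)

lemma Iv_bot: "Bot (Iv f) = E 0 (P (Suc (Suc 0)) 1 (kh 0 1 (vtx 0)) f)"
  "Top (Iv f) = E 0 (P (Suc (Suc 0)) 1 (kh 0 1 (vtx 1)) f)"
  by (simp_all add: Iv_def)

lemma Iv_act: "p \<in> Delta m k \<Longrightarrow> y \<in> fib f k \<Longrightarrow> act (Iv f) m k p (E k y) = E m (H m k p y)"
  by (simp add: Iv_def D_E)

lemma H_H: "q \<in> Delta l m \<Longrightarrow> p \<in> Delta m k \<Longrightarrow> y \<in> Ob (Suc (Suc k)) \<Longrightarrow> H l m q (H m k p y) = H l k (compose {..l} p q) y"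
  by (simp only: P_P[OF hat_in hat_in] hat_hat)

lemma Iv_set: "simplicial_set (Iv f)"
  unfolding simplicial_set_def
proof (intro conjI allI ballI impI)
  fix m n p assume p: "p \<in> Delta m n"
  show "act (Iv f) m n p \<in> simps (Iv f) n \<rightarrow>\<^sub>E simps (Iv f) m"
    using p fib_H[OF p] by (auto simp: Iv_def D_E)
next
  fix m n p assume "p \<notin> Delta m n"
  then show "act (Iv f) m n p = (\<lambda>_. undefined)" by (simp add: Iv_def)
next
  fix n x assume "x \<in> simps (Iv f) n"
  then obtain y where y: "y \<in> fib f n" "x = E n y" by auto
  show "act (Iv f) n n (delta_id n) x = x"
    unfolding y(2) Iv_act[OF delta_id_in y(1)] hat_id P_id[OF fibD(1)[OF y(1)]] ..
next
  fix l m n q p x assume q: "q \<in> Delta l m" and p: "p \<in> Delta m n" and "x \<in> simps (Iv f) n"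
  then obtain y where y: "y \<in> fib f n" "x = E n y" by auto
  show "act (Iv f) l n (compose {..l} p q) x = act (Iv f) l m q (act (Iv f) m n p x)"
    unfolding y(2) Iv_act[OF p y(1)] Iv_act[OF q fib_H[OF p y(1)]] Iv_act[OF Delta_comp[OF q p] y(1)]
      H_H[OF q p fibD(1)[OF y(1)]] ..
qed

lemma ex1_enc:
  assumes "\<exists>!y. y \<in> fib f k \<and> R y" "\<And>y. y \<in> fib f k \<Longrightarrow> R' (E k y) \<longleftrightarrow> R y"
  shows "\<exists>!u. u \<in> E k ` fib f k \<and> R' u"
proof -
  obtain y where y: "y \<in> fib f k" "R y" "\<And>z. z \<in> fib f k \<Longrightarrow> R z \<Longrightarrow> z = y" using assms(1) by blast
  show ?thesis
  proof (rule ex1I[of _ "E k y"])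
    show "E k y \<in> E k ` fib f k \<and> R' (E k y)" using y(1,2) assms(2)[OF y(1)] by blast
    fix u assume u: "u \<in> E k ` fib f k \<and> R' u"
    then obtain z where z: "z \<in> fib f k" "u = E k z" by blast
    have "R z" using u assms(2)[OF z(1)] z(2) by simp
    then show "u = E k y" using y(3)[OF z(1)] z(2) by simp
  qed
qed

lemma ex1_fib:
  assumes "\<exists>!z. z \<in> Ob (Suc (Suc k)) \<and> R z" "\<And>z. z \<in> Ob (Suc (Suc k)) \<Longrightarrow> R z \<Longrightarrow> z \<in> fib f k"
  shows "\<exists>!z. z \<in> fib f k \<and> R z"
  using assms fibD(1) by blast

lemma Iv_segal: "strict_segal (Iv f)"
proof (rule segalI[OF Iv_set])
  fix n x e assume x: "x \<in> simps (Iv f) (Suc n)" and e: "e \<in> simps (Iv f) 1"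
    and v: "act (Iv f) 0 (Suc n) (vtx (Suc n)) x = act (Iv f) 0 1 (vtx 0) e"
  obtain y where y: "y \<in> fib f (Suc n)" "x = E (Suc n) y" using x by auto
  obtain d where d: "d \<in> fib f 1" "e = E 1 d" using e by auto
  have v1: "vtx (Suc n) \<in> Delta 0 (Suc n)" "vtx 0 \<in> Delta 0 1" by (rule vtx_in, simp)+
  have "H 0 (Suc n) (vtx (Suc n)) y = H 0 1 (vtx 0) d"
    using v unfolding y(2) d(2) Iv_act[OF v1(1) y(1)] Iv_act[OF v1(2) d(1)]
      E_eq[OF fib_H[OF v1(1) y(1)] fib_H[OF v1(2) d(1)]] .
  from glue_ex1[OF fibD(1)[OF y(1)] fibD(1)[OF d(1)] this]
  have ex: "\<exists>!z. z \<in> Ob (Suc (Suc (Suc (Suc n)))) \<and> H (Suc n) (Suc (Suc n)) (init (Suc n)) z = y \<and> H 1 (Suc (Suc n)) (edg (Suc n)) z = d" .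
  have ei: "edg (Suc n) \<in> Delta 1 (Suc (Suc n))" by (rule edg_in(1)) simp
  have zf: "z \<in> fib f (Suc (Suc n))" if "z \<in> Ob (Suc (Suc (Suc (Suc n))))" "H (Suc n) (Suc (Suc n)) (init (Suc n)) z = y" for z
    using long_long[OF hat_active[OF init_in] that(1)] that(2) fibD(2)[OF y(1)] by (intro fibI[OF that(1)]) simp
  have "\<exists>!z. z \<in> fib f (Suc (Suc n)) \<and> H (Suc n) (Suc (Suc n)) (init (Suc n)) z = y \<and> H 1 (Suc (Suc n)) (edg (Suc n)) z = d"
    by (rule ex1_fib[OF ex]) (elim conjE, rule zf)
  then show "\<exists>!z. z \<in> simps (Iv f) (Suc (Suc n)) \<and> act (Iv f) (Suc n) (Suc (Suc n)) (init (Suc n)) z = x \<and> act (Iv f) 1 (Suc (Suc n)) (edg (Suc n)) z = e"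
    unfolding Iv_simps
    by (rule ex1_enc) (simp only: Iv_act[OF init_in] Iv_act[OF ei] y(2) d(2) E_eq[OF fib_H[OF init_in] y(1)] E_eq[OF fib_H[OF ei] d(1)])
qed

lemma Iv_dai:
  assumes f: "f \<in> Ob 1"
  shows "discrete_algebraic_interval (Iv f)"
proof -
  have v: "vtx 0 \<in> Delta 0 1" "vtx 1 \<in> Delta 0 1" by (rule vtx_in, simp)+
  have b: "P (Suc (Suc 0)) 1 (kh 0 1 (vtx 0)) f \<in> fib f 0" "P (Suc (Suc 0)) 1 (kh 0 1 (vtx 1)) f \<in> fib f 0"
    using fib_active[OF kh_active[OF v(1)] f] fib_active[OF kh_active[OF v(2)] f] lg_1[OF f] by simp_all
  have Hin: "H 0 1 (vtx 0) e \<in> fib f 0" "H 0 1 (vtx 1) e \<in> fib f 0" if "e \<in> fib f 1" for e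
    using fib_H[OF v(1) that] fib_H[OF v(2) that] by blast+
  have e: "e \<in> fib f 1" if "e \<in> Ob (Suc (Suc 1))" "H 0 1 (vtx i) e = x" "x \<in> fib f 0" "i \<le> 1" for e i x
    using long_long[OF hat_active[OF vtx_in[OF that(4)]] that(1)] that(2) fibD(2)[OF that(3)]
    by (intro fibI[OF that(1)]) simp
  have 1: "\<exists>!e. e \<in> E 1 ` fib f 1 \<and> act (Iv f) 0 1 (vtx 0) e = Bot (Iv f) \<and> act (Iv f) 0 1 (vtx 1) e = E 0 x" if x: "x \<in> fib f 0" for x
  proof (rule ex1_enc)
    show "\<exists>!e. e \<in> fib f 1 \<and> H 0 1 (vtx 0) e = P (Suc (Suc 0)) 1 (kh 0 1 (vtx 0)) f \<and> H 0 1 (vtx 1) e = x"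
      by (rule ex1_fib[OF bot_edge_raw[OF f fibD[OF x]]]) (elim conjE, rule e[OF _ _ x le_refl])
  qed (simp only: Iv_act[OF v(1)] Iv_act[OF v(2)] Iv_bot E_eq[OF Hin(1) b(1)] E_eq[OF Hin(2) x])
  have 2: "\<exists>!e. e \<in> E 1 ` fib f 1 \<and> act (Iv f) 0 1 (vtx 0) e = E 0 x \<and> act (Iv f) 0 1 (vtx 1) e = Top (Iv f)" if x: "x \<in> fib f 0" for x
  proof (rule ex1_enc)
    show "\<exists>!e. e \<in> fib f 1 \<and> H 0 1 (vtx 0) e = x \<and> H 0 1 (vtx 1) e = P (Suc (Suc 0)) 1 (kh 0 1 (vtx 1)) f"
      by (rule ex1_fib[OF top_edge_raw[OF f fibD[OF x]]]) (elim conjE, rule e[OF _ _ x le0])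
  qed (simp only: Iv_act[OF v(1)] Iv_act[OF v(2)] Iv_bot E_eq[OF Hin(1) x] E_eq[OF Hin(2) b(2)])
  show ?thesis
    unfolding discrete_algebraic_interval_def coface_vtx
  proof (intro conjI ballI)
    show "Bot (Iv f) \<in> simps (Iv f) 0" "Top (Iv f) \<in> simps (Iv f) 0"
      unfolding Iv_bot Iv_simps by (rule imageI[OF b(1)], rule imageI[OF b(2)])
    fix x assume "x \<in> simps (Iv f) 0"
    then obtain y where y: "y \<in> fib f 0" "x = E 0 y" by auto
    show "\<exists>!e. e \<in> simps (Iv f) 1 \<and> act (Iv f) 0 1 (vtx 0) e = Bot (Iv f) \<and> act (Iv f) 0 1 (vtx 1) e = x"
      unfolding y(2) Iv_simps by (rule 1[OF y(1)])
    show "\<exists>!e. e \<in> simps (Iv f) 1 \<and> act (Iv f) 0 1 (vtx 0) e = x \<and> act (Iv f) 0 1 (vtx 1) e = Top (Iv f)"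
      unfolding y(2) Iv_simps by (rule 2[OF y(1)])
  qed (rule Iv_set, rule Iv_segal)
qed

text \<open>The canonical subdivision of the interval of the long edge of \<open>x\<close>. The
  vertex \<open>i\<close> of \<open>[n]\<close> goes to the \<open>2\<close>-simplex
  \<open>(0, i, n)\<close> of \<open>x\<close>; in general the ends \<open>0\<close> and
  \<open>n\<close> are added to \<open>q\<close>.\<close>

definition can :: "nat \<Rightarrow> 'o \<Rightarrow> nat \<Rightarrow> (nat \<Rightarrow> nat) \<Rightarrow> 'u" where
  "can n x = (\<lambda>k. \<lambda>q\<in>Delta k n. E k (P (Suc (Suc k)) n (kh k n q) x))"

lemma can_apply: "q \<in> Delta k n \<Longrightarrow> can n x k q = E k (P (Suc (Suc k)) n (kh k n q) x)"
  by (simp add: can_def)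

lemma kh_fib: "q \<in> Delta k n \<Longrightarrow> x \<in> Ob n \<Longrightarrow> P (Suc (Suc k)) n (kh k n q) x \<in> fib (lg n x) k"
  by (rule fib_active[OF kh_active])

lemma H_kh: "q \<in> Delta j k \<Longrightarrow> p \<in> Delta k n \<Longrightarrow> x \<in> Ob n \<Longrightarrow>
   H j k q (P (Suc (Suc k)) n (kh k n p) x) = P (Suc (Suc j)) n (kh j n (compose {..j} p q)) x"
  by (simp only: P_P[OF hat_in kh_in] kh_hat)

lemma can_obj:
  assumes x: "x \<in> Ob n"
  shows "(Iv (lg n x), can n x) \<in> U_obj n"
proof (rule U_objI[OF Iv_dai[OF P_in[OF long_in(1) x]]])
  show "simplicial_map (std_simplex n) (Iv (lg n x)) (can n x)"
    unfolding simplicial_map_def std_simps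
  proof (intro conjI allI ballI)
    fix k show "can n x k \<in> Delta k n \<rightarrow>\<^sub>E simps (Iv (lg n x)) k"
      using kh_fib[OF _ x] by (auto simp: can_def)
    fix m q p assume q: "q \<in> Delta m k" and p: "p \<in> Delta k n"
    show "can n x m (act (std_simplex n) m k q p) = act (Iv (lg n x)) m k q (can n x k p)"
      unfolding std_act[OF q p] can_apply[OF Delta_comp[OF q p]] can_apply[OF p] Iv_act[OF q kh_fib[OF p x]] H_kh[OF q p x] ..
  qed
  have "P (Suc (Suc 0)) 1 (kh 0 1 (vtx i)) (lg n x) = P (Suc (Suc 0)) n (kh 0 n (vtx (long n i))) x" if i: "i \<le> 1" for i
    unfolding P_P[OF kh_in[OF vtx_in[OF i]] long_in(1) x] active_kh[OF long_active(1) vtx_in[OF i]] comp_vtx ..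
  from this[of 0] this[of 1] show "can n x 0 (vtx 0) = Bot (Iv (lg n x))" "can n x 0 (vtx n) = Top (Iv (lg n x))"
    unfolding Iv_bot by (simp_all add: can_apply vtx_in long_val)
qed

text \<open>Adding the ends commutes with an active map, because such a map preserves them.\<close>

lemma can_active:
  assumes p: "active m n p" and x: "x \<in> Ob n"
  shows "can m (P m n p x) = res m n p (can n x)"
proof (rule map_eqI)
  note x' = P_in[OF active_in[OF p] x]
  show "simplicial_map (std_simplex m) (Iv (lg m (P m n p x))) (can m (P m n p x))" by (rule U_objD(3)[OF can_obj[OF x']])
  show "simplicial_map (std_simplex m) (Iv (lg n x)) (res m n p (can n x))"
    by (rule res_map[OF active_in[OF p] U_objD(3)[OF can_obj[OF x]]])
  fix k q assume "q \<in> simps (std_simplex m) k"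
  then have q: "q \<in> Delta k m" by simp
  show "can m (P m n p x) k q = res m n p (can n x) k q"
    unfolding can_apply[OF q] res_apply[OF q] can_apply[OF Delta_comp[OF q active_in[OF p]]]
      P_P[OF kh_in[OF q] active_in[OF p] x] active_kh[OF p q] ..
qed

subsection \<open>Transport along arrows\<close>

definition mv :: "'a \<Rightarrow> nat \<Rightarrow> 'o \<Rightarrow> 'o" where
  "mv \<phi> k y = Tgt (level X (Suc (Suc k))) (THE g. g \<in> Ar (Suc (Suc k)) \<and> Src (level X (Suc (Suc k))) g = y \<and>
      Q 1 (Suc (Suc k)) (long (Suc (Suc k))) g = \<phi>)"

definition jm :: "'a \<Rightarrow> 'u smap" where
  "jm \<phi> = (\<lambda>k. \<lambda>u\<in>E k ` fib (Src (level X 1) \<phi>) k. E k (mv \<phi> k (D k u)))"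

lemma lift_fib:
  assumes \<phi>: "\<phi> \<in> hom (level X 1) f f'" and y: "y \<in> fib f k"
  obtains g y' where "g \<in> hom (level X (Suc (Suc k))) y y'" "Q 1 (Suc (Suc k)) (long (Suc (Suc k))) g = \<phi>" "y' \<in> fib f' k"
proof -
  let ?k = "Suc (Suc k)"
  have a: "\<phi> \<in> Ar 1" "Src (level X 1) \<phi> = lg ?k y" "Tgt (level X 1) \<phi> = f'" using \<phi> fibD[OF y] by (auto simp: hom_def)
  from lift_src[OF fibD(1)[OF y] a(1,2)] obtain g where g: "g \<in> Ar ?k" "Src (level X ?k) g = y" "Q 1 ?k (long ?k) g = \<phi>" by blast
  have gh: "g \<in> hom (level X ?k) y (Tgt (level X ?k) g)" using g by (simp add: hom_def)
  have "Tgt (level X ?k) g \<in> fib f' k"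
    by (rule fibI[OF conjunct2[OF arr_ob[OF gh]]]) (use Q_tgt[OF long_in(1) g(1)] g(3) a(3) in simp)
  with gh g(3) that show ?thesis by blast
qed

lemma jm_apply:
  assumes g: "g \<in> hom (level X (Suc (Suc k))) y y'" "Q 1 (Suc (Suc k)) (long (Suc (Suc k))) g = \<phi>"
  shows "jm \<phi> k (E k y) = E k y'"
proof -
  let ?k = "Suc (Suc k)"
  have a: "g \<in> Ar ?k" "Src (level X ?k) g = y" "Tgt (level X ?k) g = y'" using g by (auto simp: hom_def)
  have y: "y \<in> Ob ?k" using arr_ob[OF g(1)] by simp
  have s: "Src (level X 1) \<phi> = lg ?k y" using Q_src[OF long_in(1) a(1)] g(2) a(2) by simp
  have yf: "y \<in> fib (Src (level X 1) \<phi>) k" by (rule fibI[OF y s[symmetric]])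
  have \<phi>: "\<phi> \<in> Ar 1" using Q_in[OF long_in(1) a(1)] g(2) by simp
  have "(THE g. g \<in> Ar ?k \<and> Src (level X ?k) g = y \<and> Q 1 ?k (long ?k) g = \<phi>) = g"
    by (rule the1_equality[OF lift_src[OF y \<phi> s]]) (use a g in simp)
  then have "mv \<phi> k y = y'" unfolding mv_def using a by simp
  then show ?thesis unfolding jm_def using yf by (simp add: D_E)
qed

text \<open>Pulling a lift back along \<open>hat\<close> leaves its long edge unchanged, so the
  image of a lift is again a lift of \<open>\<phi>\<close>; as lifts are unique, it computes
  \<open>jm\<close>.\<close>

lemma jm_map:
  assumes \<phi>: "\<phi> \<in> hom (level X 1) f f'"
  shows "simplicial_map (Iv f) (Iv f') (jm \<phi>)"
  unfolding simplicial_map_def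
proof (intro conjI allI ballI)
  have s: "Src (level X 1) \<phi> = f" using \<phi> by (simp add: hom_def)
  fix n
  show "jm \<phi> n \<in> simps (Iv f) n \<rightarrow>\<^sub>E simps (Iv f') n"
  proof
    fix u assume "u \<in> simps (Iv f) n"
    then obtain y where y: "y \<in> fib f n" "u = E n y" by auto
    obtain g y' where g: "g \<in> hom (level X (Suc (Suc n))) y y'" "Q 1 (Suc (Suc n)) (long (Suc (Suc n))) g = \<phi>" "y' \<in> fib f' n"
      by (rule lift_fib[OF \<phi> y(1)])
    show "jm \<phi> n u \<in> simps (Iv f') n" using jm_apply[OF g(1,2)] g(3) y(2) by simp
  next
    fix u assume "u \<notin> simps (Iv f) n"
    then show "jm \<phi> n u = undefined" using s by (simp add: jm_def)
  qed
next
  fix m n p u assume p: "p \<in> Delta m n" and "u \<in> simps (Iv f) n"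
  then obtain y where y: "y \<in> fib f n" "u = E n y" by auto
  obtain g y' where g: "g \<in> hom (level X (Suc (Suc n))) y y'" "Q 1 (Suc (Suc n)) (long (Suc (Suc n))) g = \<phi>" "y' \<in> fib f' n"
    by (rule lift_fib[OF \<phi> y(1)])
  let ?g = "Q (Suc (Suc m)) (Suc (Suc n)) (hat m n p) g"
  have g': "?g \<in> hom (level X (Suc (Suc m))) (H m n p y) (H m n p y')" by (rule Q_hom[OF hat_in[OF p] g(1)])
  have "Q 1 (Suc (Suc m)) (long (Suc (Suc m))) ?g = \<phi>"
    using Q_Q[OF long_in(1) hat_in[OF p], of g] g(1,2) active_long(1)[OF hat_active[OF p]] by (simp add: hom_def)
  then show "jm \<phi> m (act (Iv f) m n p u) = act (Iv f') m n p (jm \<phi> n u)"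
    unfolding y(2) Iv_act[OF p y(1)] jm_apply[OF g(1,2)] Iv_act[OF p g(3)] by (rule jm_apply[OF g'])
qed

lemma jm_comp:
  assumes \<phi>: "\<phi> \<in> hom (level X 1) f f'" and \<psi>: "\<psi> \<in> hom (level X 1) f' f''"
  shows "simp_comp (Iv f) (jm \<psi>) (jm \<phi>) = jm (Comp (level X 1) \<psi> \<phi>)"
proof (rule map_eqI[OF map_comp[OF jm_map[OF \<phi>] jm_map[OF \<psi>] Iv_set] jm_map[OF cat_comp[OF cat \<phi> \<psi>]]])
  fix n u assume "u \<in> simps (Iv f) n"
  then obtain y where y: "y \<in> fib f n" "u = E n y" by auto
  obtain g y' where g: "g \<in> hom (level X (Suc (Suc n))) y y'" "Q 1 (Suc (Suc n)) (long (Suc (Suc n))) g = \<phi>" "y' \<in> fib f' n"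
    by (rule lift_fib[OF \<phi> y(1)])
  obtain h y'' where h: "h \<in> hom (level X (Suc (Suc n))) y' y''" "Q 1 (Suc (Suc n)) (long (Suc (Suc n))) h = \<psi>" "y'' \<in> fib f'' n"
    by (rule lift_fib[OF \<psi> g(3)])
  have "jm (Comp (level X 1) \<psi> \<phi>) n (E n y) = E n y''"
    by (rule jm_apply[OF cat_comp[OF cat g(1) h(1)]]) (simp only: Q_comp[OF long_in(1) g(1) h(1)] g(2) h(2))
  then show "simp_comp (Iv f) (jm \<psi>) (jm \<phi>) n u = jm (Comp (level X 1) \<psi> \<phi>) n u"
    using y jm_apply[OF g(1,2)] jm_apply[OF h(1,2)] by (simp add: simp_comp_apply)
qed

lemma jm_unit:
  assumes f: "f \<in> Ob 1"
  shows "jm (Unit (level X 1) f) = simp_id (Iv f)"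
proof (rule map_eqI[OF jm_map[OF cat_unit[OF cat f]] map_id[OF Iv_set]])
  fix n u assume u: "u \<in> simps (Iv f) n"
  then obtain y where y: "y \<in> fib f n" "u = E n y" by auto
  have "jm (Unit (level X 1) f) n (E n y) = E n y"
    by (rule jm_apply[OF cat_unit[OF cat fibD(1)[OF y(1)]]])
      (simp only: Q_unit[OF long_in(1) fibD(1)[OF y(1)]] fibD(2)[OF y(1)])
  then show "jm (Unit (level X 1) f) n u = simp_id (Iv f) n u" using y u by (simp add: simp_id_apply)
qed

lemma jm_iso:
  assumes \<phi>: "\<phi> \<in> hom (level X 1) f f'"
  shows "simplicial_iso (Iv f) (Iv f') (jm \<phi>)"
proof -
  obtain \<psi> where \<psi>: "\<psi> \<in> hom (level X 1) f' f" "Comp (level X 1) \<psi> \<phi> = Unit (level X 1) f" "Comp (level X 1) \<phi> \<psi> = Unit (level X 1) f'"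
    by (rule arr_inv[OF \<phi>])
  show ?thesis
    by (rule isoI[OF jm_map[OF \<phi>] jm_map[OF \<psi>(1)]])
      (use \<psi> arr_ob[OF \<phi>] in \<open>simp_all only: jm_comp[OF \<phi> \<psi>(1)] jm_comp[OF \<psi>(1) \<phi>] jm_unit\<close>)
qed

text \<open>The pullback of \<open>\<phi>\<close> along \<open>q\<close> with the ends added is
  itself the lift that computes \<open>jm\<close>.\<close>

lemma jm_can:
  assumes \<phi>: "\<phi> \<in> hom (level X n) x x'" and q: "q \<in> Delta k n"
  shows "jm (Q 1 n (long n) \<phi>) k (can n x k q) = can n x' k q"
  unfolding can_apply[OF q]
proof (rule jm_apply[OF Q_hom[OF kh_in[OF q] \<phi>]])
  have "\<phi> \<in> Ar n" using \<phi> by (simp add: hom_def)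
  then show "Q 1 (Suc (Suc k)) (long (Suc (Suc k))) (Q (Suc (Suc k)) n (kh k n q) \<phi>) = Q 1 n (long n) \<phi>"
    by (simp only: Q_Q[OF long_in(1) kh_in[OF q]] active_long(1)[OF kh_active[OF q]])
qed

lemma jm_arr:
  assumes \<phi>: "\<phi> \<in> hom (level X n) x x'"
  shows "((Iv (lg n x), can n x), (Iv (lg n x'), can n x'), jm (Q 1 n (long n) \<phi>)) \<in> U_arr n"
  using arr_ob[OF \<phi>]
  by (intro U_arrI can_obj jm_iso Q_hom[OF long_in(1) \<phi>] jm_can[OF \<phi>]) auto

subsection \<open>Insertion of simplices\<close>

text \<open>\<open>Y\<close> is \<open>y\<close> inserted into the middle edge of the \<open>3\<close>-simplex \<open>(0, p 0, p m, n)\<close> of \<open>x\<close>.\<close>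

definition isins :: "nat \<Rightarrow> nat \<Rightarrow> (nat \<Rightarrow> nat) \<Rightarrow> 'o \<Rightarrow> nat \<Rightarrow> 'o \<Rightarrow> 'o \<Rightarrow> bool" where
  "isins m n p x k y Y \<longleftrightarrow> Y \<in> Ob (Suc (Suc (Suc (Suc k)))) \<and>
     P (Suc (Suc k)) (Suc (Suc (Suc (Suc k)))) (up (Suc (Suc k))) Y = y \<and>
     H 1 (Suc (Suc k)) (long (Suc (Suc k))) Y = P (Suc (Suc 1)) n (kh 1 n (compose {..1} p (long m))) x"

text \<open>Deletes the second and the second to last vertex. In an insertion into \<open>x\<close>
  these are \<open>p 0\<close> and \<open>p m\<close>, so a simplex over the long edge of
  \<open>x\<close> remains.\<close>

abbreviation "out k Y \<equiv> H k (Suc (Suc k)) (up k) Y"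

lemma isins_ex1:
  assumes p: "p \<in> Delta m n" and x: "x \<in> Ob n" and y: "y \<in> fib (lg m (P m n p x)) k"
  shows "\<exists>!Y. isins m n p x k y Y"
  unfolding isins_def by (rule insert_ex1[OF p x fibD[OF y]])

lemma isins_long:
  assumes p: "p \<in> Delta m n" and x: "x \<in> Ob n" and Y: "isins m n p x k y Y"
  shows "lg (Suc (Suc (Suc (Suc k)))) Y = lg n x"
proof -
  have pl: "compose {..1} p (long m) \<in> Delta 1 n" by (rule Delta_comp[OF long_in(1) p])
  have Y': "Y \<in> Ob (Suc (Suc (Suc (Suc k))))" using Y by (simp add: isins_def)
  show ?thesis
    using long_long[OF hat_active[OF long_in(1)] Y'] long_long[OF kh_active[OF pl] x] Y unfolding isins_def by simp
qed

lemma out_fib: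
  assumes p: "p \<in> Delta m n" and x: "x \<in> Ob n" and Y: "isins m n p x k y Y"
  shows "out k Y \<in> fib (lg n x) k"
proof -
  have "Y \<in> fib (lg n x) (Suc (Suc k))"
    using isins_long[OF p x Y] Y by (auto simp: isins_def intro: fibI)
  then show ?thesis by (rule fib_H[OF up_in])
qed

text \<open>The iterated \<open>hat\<close> fixes both the outermost vertices and the ends of
  \<open>y\<close>, so the part that comes from \<open>x\<close> stays untouched.\<close>

lemma isins_act:
  assumes Y: "isins m n p x k y Y" and q: "q \<in> Delta j k"
  shows "isins m n p x j (H j k q y) (H (Suc (Suc j)) (Suc (Suc k)) (hat j k q) Y)"
    "out j (H (Suc (Suc j)) (Suc (Suc k)) (hat j k q) Y) = H j k q (out k Y)"
proof -
  have Y': "Y \<in> Ob (Suc (Suc (Suc (Suc k))))" 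
     "P (Suc (Suc k)) (Suc (Suc (Suc (Suc k)))) (up (Suc (Suc k))) Y = y"
     "H 1 (Suc (Suc k)) (long (Suc (Suc k))) Y = P (Suc (Suc 1)) n (kh 1 n (compose {..1} p (long m))) x"
    using Y by (auto simp: isins_def)
  note h = hat_in[OF q] and hh = hat_in[OF hat_in[OF q]]
  show "isins m n p x j (H j k q y) (H (Suc (Suc j)) (Suc (Suc k)) (hat j k q) Y)"
    unfolding isins_def
  proof (intro conjI)
    show "H (Suc (Suc j)) (Suc (Suc k)) (hat j k q) Y \<in> Ob (Suc (Suc (Suc (Suc j))))" by (rule P_in[OF hh Y'(1)])
    show "P (Suc (Suc j)) (Suc (Suc (Suc (Suc j)))) (up (Suc (Suc j))) (H (Suc (Suc j)) (Suc (Suc k)) (hat j k q) Y) = H j k q y"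
      unfolding P_P[OF up_in hh Y'(1)] hat_up[OF h] Y'(2)[symmetric] P_P[OF h up_in Y'(1)] ..
    show "H 1 (Suc (Suc j)) (long (Suc (Suc j))) (H (Suc (Suc j)) (Suc (Suc k)) (hat j k q) Y) =
       P (Suc (Suc 1)) n (kh 1 n (compose {..1} p (long m))) x"
      unfolding H_H[OF long_in(1) h Y'(1)] active_long(1)[OF hat_active[OF q]] by (rule Y'(3))
  qed
  show "out j (H (Suc (Suc j)) (Suc (Suc k)) (hat j k q) Y) = H j k q (out k Y)"
    unfolding H_H[OF up_in h Y'(1)] H_H[OF q up_in Y'(1)] hat_up[OF q] ..
qed

text \<open>If \<open>y\<close> is already cut out of \<open>x\<close>, its insertion can be formed
  inside \<open>x\<close> by adding the vertices \<open>0\<close> and \<open>n\<close>.\<close>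

lemma isins_can:
  assumes p: "p \<in> Delta m n" and x: "x \<in> Ob n" and r: "r \<in> Delta k m"
  shows "isins m n p x k (P (Suc (Suc k)) m (kh k m r) (P m n p x))
      (P (Suc (Suc (Suc (Suc k)))) n (kh (Suc (Suc k)) n (compose {..Suc (Suc k)} p (kh k m r))) x)"
    "out k (P (Suc (Suc (Suc (Suc k)))) n (kh (Suc (Suc k)) n (compose {..Suc (Suc k)} p (kh k m r))) x) =
      P (Suc (Suc k)) n (kh k n (compose {..k} p r)) x"
proof -
  let ?g = "compose {..Suc (Suc k)} p (kh k m r)"
  have g: "?g \<in> Delta (Suc (Suc k)) n" by (rule Delta_comp[OF kh_in[OF r] p])
  have gl: "compose {..1} ?g (long (Suc (Suc k))) = compose {..1} p (long m)"
    by (simp only: Delta_assoc[OF long_in(1), where p=p and q="kh k m r", symmetric] active_long(1)[OF kh_active[OF r]])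
  have gu: "compose {..k} ?g (up k) = compose {..k} p r"
    by (simp only: Delta_assoc[OF up_in, where p=p and q="kh k m r", symmetric] kap_hat_up_gen[OF r])
  show "isins m n p x k (P (Suc (Suc k)) m (kh k m r) (P m n p x))
      (P (Suc (Suc (Suc (Suc k)))) n (kh (Suc (Suc k)) n ?g) x)"
    unfolding isins_def P_P[OF up_in kh_in[OF g] x] kap_hat_up_gen[OF g] P_P[OF kh_in[OF r] p x]
      H_kh[OF long_in(1) g x] gl
    using P_in[OF kh_in[OF g] x] by simp
  show "out k (P (Suc (Suc (Suc (Suc k)))) n (kh (Suc (Suc k)) n ?g) x) = P (Suc (Suc k)) n (kh k n (compose {..k} p r)) x"
    unfolding H_kh[OF up_in g x] gu ..
qed

text \<open>For active \<open>p\<close> the ends \<open>p 0\<close> and \<open>p m\<close> are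
  \<open>0\<close> and \<open>n\<close>, so the outer edges of the \<open>3\<close>-simplex are
  degenerate, and doubling the ends of \<open>y\<close> is already the insertion.\<close>

lemma isins_active:
  assumes p: "active m n p" and x: "x \<in> Ob n" and y: "y \<in> fib (lg n x) k"
  shows "isins m n p x k y (P (Suc (Suc (Suc (Suc k)))) (Suc (Suc k)) (kap (Suc (Suc k))) y)"
    "out k (P (Suc (Suc (Suc (Suc k)))) (Suc (Suc k)) (kap (Suc (Suc k))) y) = y"
proof -
  let ?k = "Suc (Suc k)"
  note y' = fibD(1)[OF y]
  have "H 1 ?k (long ?k) (P (Suc (Suc ?k)) ?k (kap ?k) y) = P (Suc (Suc 1)) 1 (kap 1) (lg ?k y)"
    unfolding P_P[OF hat_in[OF long_in(1)] kap_in y'] P_P[OF kap_in long_in(1) y'] kap_hat[OF long_active(1)] ..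
  also have "\<dots> = P (Suc (Suc 1)) n (kh 1 n (compose {..1} p (long m))) x"
    unfolding fibD(2)[OF y] P_P[OF kap_in long_in(1) x] active_long(1)[OF p] kap_hat[OF long_active(1)] ..
  finally show "isins m n p x k y (P (Suc (Suc ?k)) ?k (kap ?k) y)"
    unfolding isins_def P_P[OF up_in kap_in y'] kap_up P_id[OF y'] using P_in[OF kap_in y'] by simp
  show "out k (P (Suc (Suc ?k)) ?k (kap ?k) y) = y"
    unfolding P_P[OF hat_in[OF up_in] kap_in y'] kap_hat_up by (rule P_id[OF y'])
qed

text \<open>Associativity of insertion. Inserting all of \<open>Y\<close> into \<open>x\<close>
  gives \<open>Z\<close>, which carries the vertices \<open>p 0\<close>, \<open>p (q 0)\<close>,
  \<open>p (q l)\<close> and \<open>p m\<close>. Deleting the inner pair gives \<open>Yp\<close>,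
  deleting the outer pair gives \<open>Y'\<close>, and deleting all four gives the common
  result.\<close>

lemma isins_comp:
  assumes q: "q \<in> Delta l m" and p: "p \<in> Delta m n" and x: "x \<in> Ob n"
    and Y: "isins l m q (P m n p x) k y Y"
  obtains Yp Y' where "isins m n p x k (out k Y) Yp" "isins l n (compose {..l} p q) x k y Y'" "out k Yp = out k Y'"
proof -
  let ?k = "Suc (Suc k)" and ?kk = "Suc (Suc (Suc (Suc k)))"
  let ?x = "P m n p x"
  have x': "?x \<in> Ob m" by (rule P_in[OF p x])
  have Y': "Y \<in> Ob ?kk" "P ?k ?kk (up ?k) Y = y" "H 1 ?k (long ?k) Y = P (Suc (Suc 1)) m (kh 1 m (compose {..1} q (long l))) ?x"
    using Y by (auto simp: isins_def)
  have ql: "compose {..1} q (long l) \<in> Delta 1 m" by (rule Delta_comp[OF long_in(1) q])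
  have "Y \<in> fib (lg m ?x) ?k" by (rule fibI[OF Y'(1) isins_long[OF q x' Y]])
  from isins_ex1[OF p x this] obtain Z where Z: "isins m n p x ?k Y Z" by blast
  have Z': "Z \<in> Ob (Suc (Suc ?kk))" "P ?kk (Suc (Suc ?kk)) (up ?kk) Z = Y" using Z by (auto simp: isins_def)
  note Zu = isins_act[OF Z up_in[of k]] and Zl = isins_act[OF Z long_in(1)]
  let ?Y = "out ?k Z"
  note c = isins_can[OF p x ql]
  have "H 1 ?k (long ?k) Y = P (Suc (Suc 1)) m (kh 1 m (compose {..1} q (long l))) ?x" by (rule Y'(3))
  then have V: "isins m n p x 1 (P (Suc (Suc 1)) m (kh 1 m (compose {..1} q (long l))) ?x) (H (Suc (Suc 1)) (Suc (Suc ?k)) (hat 1 ?k (long ?k)) Z)"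
    using Zl(1) by simp
  \<comment> \<open>The face of \<open>Z\<close> on its outer six vertices is the insertion of a
    \<open>3\<close>-simplex cut out of \<open>x\<close>, so uniqueness of insertion and
    \<open>isins_can\<close> compute it.\<close>
  have eqV: "H (Suc (Suc 1)) (Suc (Suc ?k)) (hat 1 ?k (long ?k)) Z = 
     P (Suc (Suc (Suc (Suc 1)))) n (kh (Suc (Suc 1)) n (compose {..Suc (Suc 1)} p (kh 1 m (compose {..1} q (long l))))) x"
    using isins_ex1[OF p x kh_fib[OF ql x']] V c(1) by blast
  have 1: "isins l n (compose {..l} p q) x k y ?Y"
    unfolding isins_def
  proof (intro conjI)
    show "?Y \<in> Ob ?kk" by (rule P_in[OF hat_in[OF up_in] Z'(1)])
    show "P ?k ?kk (up ?k) ?Y = y"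
      unfolding P_P[OF up_in hat_in[OF up_in] Z'(1)] hat_up[OF up_in] P_P[OF up_in up_in Z'(1), symmetric] Z'(2) by (rule Y'(2))
    have "H 1 ?k (long ?k) ?Y = P (Suc (Suc 1)) n (kh 1 n (compose {..1} p (compose {..1} q (long l)))) x"
      using Zl(2) c(2) unfolding eqV by simp
    then show "H 1 ?k (long ?k) ?Y = P (Suc (Suc 1)) n (kh 1 n (compose {..1} (compose {..l} p q) (long l))) x"
      by (simp only: Delta_assoc[OF long_in(1)])
  qed
  show ?thesis by (rule that[OF Zu(1) 1 Zu(2)])
qed

section \<open>The canonical culf maps\<close>

definition c0 :: "nat \<Rightarrow> nat \<Rightarrow> (nat \<Rightarrow> nat) \<Rightarrow> 'o \<Rightarrow> 'u smap" where
  "c0 m n p x = (\<lambda>k. \<lambda>u\<in>E k ` fib (lg m (P m n p x)) k. E k (out k (THE Y. isins m n p x k (D k u) Y)))"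

lemma c0_apply:
  assumes p: "p \<in> Delta m n" and x: "x \<in> Ob n" and y: "y \<in> fib (lg m (P m n p x)) k" and Y: "isins m n p x k y Y"
  shows "c0 m n p x k (E k y) = E k (out k Y)"
  using the1_equality[OF isins_ex1[OF p x y] Y] y by (simp add: c0_def D_E)

lemma c0_map:
  assumes p: "p \<in> Delta m n" and x: "x \<in> Ob n"
  shows "simplicial_map (Iv (lg m (P m n p x))) (Iv (lg n x)) (c0 m n p x)"
  unfolding simplicial_map_def
proof (intro conjI allI ballI)
  fix k
  show "c0 m n p x k \<in> simps (Iv (lg m (P m n p x))) k \<rightarrow>\<^sub>E simps (Iv (lg n x)) k"
  proof
    fix u assume "u \<in> simps (Iv (lg m (P m n p x))) k"
    then obtain y where y: "y \<in> fib (lg m (P m n p x)) k" "u = E k y" by auto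
    obtain Y where Y: "isins m n p x k y Y" using isins_ex1[OF p x y(1)] by blast
    show "c0 m n p x k u \<in> simps (Iv (lg n x)) k"
      using c0_apply[OF p x y(1) Y] out_fib[OF p x Y] y(2) by simp
  qed (simp add: c0_def)
next
  fix j k q u assume q: "q \<in> Delta j k" and "u \<in> simps (Iv (lg m (P m n p x))) k"
  then obtain y where y: "y \<in> fib (lg m (P m n p x)) k" "u = E k y" by auto
  obtain Y where Y: "isins m n p x k y Y" using isins_ex1[OF p x y(1)] by blast
  show "c0 m n p x j (act (Iv (lg m (P m n p x))) j k q u) = act (Iv (lg n x)) j k q (c0 m n p x k u)"
    unfolding y(2) c0_apply[OF p x y(1) Y] Iv_act[OF q y(1)] Iv_act[OF q out_fib[OF p x Y]]
      c0_apply[OF p x fib_H[OF q y(1)] isins_act(1)[OF Y q]] isins_act(2)[OF Y q] ..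
qed

lemma c0_can:
  assumes p: "p \<in> Delta m n" and x: "x \<in> Ob n" and r: "r \<in> Delta k m"
  shows "c0 m n p x k (can m (P m n p x) k r) = can n x k (compose {..k} p r)"
  unfolding can_apply[OF r] can_apply[OF Delta_comp[OF r p]]
    c0_apply[OF p x kh_fib[OF r P_in[OF p x]] isins_can(1)[OF p x r]] isins_can(2)[OF p x r] ..

lemma c0_active:
  assumes p: "active m n p" and x: "x \<in> Ob n"
  shows "c0 m n p x = simp_id (Iv (lg n x))"
proof (rule map_eqI[OF c0_map[OF active_in[OF p] x, unfolded long_long[OF p x]] map_id[OF Iv_set]])
  fix k u assume "u \<in> simps (Iv (lg n x)) k"
  then have "u \<in> simps (Iv (lg m (P m n p x))) k" by (simp only: long_long[OF p x])
  then obtain y where y: "y \<in> fib (lg m (P m n p x)) k" "u = E k y" by auto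
  then have y': "y \<in> fib (lg n x) k" using long_long[OF p x] by simp
  show "c0 m n p x k u = simp_id (Iv (lg n x)) k u"
    using c0_apply[OF active_in[OF p] x y(1) isins_active(1)[OF p x y']] isins_active(2)[OF p x y'] y(2) y'
    by (simp add: simp_id_apply)
qed

lemma c0_comp:
  assumes q: "q \<in> Delta l m" and p: "p \<in> Delta m n" and x: "x \<in> Ob n" and u: "u \<in> simps (Iv (lg l (P l n (compose {..l} p q) x))) k"
  shows "c0 l n (compose {..l} p q) x k u = c0 m n p x k (c0 l m q (P m n p x) k u)"
proof -
  let ?x = "P m n p x"
  have x': "?x \<in> Ob m" by (rule P_in[OF p x])
  obtain y where y: "y \<in> fib (lg l (P l n (compose {..l} p q) x)) k" "u = E k y" using u by auto
  then have y': "y \<in> fib (lg l (P l m q ?x)) k" by (simp only: P_P[OF q p x])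
  obtain Y where Y: "isins l m q ?x k y Y" using isins_ex1[OF q x' y'] by blast
  obtain Yp Y' where Y': "isins m n p x k (out k Y) Yp" "isins l n (compose {..l} p q) x k y Y'" "out k Yp = out k Y'"
    by (rule isins_comp[OF q p x Y])
  show ?thesis
    unfolding y(2) c0_apply[OF q x' y' Y] c0_apply[OF p x out_fib[OF q x' Y] Y'(1)]
      c0_apply[OF Delta_comp[OF q p] x y(1) Y'(2)] Y'(3) ..
qed

text \<open>Insertion does not change the part of \<open>y\<close> between its ends, and by the
  decomposition pullback a refinement along an active \<open>q\<close> is determined by the coarse
  simplex and the refined inner part. Hence a refinement of \<open>out j Y\<close> comes from a
  unique refinement of \<open>y\<close>.\<close>

lemma c0_culf:
  assumes p: "p \<in> Delta m n" and x: "x \<in> Ob n"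
  shows "strict_culf (Iv (lg m (P m n p x))) (Iv (lg n x)) (c0 m n p x)"
  unfolding strict_culf_def
proof (intro conjI allI impI)
  show cm: "simplicial_map (Iv (lg m (P m n p x))) (Iv (lg n x)) (c0 m n p x)" by (rule c0_map[OF p x])
  fix j k q assume qa: "active j k q"
  note q = active_in[OF qa]
  let ?f = "lg m (P m n p x)" and ?A = "Iv (lg m (P m n p x))" and ?B = "Iv (lg n x)" and ?c = "c0 m n p x"
  have mid: "P j (Suc (Suc j)) (up j) (H j k q w) = P j k q (P k (Suc (Suc k)) (up k) w)" if "w \<in> Ob (Suc (Suc k))" for w
    unfolding P_P[OF up_in hat_in[OF q] that] P_P[OF q up_in that] hat_up[OF q] ..
  have upout: "P i (Suc (Suc i)) (up i) (out i Y) = P i (Suc (Suc i)) (up i) y" if "isins m n p x i y Y" for i y Y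
  proof -
    have Y: "Y \<in> Ob (Suc (Suc (Suc (Suc i))))" "P (Suc (Suc i)) (Suc (Suc (Suc (Suc i)))) (up (Suc (Suc i))) Y = y"
      using that by (auto simp: isins_def)
    show ?thesis unfolding P_P[OF up_in hat_in[OF up_in] Y(1)] hat_up[OF up_in] Y(2)[symmetric] P_P[OF up_in up_in Y(1)] ..
  qed
  show "set_pullback (simps ?A k) (simps ?A j) (simps ?B k) (act ?A j k q) (?c k) (?c j) (act ?B j k q)"
  proof (rule set_pullbackI)
    fix u assume u: "u \<in> simps ?A k"
    show "act ?A j k q u \<in> simps ?A j" by (rule act_in[OF Iv_set q u])
    show "?c k u \<in> simps ?B k" by (rule map_in[OF cm u])
    show "?c j (act ?A j k q u) = act ?B j k q (?c k u)" by (rule map_act[OF cm q u])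
  next
    fix b c assume "b \<in> simps ?A j" "c \<in> simps ?B k" and eq: "?c j b = act ?B j k q c"
    then obtain y z where y: "y \<in> fib ?f j" "b = E j y" and z: "z \<in> fib (lg n x) k" "c = E k z" by auto
    obtain Y where Y: "isins m n p x j y Y" using isins_ex1[OF p x y(1)] by blast
    have oY: "out j Y = H j k q z"
      using eq unfolding y(2) z(2) c0_apply[OF p x y(1) Y] Iv_act[OF q z(1)] E_eq[OF out_fib[OF p x Y] fib_H[OF q z(1)]] .
    let ?z = "P k (Suc (Suc k)) (up k) z"
    have z': "?z \<in> Ob k" by (rule P_in[OF up_in fibD(1)[OF z(1)]])
    have "P j k q ?z = P j (Suc (Suc j)) (up j) y"
      unfolding mid[OF fibD(1)[OF z(1)], symmetric] oY[symmetric] by (rule upout[OF Y])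
    \<comment> \<open>\<open>w\<close> refines \<open>y\<close> and has the inner part of
      \<open>z\<close>; that its insertion yields \<open>z\<close> follows by comparing inner and
      coarse parts.\<close>
    from hat_ob_ex1[OF qa z' fibD(1)[OF y(1)] this]
    obtain w where w: "w \<in> Ob (Suc (Suc k))" "P k (Suc (Suc k)) (up k) w = ?z" "H j k q w = y" by blast
    have wf: "w \<in> fib ?f k"
      by (rule fibI[OF w(1)]) (use long_long[OF hat_active[OF q] w(1)] w(3) fibD(2)[OF y(1)] in simp)
    obtain W where W: "isins m n p x k w W" using isins_ex1[OF p x wf] by blast
    note Wq = isins_act[OF W q, unfolded w(3)]
    have YW: "H (Suc (Suc j)) (Suc (Suc k)) (hat j k q) W = Y" using isins_ex1[OF p x y(1)] Wq(1) Y by blast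
    have "out k W = z"
    proof (rule hat_ob_eqI[OF qa fibD(1)[OF out_fib[OF p x W]] fibD(1)[OF z(1)]])
      show "P k (Suc (Suc k)) (up k) (out k W) = ?z" unfolding upout[OF W] w(2) ..
      show "H j k q (out k W) = H j k q z" unfolding Wq(2)[symmetric] YW oY ..
    qed
    then have "?c k (E k w) = c" using c0_apply[OF p x wf W] z(2) by simp
    moreover have "act ?A j k q (E k w) = b" using Iv_act[OF q wf] w(3) y(2) by simp
    ultimately show "\<exists>u\<in>simps ?A k. act ?A j k q u = b \<and> ?c k u = c" using wf by auto
  next
    fix u v assume "u \<in> simps ?A k" "v \<in> simps ?A k" and e1: "act ?A j k q u = act ?A j k q v" and e2: "?c k u = ?c k v"
    then obtain y z where y: "y \<in> fib ?f k" "u = E k y" and z: "z \<in> fib ?f k" "v = E k z" by auto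
    obtain Y where Y: "isins m n p x k y Y" using isins_ex1[OF p x y(1)] by blast
    obtain Z where Z: "isins m n p x k z Z" using isins_ex1[OF p x z(1)] by blast
    have o: "out k Y = out k Z"
      using e2 unfolding y(2) z(2) c0_apply[OF p x y(1) Y] c0_apply[OF p x z(1) Z] E_eq[OF out_fib[OF p x Y] out_fib[OF p x Z]] .
    have "y = z"
    proof (rule hat_ob_eqI[OF qa fibD(1)[OF y(1)] fibD(1)[OF z(1)]])
      show "P k (Suc (Suc k)) (up k) y = P k (Suc (Suc k)) (up k) z"
        unfolding upout[OF Y, symmetric] upout[OF Z, symmetric] o ..
      show "H j k q y = H j k q z"
        using e1 unfolding y(2) z(2) Iv_act[OF q y(1)] Iv_act[OF q z(1)] E_eq[OF fib_H[OF q y(1)] fib_H[OF q z(1)]] .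
    qed
    then show "u = v" using y(2) z(2) by simp
  qed
qed

text \<open>Arrows can be inserted too: the lift \<open>g\<close> over the middle edge and the image
  of \<open>\<phi>\<close> on the \<open>3\<close>-simplex of \<open>x\<close> glue to an arrow
  \<open>G\<close> between the two insertions. Deleting the two vertices from \<open>G\<close> gives
  the lift of the long edge of \<open>\<phi>\<close> that computes \<open>jm\<close>.\<close>

lemma c0_natural:
  assumes p: "p \<in> Delta m n" and \<phi>: "\<phi> \<in> hom (level X n) x x'" and u: "u \<in> simps (Iv (lg m (P m n p x))) k"
  shows "c0 m n p x' k (jm (Q 1 m (long m) (Q m n p \<phi>)) k u) = jm (Q 1 n (long n) \<phi>) k (c0 m n p x k u)"
proof -
  let ?k = "Suc (Suc k)" and ?kk = "Suc (Suc (Suc (Suc k)))"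
  have x: "x \<in> Ob n" and x': "x' \<in> Ob n" using arr_ob[OF \<phi>] by auto
  have \<phi>a: "\<phi> \<in> Ar n" "Src (level X n) \<phi> = x" "Tgt (level X n) \<phi> = x'" using \<phi> by (auto simp: hom_def)
  have pl: "compose {..1} p (long m) \<in> Delta 1 n" by (rule Delta_comp[OF long_in(1) p])
  obtain y where y: "y \<in> fib (lg m (P m n p x)) k" "u = E k y" using u by auto
  let ?\<psi> = "Q 1 m (long m) (Q m n p \<phi>)"
  have \<psi>: "?\<psi> \<in> hom (level X 1) (lg m (P m n p x)) (lg m (P m n p x'))"
    by (rule Q_hom[OF long_in(1) Q_hom[OF p \<phi>]])
  obtain g y' where g: "g \<in> hom (level X ?k) y y'" "Q 1 ?k (long ?k) g = ?\<psi>" "y' \<in> fib (lg m (P m n p x')) k"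
    by (rule lift_fib[OF \<psi> y(1)])
  have ga: "g \<in> Ar ?k" "Src (level X ?k) g = y" "Tgt (level X ?k) g = y'" using g by (auto simp: hom_def)
  let ?w = "kh 1 n (compose {..1} p (long m))"
  have "Q 1 ?k (long ?k) g = Q 1 (Suc (Suc 1)) (up 1) (Q (Suc (Suc 1)) n ?w \<phi>)"
    unfolding g(2) Q_Q[OF long_in(1) p \<phi>a(1)] Q_Q[OF up_in kh_in[OF pl] \<phi>a(1)] kap_hat_up_gen[OF pl] ..
  from hat_ar_ex1[OF long_active(1) ga(1) Q_in[OF kh_in[OF pl] \<phi>a(1)] this]
  obtain G where G: "G \<in> Ar ?kk" "Q ?k ?kk (up ?k) G = g" "Q (Suc (Suc 1)) ?kk (hat 1 ?k (long ?k)) G = Q (Suc (Suc 1)) n ?w \<phi>" by blast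
  let ?S = "Src (level X ?kk) G" and ?T = "Tgt (level X ?kk) G"
  have Gh: "G \<in> hom (level X ?kk) ?S ?T" using G by (simp add: hom_def)
  have iS: "isins m n p x k y ?S"
    unfolding isins_def Q_src[OF up_in G(1), symmetric] Q_src[OF hat_in[OF long_in(1)] G(1), symmetric] G(2,3) Q_src[OF kh_in[OF pl] \<phi>a(1)] \<phi>a(2) ga(2)
    using arr_ob[OF Gh] by simp
  have iT: "isins m n p x' k y' ?T"
    unfolding isins_def Q_tgt[OF up_in G(1), symmetric] Q_tgt[OF hat_in[OF long_in(1)] G(1), symmetric] G(2,3) Q_tgt[OF kh_in[OF pl] \<phi>a(1)] \<phi>a(3) ga(3)
    using arr_ob[OF Gh] by simp
  have "Q 1 ?k (long ?k) (Q ?k ?kk (hat k ?k (up k)) G) = Q 1 (Suc (Suc 1)) (long (Suc (Suc 1))) (Q (Suc (Suc 1)) ?kk (hat 1 ?k (long ?k)) G)"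
    unfolding Q_Q[OF long_in(1) hat_in[OF up_in] G(1)] Q_Q[OF long_in(1) hat_in[OF long_in(1)] G(1)]
      active_long(1)[OF hat_active[OF up_in]] active_long(1)[OF hat_active[OF long_in(1)]] ..
  also have "\<dots> = Q 1 n (long n) \<phi>"
    unfolding G(3) Q_Q[OF long_in(1) kh_in[OF pl] \<phi>a(1)] active_long(1)[OF kh_active[OF pl]] ..
  finally have "jm (Q 1 n (long n) \<phi>) k (E k (out k ?S)) = E k (out k ?T)"
    by (rule jm_apply[OF Q_hom[OF hat_in[OF up_in] Gh]])
  then show ?thesis
    unfolding y(2) c0_apply[OF p x y(1) iS] jm_apply[OF g(1,2)] c0_apply[OF p x' g(3) iT] by simp
qed

end

text \<open>Cancellation in the pasting law for pullbacks. It reduces the culf condition for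
  arbitrary active maps to the maps \<open>[1] \<rightarrow> [n]\<close>.\<close>

lemma set_pullback_cancel:
  assumes outer: "set_pullback Z X1 V gf Jn J1 kh'" and right: "set_pullback Y X1 W g Jm J1 k"
    and f: "\<And>z. z \<in> Z \<Longrightarrow> f z \<in> Y" "\<And>z. z \<in> Z \<Longrightarrow> g (f z) = gf z"
    and h: "\<And>u. u \<in> V \<Longrightarrow> h u \<in> W" "\<And>u. u \<in> V \<Longrightarrow> k (h u) = kh' u"
    and fh: "\<And>z. z \<in> Z \<Longrightarrow> Jm (f z) = h (Jn z)"
  shows "set_pullback Z Y V f Jn Jm h"
proof -
  have o: "gf z \<in> X1" "Jn z \<in> V" if "z \<in> Z" for z
    using outer that unfolding set_pullback_def bij_betw_def by auto
  have r: "g y \<in> X1" "Jm y \<in> W" "J1 (g y) = k (Jm y)" if "y \<in> Y" for y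
    using right that unfolding set_pullback_def bij_betw_def by auto
  show ?thesis
  proof (rule set_pullbackI)
    fix b c assume b: "b \<in> Y" and c: "c \<in> V" and eq: "Jm b = h c"
    have "J1 (g b) = kh' c" using r(3)[OF b] eq h(2)[OF c] by simp
    from set_pullback_ex1[OF outer r(1)[OF b] c this]
    obtain z where z: "z \<in> Z" "gf z = g b" "Jn z = c" by blast
    have "\<exists>!y. y \<in> Y \<and> g y = g b \<and> Jm y = h c"
      by (rule set_pullback_ex1[OF right r(1)[OF b] h(1)[OF c]]) (use r(3)[OF b] eq in simp)
    moreover have "g (f z) = g b" "Jm (f z) = h c" using f(2)[OF z(1)] fh[OF z(1)] z by simp_all
    ultimately have "f z = b" using f(1)[OF z(1)] b eq by blast
    then show "\<exists>x\<in>Z. f x = b \<and> Jn x = c" using z by blast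
  next
    fix x y assume x: "x \<in> Z" and y: "y \<in> Z" and eq: "f x = f y" "Jn x = Jn y"
    have "gf x = gf y" using eq f(2)[OF x] f(2)[OF y] by simp
    moreover have "inj_on (\<lambda>x. (gf x, Jn x)) Z" using outer unfolding set_pullback_def bij_betw_def by blast
    ultimately show "x = y" using eq(2) x y by (auto dest: inj_onD)
  qed (use f o fh in auto)
qed

section \<open>The canonical strict culf map\<close>

context encoded
begin

declare jo_eq [simp del]

abbreviation "JO n x \<equiv> (Iv (lg n x), can n x)"

text \<open>The comparison from the chosen factorisation to the one through the canonical culf map
  \<open>c0\<close>.\<close>

definition st :: "nat \<Rightarrow> nat \<Rightarrow> (nat \<Rightarrow> nat) \<Rightarrow> 'o \<Rightarrow> 'u smap" where
  "st m n p x = filler m (fst (ch m n p (JO n x))) (JO m (P m n p x)) (snd (ch m n p (JO n x))) (c0 m n p x)"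

lemma st_arr:
  assumes p: "p \<in> Delta m n" and x: "x \<in> Ob n" and c: "ch m n p (JO n x) = ((A, a), c)"
  shows "((A, a), JO m (P m n p x), st m n p x) \<in> U_arr m"
    "\<And>k t. t \<in> simps A k \<Longrightarrow> c0 m n p x k (st m n p x k t) = c k t"
proof -
  note x' = P_in[OF p x]
  from ch_cases[OF p can_obj[OF x]] c have A: "(A, a) \<in> U_obj m" "strict_culf A (Iv (lg n x)) c"
    "\<And>k q. q \<in> Delta k m \<Longrightarrow> c k (a k q) = can n x k (compose {..k} p q)"
    by (metis prod.inject)+
  note cm = culf_map[OF A(2)] and dm = c0_map[OF p x]
  have u: "simp_comp A (simp_id (Iv (lg n x))) c = c" by (rule simp_id_comp[OF cm])
  have eq: "simp_comp (std_simplex m) (c0 m n p x) (can m (P m n p x)) = simp_comp (std_simplex m) (simp_comp A (simp_id (Iv (lg n x))) c) a"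
    unfolding u
    by (rule map_eqI[OF map_comp[OF U_objD(3)[OF can_obj[OF x']] dm std_simplicial_set] map_comp[OF U_objD(3)[OF A(1)] cm std_simplicial_set]])
      (simp add: simp_comp_apply c0_can[OF p x] A(3))
  note F = filler_spec[OF A(1) can_obj[OF x'] c0_culf[OF p x] cm eq[unfolded u]]
  have st: "st m n p x = filler m (A, a) (JO m (P m n p x)) c (c0 m n p x)" unfolding st_def c by simp
  show "((A, a), JO m (P m n p x), st m n p x) \<in> U_arr m"
    unfolding U_arr_iff st
    using A(1) can_obj[OF x'] F(2) filler_iso[OF A(1) can_obj[OF x'] A(2) c0_culf[OF p x] iso_id[OF Iv_set] eq, unfolded u] by blast
  show "c0 m n p x k (st m n p x k t) = c k t" if t: "t \<in> simps A k" for k t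
    using fun_cong[OF fun_cong[OF F(3), of k], of t] unfolding st simp_comp_apply[OF t] .
qed

text \<open>Structure isomorphisms along active maps have to be identities on the nose. There both
  the chosen culf map and \<open>c0\<close> are identities, so their comparison is one as
  well.\<close>

lemma st_active:
  assumes p: "active m n p" and x: "x \<in> Ob n"
  shows "fst (ch m n p (JO n x)) = JO m (P m n p x)" "st m n p x = simp_id (Iv (lg n x))"
proof -
  have c: "ch m n p (JO n x) = ((Iv (lg n x), res m n p (can n x)), simp_id (Iv (lg n x)))"
    by (rule ch_active[OF p can_obj[OF x]])
  then show "fst (ch m n p (JO n x)) = JO m (P m n p x)"
    using long_long[OF p x] can_active[OF p x] by simp
  note s = st_arr[OF active_in[OF p] x c]
  have "simplicial_map (Iv (lg n x)) (Iv (lg m (P m n p x))) (st m n p x)" using s(1) by (rule U_arr_map)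
  then have sm: "simplicial_map (Iv (lg n x)) (Iv (lg n x)) (st m n p x)" by (simp only: long_long[OF p x])
  show "st m n p x = simp_id (Iv (lg n x))"
  proof (rule map_eqI[OF sm map_id[OF Iv_set]])
    fix k t assume t: "t \<in> simps (Iv (lg n x)) k"
    have "st m n p x k t \<in> simps (Iv (lg n x)) k" by (rule map_in[OF sm t])
    then show "st m n p x k t = simp_id (Iv (lg n x)) k t"
      using s(2)[OF t] c0_active[OF p x] by (simp only: simp_id_apply)
  qed
qed

text \<open>An object is sent to the interval of its long edge and an arrow acts through its long
  edge, in accordance with \<open>J_active\<close> and \<open>jf_active\<close>, which hold for
  every strict culf map.\<close>

definition Jc :: "('o, 'a, 'u subdiv, 'u subdiv_arr) pseudonat" where
  "Jc = \<lparr>cmpt = (\<lambda>n. \<lparr>ob_map = (\<lambda>x\<in>Ob n. JO n x),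
      arr_map = (\<lambda>f\<in>Ar n. (JO n (Src (level X n) f), JO n (Tgt (level X n) f), jm (Q 1 n (long n) f)))\<rparr>),
    struct_iso = (\<lambda>m n p. if p \<in> Delta m n then (\<lambda>x\<in>Ob n. (fst (ch m n p (JO n x)), JO m (P m n p x), st m n p x)) else (\<lambda>_. undefined))\<rparr>"

lemma Jc_ob: "x \<in> Ob n \<Longrightarrow> ob_map (cmpt Jc n) x = JO n x"
  unfolding Jc_def by simp

lemma Jc_ar: "f \<in> hom (level X n) x y \<Longrightarrow> arr_map (cmpt Jc n) f = (JO n x, JO n y, jm (Q 1 n (long n) f))"
  unfolding Jc_def by (auto simp: hom_def)

lemma Jc_struct: "p \<in> Delta m n \<Longrightarrow> x \<in> Ob n \<Longrightarrow> struct_iso Jc m n p x = (fst (ch m n p (JO n x)), JO m (P m n p x), st m n p x)"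
  unfolding Jc_def by simp

lemma Jc_functor: "is_functor (level X n) (U_level n) (cmpt Jc n)"
  unfolding is_functor_def U_level_sel
proof (intro conjI ballI impI)
  have h: "f \<in> hom (level X n) (Src (level X n) f) (Tgt (level X n) f)" if "f \<in> Ar n" for f using that by (simp add: hom_def)
  show "ob_map (cmpt Jc n) \<in> Ob n \<rightarrow>\<^sub>E U_obj n" using can_obj by (simp add: Jc_def)
  show "arr_map (cmpt Jc n) \<in> Ar n \<rightarrow>\<^sub>E U_arr n"
  proof
    fix f assume f: "f \<in> Ar n"
    show "arr_map (cmpt Jc n) f \<in> U_arr n" unfolding Jc_ar[OF h[OF f]] by (rule jm_arr[OF h[OF f]])
  qed (simp add: Jc_def)
  fix f assume f: "f \<in> Ar n"
  show "Src (U_level n) (arr_map (cmpt Jc n) f) = ob_map (cmpt Jc n) (Src (level X n) f)"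
    "Tgt (U_level n) (arr_map (cmpt Jc n) f) = ob_map (cmpt Jc n) (Tgt (level X n) f)"
    unfolding Jc_ar[OF h[OF f]] using arr_ob[OF h[OF f]] by (simp_all add: Jc_ob)
  fix g assume g: "g \<in> Ar n" "Tgt (level X n) f = Src (level X n) g"
  have g': "g \<in> hom (level X n) (Tgt (level X n) f) (Tgt (level X n) g)" using g by (simp add: hom_def)
  show "arr_map (cmpt Jc n) (Comp (level X n) g f) = Comp (U_level n) (arr_map (cmpt Jc n) g) (arr_map (cmpt Jc n) f)"
    unfolding Jc_ar[OF cat_comp[OF cat h[OF f] g']] Jc_ar[OF g'] Jc_ar[OF h[OF f]] Q_comp[OF long_in(1) h[OF f] g']
      jm_comp[OF Q_hom[OF long_in(1) h[OF f]] Q_hom[OF long_in(1) g'], symmetric] by simp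
next
  fix x assume x: "x \<in> Ob n"
  show "arr_map (cmpt Jc n) (Unit (level X n) x) = (ob_map (cmpt Jc n) x, ob_map (cmpt Jc n) x, simp_id (fst (ob_map (cmpt Jc n) x)))"
    unfolding Jc_ar[OF cat_unit[OF cat x]] Q_unit[OF long_in(1) x] jm_unit[OF P_in[OF long_in(1) x]] Jc_ob[OF x] by simp
qed

lemma c0_cancel:
  assumes p: "p \<in> Delta m n" and x: "x \<in> Ob n"
    and F: "((A, a), JO m (P m n p x), F) \<in> U_arr m" and G: "((A, a), JO m (P m n p x), G) \<in> U_arr m"
    and eq: "\<And>k t. t \<in> simps A k \<Longrightarrow> c0 m n p x k (F k t) = c0 m n p x k (G k t)"
  shows "F = G"
proof -
  note Fm = U_arr_map[OF F] and Gm = U_arr_map[OF G] and cm = c0_map[OF p x]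
  have A: "(A, a) \<in> U_obj m" using F by (simp add: U_arr_iff)
  show ?thesis
  proof (rule cancel_culf[OF A c0_culf[OF p x] Iv_set Fm Gm])
    show "simp_comp (std_simplex m) F a = simp_comp (std_simplex m) G a" using F G by (simp add: U_arr_iff)
    show "simp_comp A (c0 m n p x) F = simp_comp A (c0 m n p x) G"
      by (rule map_eqI[OF map_comp[OF Fm cm U_objD(2)[OF A]] map_comp[OF Gm cm U_objD(2)[OF A]]])
        (simp add: simp_comp_apply eq)
  qed
qed

text \<open>After applying \<open>c0\<close> both sides become \<open>jm\<close> after the chosen
  culf map \<open>c\<close>; for the right-hand side this is the naturality of insertion.\<close>

lemma Jc_natural:
  assumes p: "p \<in> Delta m n" and f: "f \<in> hom (level X n) x y"
  shows "Comp (U_level m) (struct_iso Jc m n p y) (arr_map (U_pull ch m n p) (arr_map (cmpt Jc n) f)) =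
     Comp (U_level m) (arr_map (cmpt Jc m) (Q m n p f)) (struct_iso Jc m n p x)"
proof -
  have x: "x \<in> Ob n" and y: "y \<in> Ob n" using arr_ob[OF f] by auto
  obtain A a c where c: "ch m n p (JO n x) = ((A, a), c)" "strict_culf A (Iv (lg n x)) c"
    by (rule ch_cases[OF p can_obj[OF x]])
  obtain B b d where d: "ch m n p (JO n y) = ((B, b), d)" by (rule ch_cases[OF p can_obj[OF y]])
  obtain G where G: "arr_map (U_pull ch m n p) (JO n x, JO n y, jm (Q 1 n (long n) f)) = ((A, a), (B, b), G)"
    "((A, a), (B, b), G) \<in> U_arr m" "\<And>k s. s \<in> simps A k \<Longrightarrow> d k (G k s) = jm (Q 1 n (long n) f) k (c k s)"
    by (rule pull_arr[OF p jm_arr[OF f] c(1) d]) blast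
  note sx = st_arr[OF p x c(1)] and sy = st_arr[OF p y d]
  have "simp_comp A (st m n p y) G = simp_comp A (jm (Q 1 m (long m) (Q m n p f))) (st m n p x)"
  proof (rule c0_cancel[OF p y U_arr_comp[OF G(2) sy(1)] U_arr_comp[OF sx(1) jm_arr[OF Q_hom[OF p f]]]])
    fix k t assume t: "t \<in> simps A k"
    have 1: "c0 m n p y k (st m n p y k (G k t)) = jm (Q 1 n (long n) f) k (c k t)"
      using sy(2)[OF map_in[OF U_arr_map[OF G(2)] t]] G(3)[OF t] by simp
    have 2: "c0 m n p y k (jm (Q 1 m (long m) (Q m n p f)) k (st m n p x k t)) = jm (Q 1 n (long n) f) k (c k t)"
      using c0_natural[OF p f map_in[OF U_arr_map[OF sx(1)] t]] sx(2)[OF t] by simp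
    show "c0 m n p y k (simp_comp A (st m n p y) G k t) =
      c0 m n p y k (simp_comp A (jm (Q 1 m (long m) (Q m n p f))) (st m n p x) k t)"
      unfolding simp_comp_apply[OF t] 1 2 ..
  qed
  then show ?thesis
    unfolding Jc_struct[OF p x] Jc_struct[OF p y] Jc_ar[OF f] Jc_ar[OF Q_hom[OF p f]] G(1) c d by simp
qed

text \<open>Both sides are compared after \<open>c0\<close>: functoriality of insertion and the
  defining equation of the coherence isomorphism reduce them to \<open>c1\<close> after
  \<open>c2\<close>.\<close>

lemma Jc_coh:
  assumes q: "q \<in> Delta l m" and p: "p \<in> Delta m n" and x: "x \<in> Ob n"
  shows "Comp (U_level l) (struct_iso Jc l m q (P m n p x)) (arr_map (U_pull ch l m q) (struct_iso Jc m n p x)) =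
     Comp (U_level l) (struct_iso Jc l n (compose {..l} p q) x) (U_coh ch l m n q p (JO n x))"
proof -
  let ?x = "P m n p x" and ?r = "compose {..l} p q"
  have x': "?x \<in> Ob m" by (rule P_in[OF p x])
  note r = Delta_comp[OF q p]
  note PP = P_P[OF q p x]
  obtain A1 a1 c1 where c1: "ch m n p (JO n x) = ((A1, a1), c1)" "(A1, a1) \<in> U_obj m"
    by (rule ch_cases[OF p can_obj[OF x]])
  obtain A2 a2 c2 where c2: "ch l m q (A1, a1) = ((A2, a2), c2)" "(A2, a2) \<in> U_obj l" "strict_culf A2 A1 c2"
    by (rule ch_cases[OF q c1(2)])
  obtain A3 a3 c3 where c3: "ch l m q (JO m ?x) = ((A3, a3), c3)" by (rule ch_cases[OF q can_obj[OF x']])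
  obtain A4 a4 c4 where c4: "ch l n ?r (JO n x) = ((A4, a4), c4)" "(A4, a4) \<in> U_obj l" by (rule ch_cases[OF r can_obj[OF x]])
  note sp = st_arr[OF p x c1(1)] and sq = st_arr[OF q x' c3] and sr = st_arr[OF r x c4(1)]
  obtain G where G: "arr_map (U_pull ch l m q) ((A1, a1), JO m ?x, st m n p x) = ((A2, a2), (A3, a3), G)"
    "((A2, a2), (A3, a3), G) \<in> U_arr l" "\<And>k t. t \<in> simps A2 k \<Longrightarrow> c3 k (G k t) = st m n p x k (c2 k t)"
    by (rule pull_arr[OF q sp(1) c2(1) c3]) blast
  obtain K where K: "U_coh ch l m n q p (JO n x) = ((A2, a2), (A4, a4), K)" "simplicial_map A2 A4 K"
    "\<And>k r. r \<in> Delta k l \<Longrightarrow> K k (a2 k r) = a4 k r" "\<And>k t. t \<in> simps A2 k \<Longrightarrow> c4 k (K k t) = c1 k (c2 k t)"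
    by (rule coh_cases[OF q p can_obj[OF x] c1(1) c2(1) c4(1)]) blast
  let ?F = "simp_comp A2 (st l m q ?x) G" and ?G = "simp_comp A2 (st l n ?r x) K"
  have F: "((A2, a2), JO l (P l n ?r x), ?F) \<in> U_arr l"
    using U_arr_comp[OF G(2) sq(1)] by (simp only: PP)
  have Fm: "simplicial_map A2 (Iv (lg l (P l n ?r x))) ?F" by (rule U_arr_map[OF F])
  have Gm: "simplicial_map A2 (Iv (lg l (P l n ?r x))) ?G"
    by (rule map_comp[OF K(2) U_arr_map[OF sr(1)] U_objD(2)[OF c2(2)]])
  have "?F = ?G"
  proof (rule cancel_culf[OF c2(2) c0_culf[OF r x] Iv_set Fm Gm])
    note am = U_objD(3)[OF c2(2)]
    show "simp_comp (std_simplex l) ?F a2 = simp_comp (std_simplex l) ?G a2"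
    proof (rule map_eqI[OF map_comp[OF am Fm std_simplicial_set] map_comp[OF am Gm std_simplicial_set]])
      fix k s assume s: "s \<in> simps (std_simplex l) k"
      then have s': "s \<in> Delta k l" by simp
      have "?F k (a2 k s) = can l (P l n ?r x) k s" by (rule U_arr_apply[OF F s'])
      also have "\<dots> = ?G k (a2 k s)"
        unfolding simp_comp_apply[OF std_in[OF c2(2) s']] K(3)[OF s'] using U_arr_apply[OF sr(1) s'] by simp
      finally show "simp_comp (std_simplex l) ?F a2 k s = simp_comp (std_simplex l) ?G a2 k s"
        unfolding simp_comp_apply[OF s] .
    qed
    note cm = c0_map[OF r x]
    show "simp_comp A2 (c0 l n ?r x) ?F = simp_comp A2 (c0 l n ?r x) ?G"
    proof (rule map_eqI[OF map_comp[OF Fm cm U_objD(2)[OF c2(2)]] map_comp[OF Gm cm U_objD(2)[OF c2(2)]]])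
      fix k t assume t: "t \<in> simps A2 k"
      note gt = map_in[OF U_arr_map[OF G(2)] t] and kt = map_in[OF K(2) t]
      have u: "st l m q ?x k (G k t) \<in> simps (Iv (lg l (P l n ?r x))) k"
        using map_in[OF U_arr_map[OF sq(1)] gt] by (simp only: PP)
      have "c0 l n ?r x k (st l m q ?x k (G k t)) = c0 m n p x k (c3 k (G k t))"
        unfolding c0_comp[OF q p x u] sq(2)[OF gt] ..
      also have "\<dots> = c1 k (c2 k t)"
        unfolding G(3)[OF t] by (rule sp(2)[OF map_in[OF culf_map[OF c2(3)] t]])
      also have "\<dots> = c0 l n ?r x k (st l n ?r x k (K k t))"
        unfolding sr(2)[OF kt] K(4)[OF t] ..
      finally show "simp_comp A2 (c0 l n ?r x) ?F k t = simp_comp A2 (c0 l n ?r x) ?G k t"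
        unfolding simp_comp_apply[OF t] .
    qed
  qed
  then show ?thesis
    unfolding Jc_struct[OF p x] Jc_struct[OF q x'] Jc_struct[OF r x] c1 c3 c4 fst_conv G(1) K(1) by (simp add: PP)
qed

lemma Jc_struct_active:
  assumes p: "active m n p" and x: "x \<in> Ob n"
  shows "struct_iso Jc m n p x = Unit (U_level m) (ob_map (U_pull ch m n p) (JO n x))"
  unfolding Jc_struct[OF active_in[OF p] x] pull_ob[OF can_obj[OF x]] st_active[OF p x]
  by (simp add: long_long[OF p x, simplified])

lemma Jc_pseudonatural: "pseudonatural X U Jc"
  unfolding pseudonatural_def U_groupoid_sel
proof (intro conjI allI ballI impI)
  show "is_functor (level X n) (U_level n) (cmpt Jc n)" for n by (rule Jc_functor)
  show "struct_iso Jc m n p = (\<lambda>_. undefined)" if "p \<notin> Delta m n" for m n p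
    using that by (simp add: Jc_def)
next
  fix m n p assume p: "p \<in> Delta m n"
  show "struct_iso Jc m n p \<in> extensional (Ob n)" using p by (simp add: Jc_def)
  fix x assume x: "x \<in> Ob n"
  obtain A a c where c: "ch m n p (JO n x) = ((A, a), c)" by (rule ch_cases[OF p can_obj[OF x]])
  have s: "struct_iso Jc m n p x \<in> U_arr m" using st_arr(1)[OF p x c] unfolding Jc_struct[OF p x] c fst_conv .
  show "struct_iso Jc m n p x \<in> hom (U_level m) (ob_map (U_pull ch m n p) (ob_map (cmpt Jc n) x)) (ob_map (cmpt Jc m) (P m n p x))"
    unfolding Jc_ob[OF x] Jc_ob[OF P_in[OF p x]] pull_ob[OF can_obj[OF x]] U_hom using s unfolding Jc_struct[OF p x] by blast
  show "invertible (U_level m) (struct_iso Jc m n p x)" by (rule U_invertible[OF s])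
next
  fix m n p f assume p: "p \<in> Delta m n" and f: "f \<in> Ar n"
  show "Comp (U_level m) (struct_iso Jc m n p (Tgt (level X n) f)) (arr_map (U_pull ch m n p) (arr_map (cmpt Jc n) f)) =
     Comp (U_level m) (arr_map (cmpt Jc m) (Q m n p f)) (struct_iso Jc m n p (Src (level X n) f))"
    by (rule Jc_natural[OF p]) (use f in \<open>simp add: hom_def\<close>)
next
  fix n x assume x: "x \<in> Ob n"
  have "res n n (delta_id n) (can n x) = can n x"
    using can_active[OF delta_id_active x] P_id[OF x] by simp
  then show "struct_iso Jc n n (delta_id n) x = Unit (U_level n) (ob_map (cmpt Jc n) x)"
    unfolding Jc_struct_active[OF delta_id_active x] pull_ob_active[OF delta_id_active can_obj[OF x]] Jc_ob[OF x] by simp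
next
  fix l m n q p x assume "q \<in> Delta l m" "p \<in> Delta m n" "x \<in> Ob n"
  then show "Comp (U_level l) (struct_iso Jc l m q (P m n p x)) (arr_map (U_pull ch l m q) (struct_iso Jc m n p x)) =
     Comp (U_level l) (struct_iso Jc l n (compose {..l} p q) x) (U_coh ch l m n q p (ob_map (cmpt Jc n) x))"
    by (simp only: Jc_ob Jc_coh)
qed

section \<open>The pullback condition for long edges\<close>

lemma res_res: 
  assumes q: "active l m q" and p: "active m n p" and x: "(A, a) \<in> U_obj n"
  shows "res l m q (res m n p a) = res l n (compose {..l} p q) a"
proof (rule map_eqI[OF U_objD(3)[OF res_obj[OF q res_obj[OF p x]]] U_objD(3)[OF res_obj[OF active_comp[OF q p] x]]])
  fix k s assume "s \<in> simps (std_simplex l) k"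
  then have s: "s \<in> Delta k l" by simp
  show "res l m q (res m n p a) k s = res l n (compose {..l} p q) a k s"
    by (simp only: res_apply[OF s] res_apply[OF Delta_comp[OF s active_in[OF q]]] Delta_assoc[OF s])
qed

text \<open>A subdivision by \<open>[n]\<close> is determined by its top simplex, which joins the
  initial to the terminal object. \<open>degenerate_ends\<close> turns this
  \<open>(n + 2)\<close>-simplex of \<open>X\<close> into the \<open>n\<close>-simplex
  \<open>x\<close> that induces the subdivision.\<close>

lemma long_pullback_ob:
  assumes f: "f \<in> Ob 1" and b: "(Iv f, b) \<in> U_obj n"
  shows "\<exists>x\<in>Ob n. lg n x = f \<and> can n x = b"
proof -
  have "b n (delta_id n) \<in> simps (Iv f) n" by (rule std_in[OF b delta_id_in])
  then obtain z where z: "z \<in> fib f n" "b n (delta_id n) = E n z" by auto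
  have v: "H 0 n (vtx i) z \<in> fib f 0" "E 0 (H 0 n (vtx i) z) = b 0 (vtx i)" if "i \<le> n" for i
    using fib_H[OF vtx_in[OF that] z(1)] Iv_act[OF vtx_in[OF that] z(1)] obj_act[OF b delta_id_in vtx_in[OF that]] z(2)
      comp_id_left[OF vtx_in[OF that]] by simp_all
  have w: "P (Suc (Suc 0)) 1 (kh 0 1 (vtx i)) f \<in> fib f 0" if "i \<le> 1" for i
    using kh_fib[OF vtx_in[OF that] f] lg_1[OF f] by simp
  have "z = P (Suc (Suc n)) n (kap n) (P n (Suc (Suc n)) (up n) z)"
  proof (rule degenerate_ends[OF f fibD(1)[OF z(1)]])
    show "H 0 n (vtx 0) z = P (Suc (Suc 0)) 1 (kh 0 1 (vtx 0)) f"
      using v(2)[of 0] U_objD(4)[OF b] E_eq[OF v(1)[of 0] w[of 0]] by (simp add: Iv_bot)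
    show "H 0 n (vtx n) z = P (Suc (Suc 0)) 1 (kh 0 1 (vtx 1)) f"
      using v(2)[of n] U_objD(5)[OF b] E_eq[OF v(1)[of n] w[of 1]] by (simp add: Iv_bot)
  qed
  moreover define x where "x = P n (Suc (Suc n)) (up n) z"
  ultimately have zx: "z = P (Suc (Suc n)) n (kap n) x" by simp
  have x: "x \<in> Ob n" unfolding x_def by (rule P_in[OF up_in fibD(1)[OF z(1)]])
  have lx: "lg n x = f" using long_long[OF kap_active x] fibD(2)[OF z(1)] zx by simp
  have "can n x n (delta_id n) = b n (delta_id n)"
    unfolding can_apply[OF delta_id_in] z(2) zx hat_id comp_id_right[OF kap_in] ..
  then have "can n x = b"
    by (rule std_map_eqI[OF U_objD(3)[OF can_obj[OF x]] U_objD(3)[OF b, folded lx]])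
  then show ?thesis using x lx by blast
qed

text \<open>\<open>up n\<close> is a section of \<open>kap n\<close>, so \<open>x\<close> is
  recovered from the top simplex of its subdivision.\<close>

lemma can_inj:
  assumes x: "x \<in> Ob n" and y: "y \<in> Ob n" and eq: "can n x = can n y"
  shows "x = y"
proof -
  have kx: "P (Suc (Suc n)) n (kap n) w \<in> fib (lg n w) n" "can n w n (delta_id n) = E n (P (Suc (Suc n)) n (kap n) w)" if "w \<in> Ob n" for w
    using fib_active[OF kap_active that] by (simp_all add: can_apply hat_id comp_id_right[OF kap_in])
  have "P (Suc (Suc n)) n (kap n) x = P (Suc (Suc n)) n (kap n) y"
    using kx(2)[OF x] kx(2)[OF y] eq E_eq[OF kx(1)[OF x] kx(1)[OF y]] by simp
  then have "P n (Suc (Suc n)) (up n) (P (Suc (Suc n)) n (kap n) x) = P n (Suc (Suc n)) (up n) (P (Suc (Suc n)) n (kap n) y)" by simp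
  then show ?thesis unfolding P_P[OF up_in kap_in x] P_P[OF up_in kap_in y] kap_up P_id[OF x] P_id[OF y] .
qed

lemma Jc_long_ob: "set_pullback (Ob n) (Ob 1) (U_obj n) (lg n) (ob_map (cmpt Jc n)) (ob_map (cmpt Jc 1)) (ob_map (U_pull ch 1 n (long n)))"
proof (rule set_pullbackI)
  fix x assume x: "x \<in> Ob n"
  show "lg n x \<in> Ob 1" by (rule P_in[OF long_in(1) x])
  show "ob_map (cmpt Jc n) x \<in> U_obj n" unfolding Jc_ob[OF x] by (rule can_obj[OF x])
  show "ob_map (cmpt Jc 1) (lg n x) = ob_map (U_pull ch 1 n (long n)) (ob_map (cmpt Jc n) x)"
    unfolding Jc_ob[OF x] Jc_ob[OF P_in[OF long_in(1) x]] pull_ob_active[OF long_active(1) can_obj[OF x]]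
      lg_1[OF P_in[OF long_in(1) x]] can_active[OF long_active(1) x] ..
next
  fix f u assume f: "f \<in> Ob 1" and "u \<in> U_obj n" and eq: "ob_map (cmpt Jc 1) f = ob_map (U_pull ch 1 n (long n)) u"
  moreover obtain A b where "u = (A, b)" by (cases u)
  ultimately have b: "(A, b) \<in> U_obj n" and u: "u = (A, b)" by auto
  have "A = Iv f" using eq unfolding u Jc_ob[OF f] pull_ob_active[OF long_active(1) b] lg_1[OF f] by simp
  with b u show "\<exists>x\<in>Ob n. lg n x = f \<and> ob_map (cmpt Jc n) x = u"
    using long_pullback_ob[OF f, of b n] by (auto simp: Jc_ob)
next
  fix x y assume x: "x \<in> Ob n" and y: "y \<in> Ob n" and eq: "ob_map (cmpt Jc n) x = ob_map (cmpt Jc n) y"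
  then show "x = y" using can_inj[OF x y] by (simp add: Jc_ob)
qed

text \<open>The lifting property covers positive dimensions. For \<open>n = 0\<close> the long edge
  is degenerate and full faithfulness takes over, which is why the target of \<open>\<psi>\<close>
  is required to be a long edge as well.\<close>

lemma lift_long:
  assumes x: "x \<in> Ob n" and y: "y \<in> Ob n" and \<psi>: "\<psi> \<in> hom (level X 1) (lg n x) (lg n y)"
  obtains y' \<phi> where "\<phi> \<in> hom (level X n) x y'" "Q 1 n (long n) \<phi> = \<psi>"
proof (cases n)
  case 0
  have l0: "long 0 = codegen0" by (auto simp: fun_eq_iff long_def codegen0_def)
  have "fully_faithful (level X 0) (level X 1) (pull X 1 0 codegen0)"
    using rigid by (simp add: rigid_decomposition_groupoid_def)
  then have "bij_betw (Q 1 0 codegen0) (hom (level X 0) x y) (hom (level X 1) (P 1 0 codegen0 x) (P 1 0 codegen0 y))"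
    using x y 0 unfolding fully_faithful_def by blast
  then obtain \<phi> where "\<phi> \<in> hom (level X 0) x y" "Q 1 0 codegen0 \<phi> = \<psi>"
    using \<psi> 0 l0 unfolding bij_betw_def by (metis imageE)
  then show ?thesis using that 0 l0 by simp
next
  case (Suc k)
  have "\<psi> \<in> Ar 1" "Src (level X 1) \<psi> = P 1 (Suc k) (long (Suc k)) x" using \<psi> Suc by (auto simp: hom_def)
  from lift_src[OF x[unfolded Suc] this] obtain g where "g \<in> Ar (Suc k)" "Src (level X (Suc k)) g = x" "Q 1 (Suc k) (long (Suc k)) g = \<psi>" by blast
  then show ?thesis using that[of g "Tgt (level X (Suc k)) g"] Suc by (simp add: hom_def)
qed

text \<open>Uniqueness of lifts with given source for positive \<open>n\<close>, and faithfulness of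
  the degeneracy for \<open>n = 0\<close>.\<close>

lemma long_faithful:
  assumes g: "g \<in> hom (level X n) x y" and h: "h \<in> hom (level X n) x y" and eq: "Q 1 n (long n) g = Q 1 n (long n) h"
  shows "g = h"
proof (cases n)
  case 0
  have l0: "long 0 = codegen0" by (auto simp: fun_eq_iff long_def codegen0_def)
  have "fully_faithful (level X 0) (level X 1) (pull X 1 0 codegen0)"
    using rigid by (simp add: rigid_decomposition_groupoid_def)
  then have "bij_betw (Q 1 0 codegen0) (hom (level X 0) x y) (hom (level X 1) (P 1 0 codegen0 x) (P 1 0 codegen0 y))"
    using arr_ob[OF g] 0 unfolding fully_faithful_def by blast
  then have "inj_on (Q 1 0 codegen0) (hom (level X 0) x y)" by (simp add: bij_betw_def)
  then show ?thesis by (rule inj_onD) (use g h eq 0 l0 in simp_all)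
next
  case (Suc k)
  have g': "g \<in> Ar (Suc k)" "Src (level X (Suc k)) g = x" and h': "h \<in> Ar (Suc k)" "Src (level X (Suc k)) h = x"
    using g h Suc by (auto simp: hom_def)
  have x: "x \<in> Ob (Suc k)" using arr_ob[OF g] Suc by simp
  have "Src (level X 1) (Q 1 (Suc k) (long (Suc k)) g) = P 1 (Suc k) (long (Suc k)) x"
    unfolding Q_src[OF long_in(1) g'(1)] g'(2) ..
  from lift_src[OF x Q_in[OF long_in(1) g'(1)] this] g' h' eq Suc show ?thesis by metis
qed

text \<open>The objects at both ends are found by \<open>long_pullback_ob\<close>; the arrow
  \<open>\<psi>\<close> is then lifted from the source, and the lift is shown to end at the correct
  subdivision.\<close>

lemma Jc_long_ar: "set_pullback (Ar n) (Ar 1) (U_arr n) (Q 1 n (long n)) (arr_map (cmpt Jc n)) (arr_map (cmpt Jc 1)) (arr_map (U_pull ch 1 n (long n)))"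
proof (rule set_pullbackI)
  have h: "f \<in> hom (level X n) (Src (level X n) f) (Tgt (level X n) f)" if "f \<in> Ar n" for n f using that by (simp add: hom_def)
  have l1: "Q 1 1 (long 1) f = f" if "f \<in> Ar 1" for f using Q_id[of f 1] that by (simp add: long_1)
  {
    fix f assume f: "f \<in> Ar n"
    show "Q 1 n (long n) f \<in> Ar 1" by (rule Q_in[OF long_in(1) f])
    show "arr_map (cmpt Jc n) f \<in> U_arr n" unfolding Jc_ar[OF h[OF f]] by (rule jm_arr[OF h[OF f]])
    have "Src (level X n) f \<in> Ob n" "Tgt (level X n) f \<in> Ob n" using cat_arr[OF cat f] by auto
    then show "arr_map (cmpt Jc 1) (Q 1 n (long n) f) = arr_map (U_pull ch 1 n (long n)) (arr_map (cmpt Jc n) f)"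
      unfolding Jc_ar[OF h[OF f]] Jc_ar[OF Q_hom[OF long_in(1) h[OF f]]] pull_arr_active[OF long_active(1) jm_arr[OF h[OF f]]]
        l1[OF Q_in[OF long_in(1) f]]
      by (simp only: lg_1 P_in[OF long_in(1)] can_active[OF long_active(1)])
  }
  {
    fix \<psi> u assume \<psi>: "\<psi> \<in> Ar 1" and u: "u \<in> U_arr n" and eq: "arr_map (cmpt Jc 1) \<psi> = arr_map (U_pull ch 1 n (long n)) u"
    obtain A a B b F where ue: "u = ((A, a), (B, b), F)" by (metis surj_pair)
    note uF = u[unfolded ue]
    have a: "(A, a) \<in> U_obj n" and b: "(B, b) \<in> U_obj n" using uF by (auto simp: U_arr_iff)
    let ?f = "Src (level X 1) \<psi>" and ?g = "Tgt (level X 1) \<psi>"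
    have f: "?f \<in> Ob 1" and g: "?g \<in> Ob 1" using cat_arr[OF cat \<psi>] by auto
    have e: "JO 1 ?f = (A, res 1 n (long n) a)" "JO 1 ?g = (B, res 1 n (long n) b)" "jm \<psi> = F"
      using eq unfolding ue pull_arr_active[OF long_active(1) uF] Jc_ar[OF h[OF \<psi>]] l1[OF \<psi>] by simp_all
    have A: "A = Iv ?f" and B: "B = Iv ?g" using e lg_1[OF f] lg_1[OF g] by auto
    obtain x where x: "x \<in> Ob n" "lg n x = ?f" "can n x = a" using long_pullback_ob[OF f, of a n] a A by blast
    obtain y where y: "y \<in> Ob n" "lg n y = ?g" "can n y = b" using long_pullback_ob[OF g, of b n] b B by blast
    have "\<psi> \<in> hom (level X 1) (lg n x) (lg n y)" using \<psi> x y by (simp add: hom_def)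
    from lift_long[OF x(1) y(1) this] obtain y' \<phi> where \<phi>: "\<phi> \<in> hom (level X n) x y'" "Q 1 n (long n) \<phi> = \<psi>" by blast
    have y': "y' \<in> Ob n" using arr_ob[OF \<phi>(1)] by simp
    have ly: "lg n y' = ?g" using Q_hom[OF long_in(1) \<phi>(1)] \<phi>(2) by (simp add: hom_def)
    \<comment> \<open>A priori the target of the lift is only known to lie over \<open>?g\<close>.
      It induces \<open>b\<close> because \<open>jm \<psi>\<close> is \<open>F\<close>, which
      carries \<open>a\<close> to \<open>b\<close>.\<close>
    have "can n y' = b"
    proof (rule map_eqI[OF U_objD(3)[OF can_obj[OF y']] U_objD(3)[OF b]])
      fix k q assume "q \<in> simps (std_simplex n) k"
      then have q: "q \<in> Delta k n" by simp
      show "can n y' k q = b k q"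
        using U_arr_apply[OF jm_arr[OF \<phi>(1)] q] U_arr_apply[OF uF q] x(3) e(3) \<phi>(2) by simp
    qed
    then have "arr_map (cmpt Jc n) \<phi> = u"
      unfolding Jc_ar[OF \<phi>(1)] ue using x ly A B e(3) \<phi>(2) by simp
    then show "\<exists>x\<in>Ar n. Q 1 n (long n) x = \<psi> \<and> arr_map (cmpt Jc n) x = u"
      using \<phi> by (auto simp: hom_def)
  }
  {
    fix f g assume f: "f \<in> Ar n" and g: "g \<in> Ar n" and e: "Q 1 n (long n) f = Q 1 n (long n) g" "arr_map (cmpt Jc n) f = arr_map (cmpt Jc n) g"
    have o: "Src (level X n) f \<in> Ob n" "Tgt (level X n) f \<in> Ob n" "Src (level X n) g \<in> Ob n" "Tgt (level X n) g \<in> Ob n"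
      using cat_arr[OF cat f] cat_arr[OF cat g] by auto
    have "can n (Src (level X n) f) = can n (Src (level X n) g)" "can n (Tgt (level X n) f) = can n (Tgt (level X n) g)"
      using e(2) unfolding Jc_ar[OF h[OF f]] Jc_ar[OF h[OF g]] by auto
    then have "Src (level X n) f = Src (level X n) g" "Tgt (level X n) f = Tgt (level X n) g" using can_inj o by blast+
    then show "f = g" using long_faithful[OF h[OF f] _ e(1)] h[OF g] by simp
  }
qed

lemma Jc_strict_culf: "scm Jc"
  unfolding strict_culf_map_def U_groupoid_sel
proof (intro conjI allI ballI impI)
  show "pseudonatural X U Jc" by (rule Jc_pseudonatural)
next
  fix m n p x assume "active m n p" "x \<in> Ob n"
  then show "struct_iso Jc m n p x = Unit (U_level m) (ob_map (U_pull ch m n p) (ob_map (cmpt Jc n) x))"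
    by (simp only: Jc_struct_active Jc_ob)
next
  fix m n p assume p: "active m n p"
  note pD = active_in[OF p]
  have h: "f \<in> hom (level X n) (Src (level X n) f) (Tgt (level X n) f)" if "f \<in> Ar n" for n f using that by (simp add: hom_def)
  show "strict_pullback (level X n) (level X m) (U_level n) (pull X m n p) (cmpt Jc n) (cmpt Jc m) (U_pull ch m n p)"
    unfolding strict_pullback_def U_level_sel
  proof (intro conjI)
    show "set_pullback (Ob n) (Ob m) (U_obj n) (P m n p) (ob_map (cmpt Jc n)) (ob_map (cmpt Jc m)) (ob_map (U_pull ch m n p))"
    proof (rule set_pullback_cancel[OF Jc_long_ob Jc_long_ob])
      fix x assume x: "x \<in> Ob n"
      show "P m n p x \<in> Ob m" by (rule P_in[OF pD x])
      show "lg m (P m n p x) = lg n x" by (rule long_long[OF p x])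
      show "ob_map (cmpt Jc m) (P m n p x) = ob_map (U_pull ch m n p) (ob_map (cmpt Jc n) x)"
        unfolding Jc_ob[OF x] Jc_ob[OF P_in[OF pD x]] pull_ob_active[OF p can_obj[OF x]] long_long[OF p x] can_active[OF p x] ..
    next
      fix u :: "'u subdiv" assume "u \<in> U_obj n"
      moreover obtain A a where u: "u = (A, a)" by (cases u)
      ultimately have a: "(A, a) \<in> U_obj n" by simp
      show "ob_map (U_pull ch m n p) u \<in> U_obj m"
        unfolding u pull_ob_active[OF p a] by (rule res_obj[OF p a])
      show "ob_map (U_pull ch 1 m (long m)) (ob_map (U_pull ch m n p) u) = ob_map (U_pull ch 1 n (long n)) u"
        unfolding u pull_ob_active[OF p a] pull_ob_active[OF long_active(1) a] pull_ob_active[OF long_active(1) res_obj[OF p a]]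
          res_res[OF long_active(1) p a] active_long(1)[OF p] ..
    qed
    show "set_pullback (Ar n) (Ar m) (U_arr n) (Q m n p) (arr_map (cmpt Jc n)) (arr_map (cmpt Jc m)) (arr_map (U_pull ch m n p))"
    proof (rule set_pullback_cancel[OF Jc_long_ar Jc_long_ar])
      fix f assume f: "f \<in> Ar n"
      show "Q m n p f \<in> Ar m" by (rule Q_in[OF pD f])
      show ll: "Q 1 m (long m) (Q m n p f) = Q 1 n (long n) f"
        unfolding Q_Q[OF long_in(1) pD f] active_long(1)[OF p] ..
      have o: "Src (level X n) f \<in> Ob n" "Tgt (level X n) f \<in> Ob n" using cat_arr[OF cat f] by auto
      show "arr_map (cmpt Jc m) (Q m n p f) = arr_map (U_pull ch m n p) (arr_map (cmpt Jc n) f)"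
        unfolding Jc_ar[OF h[OF f]] Jc_ar[OF Q_hom[OF pD h[OF f]]] pull_arr_active[OF p jm_arr[OF h[OF f]]] ll
          long_long[OF p o(1)] long_long[OF p o(2)] can_active[OF p o(1)] can_active[OF p o(2)] ..
    next
      fix u :: "'u subdiv_arr" assume u: "u \<in> U_arr n"
      obtain A a B b F where ue: "u = ((A, a), (B, b), F)" by (metis surj_pair)
      note uF = u[unfolded ue]
      have a: "(A, a) \<in> U_obj n" and b: "(B, b) \<in> U_obj n" using uF by (auto simp: U_arr_iff)
      show "arr_map (U_pull ch m n p) u \<in> U_arr m"
        unfolding ue pull_arr_active[OF p uF] by (rule res_arr[OF p uF])
      show "arr_map (U_pull ch 1 m (long m)) (arr_map (U_pull ch m n p) u) = arr_map (U_pull ch 1 n (long n)) u"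
        unfolding ue pull_arr_active[OF p uF] pull_arr_active[OF long_active(1) uF] pull_arr_active[OF long_active(1) res_arr[OF p uF]]
          res_res[OF long_active(1) p a] res_res[OF long_active(1) p b] active_long(1)[OF p] ..
    qed
  qed
qed

end

subsection \<open>Contractibility\<close>

text \<open>All laws hold because parallel arrows are equal; the natural isomorphism to the identity
  consists of the unique arrows out of \<open>x0\<close>.\<close>

lemma contractibleI:
  assumes x0: "x0 \<in> Obj C"
    and arr: "\<And>f. f \<in> Arr C \<Longrightarrow> Src C f \<in> Obj C \<and> Tgt C f \<in> Obj C"
    and ex1: "\<And>x y. x \<in> Obj C \<Longrightarrow> y \<in> Obj C \<Longrightarrow> \<exists>!f. f \<in> hom C x y"
    and unit: "\<And>x. x \<in> Obj C \<Longrightarrow> Unit C x \<in> hom C x x"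
    and comp: "\<And>x y z f g. f \<in> hom C x y \<Longrightarrow> g \<in> hom C y z \<Longrightarrow> Comp C g f \<in> hom C x z"
  shows "contractible_groupoid C"
proof -
  have ob: "x \<in> Obj C \<and> y \<in> Obj C" if "f \<in> hom C x y" for f x y using arr that by (auto simp: hom_def)
  have eq: "f = g" if "f \<in> hom C x y" "g \<in> hom C x y" for f g x y
    using ex1[of x y] ob[OF that(1)] that by blast
  have cat: "is_category C"
    unfolding is_category_def
  proof (intro conjI ballI)
    fix w x y z f g h assume f: "f \<in> hom C w x" and g: "g \<in> hom C x y" and h: "h \<in> hom C y z"
    show "Comp C h (Comp C g f) = Comp C (Comp C h g) f"
      by (rule eq[OF comp[OF comp[OF f g] h] comp[OF f comp[OF g h]]])
  next
    fix x y f assume x: "x \<in> Obj C" and y: "y \<in> Obj C" and f: "f \<in> hom C x y"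
    show "Comp C f (Unit C x) = f" by (rule eq[OF comp[OF unit[OF x] f] f])
    show "Comp C (Unit C y) f = f" by (rule eq[OF comp[OF f unit[OF y]] f])
  qed (use arr unit comp in blast)+
  have inv: "invertible C f" if f: "f \<in> Arr C" for f
  proof -
    let ?x = "Src C f" and ?y = "Tgt C f"
    have fh: "f \<in> hom C ?x ?y" using f by (simp add: hom_def)
    have x: "?x \<in> Obj C" and y: "?y \<in> Obj C" using arr[OF f] by auto
    obtain g where g: "g \<in> hom C ?y ?x" using ex1[OF y x] by blast
    have "Comp C g f = Unit C ?x" by (rule eq[OF comp[OF fh g] unit[OF x]])
    moreover have "Comp C f g = Unit C ?y" by (rule eq[OF comp[OF g fh] unit[OF y]])
    ultimately show ?thesis unfolding invertible_def using f g by blast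
  qed
  let ?F = "\<lparr>ob_map = (\<lambda>x\<in>Obj C. ()), arr_map = (\<lambda>f\<in>Arr C. ())\<rparr>"
  let ?G = "\<lparr>ob_map = (\<lambda>u\<in>(UNIV :: unit set). x0), arr_map = (\<lambda>u\<in>(UNIV :: unit set). Unit C x0)\<rparr>"
  note u0 = homD[OF unit[OF x0]]
  have F: "is_functor C terminal_groupoid ?F"
    by (auto simp: is_functor_def terminal_groupoid_def)
  have G: "is_functor terminal_groupoid C ?G"
    using x0 u0 eq[OF comp[OF unit[OF x0] unit[OF x0]] unit[OF x0]]
    by (auto simp: is_functor_def terminal_groupoid_def)
  have GF: "nat_isomorphic C C (comp_functor C ?G ?F) (id_functor C)"
    unfolding nat_isomorphic_def
  proof (intro exI conjI ballI)
    let ?t = "\<lambda>x. THE f. f \<in> hom C x0 x"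
    have t: "?t x \<in> hom C x0 x" if "x \<in> Obj C" for x by (rule theI'[OF ex1[OF x0 that]])
    show "?t x \<in> hom C (ob_map (comp_functor C ?G ?F) x) (ob_map (id_functor C) x)" if "x \<in> Obj C" for x
      using t[OF that] that by (simp add: comp_functor_def id_functor_def compose_def)
    show "invertible C (?t x)" if "x \<in> Obj C" for x using inv t[OF that] by (simp add: hom_def)
    fix f assume f: "f \<in> Arr C"
    have fh: "f \<in> hom C (Src C f) (Tgt C f)" using f by (simp add: hom_def)
    have "Comp C (?t (Tgt C f)) (Unit C x0) = Comp C f (?t (Src C f))"
      by (rule eq[OF comp[OF unit[OF x0] t] comp[OF t fh]]) (use arr[OF f] in auto)
    then show "Comp C (?t (Tgt C f)) (arr_map (comp_functor C ?G ?F) f) = Comp C (arr_map (id_functor C) f) (?t (Src C f))"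
      using f by (simp add: comp_functor_def id_functor_def compose_def)
  qed
  have FG: "nat_isomorphic terminal_groupoid terminal_groupoid (comp_functor terminal_groupoid ?F ?G) (id_functor terminal_groupoid)"
    unfolding nat_isomorphic_def by (auto simp: terminal_groupoid_def hom_def invertible_def)
  show ?thesis
    unfolding contractible_groupoid_def is_groupoid_def equivalent_def using cat inv F G GF FG by blast
qed

theorem theorem6p7:
  fixes X :: "('o, 'a) simplicial" and ch :: "'u choice"
  assumes "rigid_decomposition_groupoid X"
    and small: "\<And>n. Obj (level X n) \<lesssim> (UNIV :: 'u set)"
    and "factorisation_choice ch"
  shows "contractible_groupoid (mapping_groupoid X (U_groupoid ch))"
proof -
  \<comment> \<open>Smallness of the object sets relative to \<open>'u\<close> provides the codes
    from which the intervals are built.\<close>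
  have "\<forall>n. \<exists>e :: 'o \<Rightarrow> 'u. inj_on e (Obj (level X n))"
    using small unfolding lepoll_def by blast
  then obtain enc :: "nat \<Rightarrow> 'o \<Rightarrow> 'u" where enc: "\<And>n. inj_on (enc n) (Obj (level X n))"
    by metis
  interpret encoded X ch enc
    using assms(1,3) enc by unfold_locales (auto simp: rigid_decomposition_groupoid_def)
  let ?M = "mapping_groupoid X (U_groupoid ch)"
  \<comment> \<open>The comparisons in the two directions are mutually inverse: comparisons compose
    to comparisons, and the comparison of \<open>J\<close> with itself is the identity.\<close>
  have inv: "invertible_modification X U J J' (tmod J J')" if "scm J" "scm J'" for J J'
    unfolding invertible_modification_def
    using tmod_modification[OF that] tmod_modification[OF that(2,1)] mod_comp_tmod[OF that that(1)] mod_comp_tmod[OF that(2,1,2)]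
      mod_id_tmod[OF that(1)] mod_id_tmod[OF that(2)] by auto
  have hom: "hom ?M J J' = {(J, J', tmod J J')}" if "scm J" "scm J'" for J J'
    using inv[OF that] modification_unique[OF that] that
    by (auto simp: hom_def mapping_groupoid_def invertible_modification_def)
  have ob: "J \<in> Obj ?M \<longleftrightarrow> scm J" for J by (simp add: mapping_groupoid_def)
  have src: "scm J \<and> scm J'" if "f \<in> hom ?M J J'" for f J J'
    using that by (auto simp: hom_def mapping_groupoid_def)
  show ?thesis
  proof (rule contractibleI[where ?x0.0 = Jc])
    show "Jc \<in> Obj ?M" using Jc_strict_culf ob by simp
    show "Src ?M f \<in> Obj ?M \<and> Tgt ?M f \<in> Obj ?M" if "f \<in> Arr ?M" for f
      using that by (auto simp: mapping_groupoid_def)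
    show "\<exists>!f. f \<in> hom ?M J J'" if "J \<in> Obj ?M" "J' \<in> Obj ?M" for J J'
      using hom that ob by simp
    show "Unit ?M J \<in> hom ?M J J" if "J \<in> Obj ?M" for J
      using hom[of J J] that ob mod_id_tmod[of J] by (simp add: mapping_groupoid_def)
    show "Comp ?M g f \<in> hom ?M J J''" if f: "f \<in> hom ?M J J'" and g: "g \<in> hom ?M J' J''" for J J' J'' f g
    proof -
      have J: "scm J" "scm J'" "scm J''" using src[OF f] src[OF g] by auto
      have "f = (J, J', tmod J J')" "g = (J', J'', tmod J' J'')" using f g hom J by auto
      then show ?thesis unfolding hom[OF J(1,3)] using mod_comp_tmod[OF J] by (simp add: mapping_groupoid_def)
    qed
  qed
qed

end
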